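(* Let observations $X_1,\dots,X_T$ come from the model $X_t=f_t+\epsilon_t$, $t=1,\dots,T$, where $(f_t)$ is a fixed piecewise constant real signal with an unknown number $N$ of change points at unknown locations and $\epsilon_1,\dots,\epsilon_T$ are i.i.d. $\mathcal N(0,1)$. Fix a decay parameter $a\in[1/2,1)$ and a minimal segment length $m_0\ge2$. Consider seeded binary segmentation with decay $a$ and minimal segment length $m_0$ in which one determines the full solution path of the selection method (i.e. the segmentations obtained with all thresholds $\kappa$ that equal the maximal gain of some seeded interval) and then outputs the segmentation in the solution path having the best (smallest) value of the information criterion $$\tilde\eta_1<\cdots<\tilde\eta_m\ \mapsto\ \sum_{i=0}^{m}\ \sum_{t\in(\tilde\eta_i,\tilde\eta_{i+1}]}\bigl(\bar X_{(\tilde\eta_i,\tilde\eta_{i+1}]}-X_t\bigr)^2+\mathrm{PEN}(\{\tilde\eta_1,\dots,\tilde\eta_m\}),$$ where $\tilde\eta_0=0$, $\tilde\eta_{m+1}=T$, $\bar X_{(i,j]}=\frac1{j-i}\sum_{t=i+1}^{j}X_t$, and $\mathrm{PEN}$ is a real-valued penalty on finite sets of split points. Assume that, given the value $\mathrm{PEN}(S)$, the value $\mathrm{PEN}(S\cup\{\tilde\eta\})$ can be computed in $O(1)$ time, for every finite set of split points $S$ and every additional split point $\tilde\eta$. Then this procedure has memory complexity $O(T)$ and computational complexity $$\begin{cases}O(T\log T)&\text{if the selection method is the greedy selection},\\ O(T^2\log T)&\text{if the selection method is the narrowest over threshold selection.}\end{cases}$$ (These are worst-case bounds as functions of $T$,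 with implied constants not depending on the data or on $N$: there is an implementation which computes the output of the procedure within these time and memory bounds.)
   Context: Complexity is counted in the usual unit-cost model (arithmetic operations, comparisons and memory accesses on real numbers and on integers of size polynomial in $T$ cost $O(1)$; one number takes one unit of memory). The parameters $a,m_0$ are fixed. Seeded intervals. For $a\in[1/2,1)$ and $1\le k\le \lceil \log_{1/a}(T)\rceil$ let $n_k=2\lceil (1/a)^{k-1}\rceil-1$, $l_k=Ta^{k-1}$, $s_k=(T-l_k)/(n_k-1)$ (for $k=1$, where $n_1=1$, put $s_1=0$), and $$\mathcal I_k=\bigcup_{i=1}^{n_k}\{(\lfloor (i-1)s_k\rfloor,\ \lceil (i-1)s_k+l_k\rceil]\}.$$ The collection of seeded intervals is $\mathcal I=\bigcup_{k=1}^{\lceil\log_{1/a}(T)\rceil}\mathcal I_k$. With minimal segment length $m_0$, only those intervals $(\ell,r]\in\mathcal I$ with $r-\ell\ge m_0$ are kept; the resulting collection is again denoted $\mathcal I$. CUSUM statistics. For integers $0\le \ell<r\le T$, $n=r-\ell$ and $s\in\{\ell+1,\dots,r-1\}$, $$T_{(\ell,r]}(s)=\sqrt{\frac{r-s}{n(s-\ell)}}\sum_{t=\ell+1}^{s}X_t-\sqrt{\frac{s-\ell}{n(r-s)}}\sum_{t=s+1}^{r}X_t .$$ The best split of $(\ell,r]$ is $\hat s_{(\ell,r]}\in\arg\max_{s\in\{\ell+1,\dots,r-1\}}|T_{(\ell,r]}(s)|$, and $|T_{(\ell,r]}(\hat s_{(\ell,r]})|$ is the maximal gain of $(\ell,r]$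 (ties are broken by any fixed rule). Seeded binary segmentation: create $\mathcal I$, compute $T_{(\ell,r]}(s)$ for all $(\ell,r]\in\mathcal I$ and all $s\in\{\ell+1,\dots,r-1\}$ (and hence the best split and maximal gain of each interval), then apply a selection method, which outputs the estimated change points. Greedy selection with threshold $\kappa$: among the remaining intervals of $\mathcal I$ take one with the largest maximal gain; if this maximal gain exceeds $\kappa$, declare its best split a change point, delete from $\mathcal I$ all intervals that contain this change point, and repeat; stop when no remaining interval has maximal gain above $\kappa$. Narrowest over threshold selection with threshold $\kappa$: among the remaining intervals of $\mathcal I$ whose maximal gain exceeds $\kappa$ take a shortest one (smallest $r-\ell$); declare its best split a change point, delete from $\mathcal I$ all intervals that contain this change point, and repeat; stop when no remaining interval has maximal gain above $\kappa$. *)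

theory Defs
  imports "HOL-Probability.Probability" "HOL-Library.Landau_Symbols"
begin

section \<open>The change point model\<close>

definition change_point_model ::
  "'w measure \<Rightarrow> nat \<Rightarrow> (nat \<Rightarrow> real) \<Rightarrow> nat \<Rightarrow> (nat \<Rightarrow> 'w \<Rightarrow> real) \<Rightarrow> bool" where
  "change_point_model M T f N eps \<longleftrightarrow>
     prob_space M \<and>
     card {t \<in> {1..<T}. f t \<noteq> f (t + 1)} = N \<and>
     prob_space.indep_vars M (\<lambda>_. borel) eps {1..T} \<and>
     (\<forall>t\<in>{1..T}. distributed M lborel (eps t) std_normal_density)"


section \<open>Seeded intervals\<close>

text \<open>The pair \<open>(l, r)\<close> stands for the interval of integers \<open>t\<close> with \<open>l < t \<le> r\<close>.\<close>

type_synonym interval = "nat \<times> nat"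

definition seed_num :: "real \<Rightarrow> nat \<Rightarrow> nat" where
  "seed_num a k = 2 * nat \<lceil>(1 / a) ^ (k - 1)\<rceil> - 1"

definition seed_len :: "real \<Rightarrow> nat \<Rightarrow> nat \<Rightarrow> real" where
  "seed_len a T k = real T * a ^ (k - 1)"

definition seed_shift :: "real \<Rightarrow> nat \<Rightarrow> nat \<Rightarrow> real" where
  "seed_shift a T k =
     (if k = 1 then 0 else (real T - seed_len a T k) / (real (seed_num a k) - 1))"

definition seed_layer :: "real \<Rightarrow> nat \<Rightarrow> nat \<Rightarrow> interval set" where
  "seed_layer a T k =
     (\<lambda>i. (nat \<lfloor>(real i - 1) * seed_shift a T k\<rfloor>,
           nat \<lceil>(real i - 1) * seed_shift a T k + seed_len a T k\<rceil>)) ` {1..seed_num a k}"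

definition seeded_intervals :: "real \<Rightarrow> nat \<Rightarrow> nat \<Rightarrow> interval set" where
  "seeded_intervals a m0 T =
     {(l, r) \<in> (\<Union>k\<in>{1..nat \<lceil>log (1 / a) (real T)\<rceil>}. seed_layer a T k). m0 \<le> r - l}"


section \<open>CUSUM statistics, best splits and maximal gains\<close>

definition cusum :: "(nat \<Rightarrow> real) \<Rightarrow> interval \<Rightarrow> nat \<Rightarrow> real" where
  "cusum X = (\<lambda>(l, r) s.
     sqrt (real (r - s) / (real (r - l) * real (s - l))) * (\<Sum>t\<in>{l<..s}. X t)
   - sqrt (real (s - l) / (real (r - l) * real (r - s))) * (\<Sum>t\<in>{s<..r}. X t))"

text \<open>A tie-breaking rule picks one element from every nonempty finite set of tied
  candidates; it sees neither the data nor \<open>T\<close>.\<close>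

definition tie_rule :: "('b set \<Rightarrow> 'b) \<Rightarrow> bool" where
  "tie_rule \<tau> \<longleftrightarrow> (\<forall>A. finite A \<and> A \<noteq> {} \<longrightarrow> \<tau> A \<in> A)"

definition best_split :: "(nat set \<Rightarrow> nat) \<Rightarrow> (nat \<Rightarrow> real) \<Rightarrow> interval \<Rightarrow> nat" where
  "best_split \<sigma> X I =
     \<sigma> {s \<in> {fst I<..<snd I}. \<forall>s'\<in>{fst I<..<snd I}. \<bar>cusum X I s'\<bar> \<le> \<bar>cusum X I s\<bar>}"

definition max_gain :: "(nat set \<Rightarrow> nat) \<Rightarrow> (nat \<Rightarrow> real) \<Rightarrow> interval \<Rightarrow> real" where
  "max_gain \<sigma> X I = \<bar>cusum X I (best_split \<sigma> X I)\<bar>"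


section \<open>Selection methods, solution path and information criterion\<close>

datatype selection = Greedy | Narrowest

text \<open>\<open>candidates sel \<sigma> X \<kappa> R\<close> are the remaining intervals among which the selection method
  may pick the next one; it is empty iff the method stops.\<close>

definition candidates ::
  "selection \<Rightarrow> (nat set \<Rightarrow> nat) \<Rightarrow> (nat \<Rightarrow> real) \<Rightarrow> real \<Rightarrow> interval set \<Rightarrow> interval set" where
  "candidates sel \<sigma> X \<kappa> R = (case sel of
     Greedy \<Rightarrow> {I \<in> R. max_gain \<sigma> X I > \<kappa> \<and> (\<forall>J\<in>R. max_gain \<sigma> X J \<le> max_gain \<sigma> X I)}
   | Narrowest \<Rightarrow> {I \<in> R. max_gain \<sigma> X I > \<kappa> \<and>
        (\<forall>J\<in>R. max_gain \<sigma> X J > \<kappa> \<longrightarrow> snd I - fst I \<le> snd J - fst J)})"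

text \<open>\<open>selects sel \<sigma> \<pi> X \<kappa> R S\<close>: started with the intervals \<open>R\<close>, the selection method with
  threshold \<open>\<kappa>\<close> stops after declaring exactly the change points \<open>S\<close>.\<close>

inductive selects ::
  "selection \<Rightarrow> (nat set \<Rightarrow> nat) \<Rightarrow> (interval set \<Rightarrow> interval) \<Rightarrow> (nat \<Rightarrow> real) \<Rightarrow> real
    \<Rightarrow> interval set \<Rightarrow> nat set \<Rightarrow> bool"
  for sel \<sigma> \<pi> X \<kappa> where
  stop: "candidates sel \<sigma> X \<kappa> R = {} \<Longrightarrow> selects sel \<sigma> \<pi> X \<kappa> R {}"
| pick: "\<lbrakk>candidates sel \<sigma> X \<kappa> R \<noteq> {};
          \<eta> = best_split \<sigma> X (\<pi> (candidates sel \<sigma> X \<kappa> R));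
          selects sel \<sigma> \<pi> X \<kappa> {(l, r) \<in> R. \<not> (l < \<eta> \<and> \<eta> \<le> r)} S\<rbrakk>
         \<Longrightarrow> selects sel \<sigma> \<pi> X \<kappa> R (insert \<eta> S)"

definition solution_path ::
  "selection \<Rightarrow> (nat set \<Rightarrow> nat) \<Rightarrow> (interval set \<Rightarrow> interval) \<Rightarrow> (nat \<Rightarrow> real)
    \<Rightarrow> interval set \<Rightarrow> nat set set" where
  "solution_path sel \<sigma> \<pi> X \<I> = {S. \<exists>\<kappa>\<in>max_gain \<sigma> X ` \<I>. selects sel \<sigma> \<pi> X \<kappa> \<I> S}"

definition segment_mean :: "(nat \<Rightarrow> real) \<Rightarrow> nat \<Rightarrow> nat \<Rightarrow> real" where
  "segment_mean X i j = (\<Sum>t\<in>{i<..j}. X t) / real (j - i)"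

definition info_criterion ::
  "(nat set \<Rightarrow> real) \<Rightarrow> nat \<Rightarrow> (nat \<Rightarrow> real) \<Rightarrow> nat set \<Rightarrow> real" where
  "info_criterion PEN T X S =
     (let \<eta> = (\<lambda>i. (0 # sorted_list_of_set S @ [T]) ! i) in
       (\<Sum>i = 0..card S. \<Sum>t\<in>{\<eta> i<..\<eta> (i + 1)}. (segment_mean X (\<eta> i) (\<eta> (i + 1)) - X t)\<^sup>2)
       + PEN S)"

text \<open>\<open>S\<close> is an output of the whole procedure (a minimiser of the criterion over the solution path).\<close>

definition sbs_output ::
  "selection \<Rightarrow> (nat set \<Rightarrow> nat) \<Rightarrow> (interval set \<Rightarrow> interval) \<Rightarrow> real \<Rightarrow> nat
    \<Rightarrow> (nat set \<Rightarrow> real) \<Rightarrow> nat \<Rightarrow> (nat \<Rightarrow> real) \<Rightarrow> nat set \<Rightarrow> bool" where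
  "sbs_output sel \<sigma> \<pi> a m0 PEN T X S \<longleftrightarrow>
     (let P = solution_path sel \<sigma> \<pi> X (seeded_intervals a m0 T) in
       S \<in> P \<and> (\<forall>S'\<in>P. info_criterion PEN T X S \<le> info_criterion PEN T X S'))"

text \<open>\<open>upd S v \<eta>\<close> yields the penalty of \<open>S \<union> {\<eta>}\<close> whenever it is given the correct
  penalty \<open>v\<close> of \<open>S\<close>; nothing is known about it for other \<open>v\<close>.\<close>

definition pen_update ::
  "nat \<Rightarrow> (nat set \<Rightarrow> real) \<Rightarrow> (nat set \<Rightarrow> real \<Rightarrow> nat \<Rightarrow> real) \<Rightarrow> bool" where
  "pen_update T PEN upd \<longleftrightarrow>
     (\<forall>S \<eta>. S \<subseteq> {1..<T} \<and> \<eta> \<in> {1..<T} - S \<longrightarrow> upd S (PEN S) \<eta> = PEN (insert \<eta> S))"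


section \<open>Unit-cost random access machine\<close>

text \<open>
  A program is a while-program whose memory consists of cells \<open>x[i]\<close>, each holding one integer
  or one real number (a scalar is \<open>x[0]\<close>). Every operation, comparison, memory access and
  branching costs one unit of time. Program literals are integers, there is no rounding
  of reals to integers, and no root or logarithm is available. An execution exists only
  if all integers that occur are bounded in absolute value by \<open>W\<close> and all addresses are
  nonnegative.
\<close>

type_synonym vname = string

datatype iexp =
    Num int
  | ICell vname iexp
  | IAdd iexp iexp
  | ISub iexp iexp
  | IMul iexp iexp
  | IDiv iexp iexp

datatype rexp =
    RCell vname iexp
  | OfInt iexp
  | RAdd rexp rexp
  | RSub rexp rexp
  | RMul rexp rexp
  | RDiv rexp rexp

datatype bexp =
    ILe iexp iexp
  | RLe rexp rexp
  | Neg bexp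
  | Conj bexp bexp

text \<open>\<open>PenUpd x i p n v h\<close> is the call \<open>x[i] := upd {p[0], \<dots>, p[n-1]} v h\<close> of the
  penalty update.\<close>

datatype com =
    Skip
  | IAssign vname iexp iexp
  | RAssign vname iexp rexp
  | PenUpd vname iexp vname iexp rexp iexp
  | Seq com com
  | Cond bexp com com
  | While bexp com

record state =
  ints :: "vname \<Rightarrow> nat \<Rightarrow> int"
  reals :: "vname \<Rightarrow> nat \<Rightarrow> real"

datatype addr = IAddr vname nat | RAddr vname nat

fun ival :: "state \<Rightarrow> iexp \<Rightarrow> int" where
  "ival s (Num n) = n"
| "ival s (ICell x i) = ints s x (nat (ival s i))"
| "ival s (IAdd e1 e2) = ival s e1 + ival s e2"
| "ival s (ISub e1 e2) = ival s e1 - ival s e2"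
| "ival s (IMul e1 e2) = ival s e1 * ival s e2"
| "ival s (IDiv e1 e2) = ival s e1 div ival s e2"

fun rval :: "state \<Rightarrow> rexp \<Rightarrow> real" where
  "rval s (RCell x i) = reals s x (nat (ival s i))"
| "rval s (OfInt e) = real_of_int (ival s e)"
| "rval s (RAdd e1 e2) = rval s e1 + rval s e2"
| "rval s (RSub e1 e2) = rval s e1 - rval s e2"
| "rval s (RMul e1 e2) = rval s e1 * rval s e2"
| "rval s (RDiv e1 e2) = rval s e1 / rval s e2"

fun bval :: "state \<Rightarrow> bexp \<Rightarrow> bool" where
  "bval s (ILe e1 e2) = (ival s e1 \<le> ival s e2)"
| "bval s (RLe e1 e2) = (rval s e1 \<le> rval s e2)"
| "bval s (Neg b) = (\<not> bval s b)"
| "bval s (Conj b1 b2) = (bval s b1 \<and> bval s b2)"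

fun isafe :: "int \<Rightarrow> state \<Rightarrow> iexp \<Rightarrow> bool" where
  "isafe W s (Num n) = (\<bar>n\<bar> \<le> W)"
| "isafe W s (ICell x i) =
     (isafe W s i \<and> 0 \<le> ival s i \<and> \<bar>ival s (ICell x i)\<bar> \<le> W)"
| "isafe W s (IAdd e1 e2) = (isafe W s e1 \<and> isafe W s e2 \<and> \<bar>ival s (IAdd e1 e2)\<bar> \<le> W)"
| "isafe W s (ISub e1 e2) = (isafe W s e1 \<and> isafe W s e2 \<and> \<bar>ival s (ISub e1 e2)\<bar> \<le> W)"
| "isafe W s (IMul e1 e2) = (isafe W s e1 \<and> isafe W s e2 \<and> \<bar>ival s (IMul e1 e2)\<bar> \<le> W)"
| "isafe W s (IDiv e1 e2) =
     (isafe W s e1 \<and> isafe W s e2 \<and> ival s e2 \<noteq> 0 \<and> \<bar>ival s (IDiv e1 e2)\<bar> \<le> W)"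

fun rsafe :: "int \<Rightarrow> state \<Rightarrow> rexp \<Rightarrow> bool" where
  "rsafe W s (RCell x i) = (isafe W s i \<and> 0 \<le> ival s i)"
| "rsafe W s (OfInt e) = isafe W s e"
| "rsafe W s (RAdd e1 e2) = (rsafe W s e1 \<and> rsafe W s e2)"
| "rsafe W s (RSub e1 e2) = (rsafe W s e1 \<and> rsafe W s e2)"
| "rsafe W s (RMul e1 e2) = (rsafe W s e1 \<and> rsafe W s e2)"
| "rsafe W s (RDiv e1 e2) = (rsafe W s e1 \<and> rsafe W s e2 \<and> rval s e2 \<noteq> 0)"

fun bsafe :: "int \<Rightarrow> state \<Rightarrow> bexp \<Rightarrow> bool" where
  "bsafe W s (ILe e1 e2) = (isafe W s e1 \<and> isafe W s e2)"
| "bsafe W s (RLe e1 e2) = (rsafe W s e1 \<and> rsafe W s e2)"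
| "bsafe W s (Neg b) = bsafe W s b"
| "bsafe W s (Conj b1 b2) = (bsafe W s b1 \<and> bsafe W s b2)"

fun itime :: "iexp \<Rightarrow> nat" where
  "itime (Num n) = 1"
| "itime (ICell x i) = 1 + itime i"
| "itime (IAdd e1 e2) = 1 + itime e1 + itime e2"
| "itime (ISub e1 e2) = 1 + itime e1 + itime e2"
| "itime (IMul e1 e2) = 1 + itime e1 + itime e2"
| "itime (IDiv e1 e2) = 1 + itime e1 + itime e2"

fun rtime :: "rexp \<Rightarrow> nat" where
  "rtime (RCell x i) = 1 + itime i"
| "rtime (OfInt e) = 1 + itime e"
| "rtime (RAdd e1 e2) = 1 + rtime e1 + rtime e2"
| "rtime (RSub e1 e2) = 1 + rtime e1 + rtime e2"
| "rtime (RMul e1 e2) = 1 + rtime e1 + rtime e2"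
| "rtime (RDiv e1 e2) = 1 + rtime e1 + rtime e2"

fun btime :: "bexp \<Rightarrow> nat" where
  "btime (ILe e1 e2) = 1 + itime e1 + itime e2"
| "btime (RLe e1 e2) = 1 + rtime e1 + rtime e2"
| "btime (Neg b) = 1 + btime b"
| "btime (Conj b1 b2) = 1 + btime b1 + btime b2"

text \<open>Memory cells accessed by an expression.\<close>

fun icells :: "state \<Rightarrow> iexp \<Rightarrow> addr set" where
  "icells s (Num n) = {}"
| "icells s (ICell x i) = insert (IAddr x (nat (ival s i))) (icells s i)"
| "icells s (IAdd e1 e2) = icells s e1 \<union> icells s e2"
| "icells s (ISub e1 e2) = icells s e1 \<union> icells s e2"
| "icells s (IMul e1 e2) = icells s e1 \<union> icells s e2"
| "icells s (IDiv e1 e2) = icells s e1 \<union> icells s e2"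

fun rcells :: "state \<Rightarrow> rexp \<Rightarrow> addr set" where
  "rcells s (RCell x i) = insert (RAddr x (nat (ival s i))) (icells s i)"
| "rcells s (OfInt e) = icells s e"
| "rcells s (RAdd e1 e2) = rcells s e1 \<union> rcells s e2"
| "rcells s (RSub e1 e2) = rcells s e1 \<union> rcells s e2"
| "rcells s (RMul e1 e2) = rcells s e1 \<union> rcells s e2"
| "rcells s (RDiv e1 e2) = rcells s e1 \<union> rcells s e2"

fun bcells :: "state \<Rightarrow> bexp \<Rightarrow> addr set" where
  "bcells s (ILe e1 e2) = icells s e1 \<union> icells s e2"
| "bcells s (RLe e1 e2) = rcells s e1 \<union> rcells s e2"
| "bcells s (Neg b) = bcells s b"
| "bcells s (Conj b1 b2) = bcells s b1 \<union> bcells s b2"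

definition set_int :: "vname \<Rightarrow> nat \<Rightarrow> int \<Rightarrow> state \<Rightarrow> state" where
  "set_int x i v s = s\<lparr>ints := (ints s)(x := (ints s x)(i := v))\<rparr>"

definition set_real :: "vname \<Rightarrow> nat \<Rightarrow> real \<Rightarrow> state \<Rightarrow> state" where
  "set_real x i v s = s\<lparr>reals := (reals s)(x := (reals s x)(i := v))\<rparr>"

text \<open>\<open>exec W upd c prog s s' t A\<close>: started in state \<open>s\<close>, the program terminates in state \<open>s'\<close>
  after \<open>t\<close> units of time, and \<open>A\<close> is the set of all memory cells it has read or written.
  One call of the penalty update \<open>upd\<close> takes time \<open>c\<close>.\<close>

inductive exec ::
  "int \<Rightarrow> (nat set \<Rightarrow> real \<Rightarrow> nat \<Rightarrow> real) \<Rightarrow> nat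
    \<Rightarrow> com \<Rightarrow> state \<Rightarrow> state \<Rightarrow> nat \<Rightarrow> addr set \<Rightarrow> bool"
  for W upd c where
  Skip: "exec W upd c Skip s s 1 {}"
| IAssign: "\<lbrakk>isafe W s i; 0 \<le> ival s i; isafe W s e\<rbrakk> \<Longrightarrow>
    exec W upd c (IAssign x i e) s (set_int x (nat (ival s i)) (ival s e) s)
      (1 + itime i + itime e)
      (insert (IAddr x (nat (ival s i))) (icells s i \<union> icells s e))"
| RAssign: "\<lbrakk>isafe W s i; 0 \<le> ival s i; rsafe W s e\<rbrakk> \<Longrightarrow>
    exec W upd c (RAssign x i e) s (set_real x (nat (ival s i)) (rval s e) s)
      (1 + itime i + rtime e)
      (insert (RAddr x (nat (ival s i))) (icells s i \<union> rcells s e))"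
| PenUpd: "\<lbrakk>isafe W s i; 0 \<le> ival s i; isafe W s n; 0 \<le> ival s n; rsafe W s v;
            isafe W s h; 0 \<le> ival s h\<rbrakk> \<Longrightarrow>
    exec W upd c (PenUpd x i p n v h) s
      (set_real x (nat (ival s i))
        (upd ((\<lambda>j. nat (ints s p j)) ` {..<nat (ival s n)}) (rval s v) (nat (ival s h))) s)
      (1 + c + itime i + itime n + rtime v + itime h)
      (insert (RAddr x (nat (ival s i)))
        (IAddr p ` {..<nat (ival s n)} \<union> icells s i \<union> icells s n \<union> rcells s v \<union> icells s h))"
| Seq: "\<lbrakk>exec W upd c c1 s1 s2 t1 A1; exec W upd c c2 s2 s3 t2 A2\<rbrakk> \<Longrightarrow>
    exec W upd c (Seq c1 c2) s1 s3 (t1 + t2) (A1 \<union> A2)"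
| CondTrue: "\<lbrakk>bsafe W s b; bval s b; exec W upd c c1 s s' t A\<rbrakk> \<Longrightarrow>
    exec W upd c (Cond b c1 c2) s s' (1 + btime b + t) (bcells s b \<union> A)"
| CondFalse: "\<lbrakk>bsafe W s b; \<not> bval s b; exec W upd c c2 s s' t A\<rbrakk> \<Longrightarrow>
    exec W upd c (Cond b c1 c2) s s' (1 + btime b + t) (bcells s b \<union> A)"
| WhileFalse: "\<lbrakk>bsafe W s b; \<not> bval s b\<rbrakk> \<Longrightarrow>
    exec W upd c (While b c1) s s (1 + btime b) (bcells s b)"
| WhileTrue: "\<lbrakk>bsafe W s b; bval s b; exec W upd c c1 s s1 t1 A1;
               exec W upd c (While b c1) s1 s2 t2 A2\<rbrakk> \<Longrightarrow>
    exec W upd c (While b c1) s s2 (1 + btime b + t1 + t2) (bcells s b \<union> A1 \<union> A2)"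

inductive_cases SkipE: "exec W upd c Skip s s' t A"
inductive_cases IAssignE: "exec W upd c (IAssign x i e) s s' t A"
inductive_cases RAssignE: "exec W upd c (RAssign x i e) s s' t A"
inductive_cases PenUpdE: "exec W upd c (PenUpd x i p n v h) s s' t A"
inductive_cases SeqE: "exec W upd c (Seq c1 c2) s s' t A"
inductive_cases CondE: "exec W upd c (Cond b c1 c2) s s' t A"
inductive_cases WhileE: "exec W upd c (While b c1) s s' t A"

text \<open>Executions are deterministic, so the existence of one with given properties means that the
  run of the program has them; and the set of accessed cells is finite.\<close>

lemma exec_deterministic:
  assumes "exec W upd c p s s1 t1 A1" and "exec W upd c p s s2 t2 A2"
  shows "s1 = s2 \<and> t1 = t2 \<and> A1 = A2"
  using assms
proof (induction arbitrary: s2 t2 A2 rule: exec.induct)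
  case (Skip s)
  then show ?case by (auto elim: SkipE)
next
  case (IAssign s i e x)
  from IAssign(4) show ?case by (auto elim: IAssignE)
next
  case (RAssign s i e x)
  from RAssign(4) show ?case by (auto elim: RAssignE)
next
  case (PenUpd s i n v h x p)
  from PenUpd(8) show ?case by (auto elim: PenUpdE)
next
  case (Seq c1 sa sb ta Aa c2 sc tb Ab)
  from Seq.prems show ?case
  proof (rule SeqE)
    fix s2' t1' A1' t2' A2'
    assume "exec W upd c c1 sa s2' t1' A1'" "exec W upd c c2 s2' s2 t2' A2'"
      "t2 = t1' + t2'" "A2 = A1' \<union> A2'"
    then show ?thesis using Seq.IH by metis
  qed
next
  case (CondTrue s b p1 s' t A p2)
  obtain u B where "t2 = 1 + btime b + u" "A2 = bcells s b \<union> B" "exec W upd c p1 s s2 u B"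
    using CondTrue.prems CondTrue.hyps by (auto elim: CondE)
  with CondTrue.IH[of s2 u B] show ?case by simp
next
  case (CondFalse s b p2 s' t A p1)
  obtain u B where "t2 = 1 + btime b + u" "A2 = bcells s b \<union> B" "exec W upd c p2 s s2 u B"
    using CondFalse.prems CondFalse.hyps by (auto elim: CondE)
  with CondFalse.IH[of s2 u B] show ?case by simp
next
  case (WhileFalse s b p1)
  from WhileFalse.prems WhileFalse.hyps show ?case by (auto elim: WhileE)
next
  case (WhileTrue s b p1 sa ta Aa sb tb Ab)
  obtain sa' u B v B' where *: "t2 = 1 + btime b + u + v" "A2 = bcells s b \<union> B \<union> B'"
    "exec W upd c p1 s sa' u B" "exec W upd c (While b p1) sa' s2 v B'"
    by (rule WhileE[OF WhileTrue.prems]) (use WhileTrue.hyps in auto)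
  have 1: "sa = sa' \<and> ta = u \<and> Aa = B"
    using WhileTrue.IH(1)[OF *(3)] .
  have "sb = s2 \<and> tb = v \<and> Ab = B'"
    using WhileTrue.IH(2) *(4) 1 by blast
  with 1 *(1,2) show ?case by simp
qed

lemma finite_icells: "finite (icells s e)"
  by (induction e) auto

lemma finite_rcells: "finite (rcells s e)"
  by (induction e) (auto simp: finite_icells)

lemma finite_bcells: "finite (bcells s b)"
  by (induction b) (auto simp: finite_icells finite_rcells)

lemma exec_finite_cells: "exec W upd c p s s' t A \<Longrightarrow> finite A"
  by (induction rule: exec.induct) (auto simp: finite_icells finite_rcells finite_bcells)

text \<open>The input consists of \<open>T\<close>, \<open>m0\<close>, \<open>a\<close>, the data \<open>X[1], \<dots>, X[T]\<close> and the penalty \<open>p0\<close> of the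
  empty segmentation, from which the penalties of all other segmentations are obtained by updates.\<close>

definition input_state :: "real \<Rightarrow> nat \<Rightarrow> nat \<Rightarrow> (nat \<Rightarrow> real) \<Rightarrow> real \<Rightarrow> state" where
  "input_state a m0 T X p0 =
     \<lparr>ints = (\<lambda>x i. if x = ''T'' \<and> i = 0 then int T
                    else if x = ''m0'' \<and> i = 0 then int m0 else 0),
      reals = (\<lambda>x i. if x = ''X'' \<and> i \<in> {1..T} then X i
                     else if x = ''a'' \<and> i = 0 then a
                     else if x = ''pen'' \<and> i = 0 then p0 else 0)\<rparr>"

text \<open>The number of split points is returned in \<open>m[0]\<close>, the split points, in increasing order, in
  \<open>out[0], out[1], \<dots>\<close>.\<close>

definition outputs :: "state \<Rightarrow> nat set \<Rightarrow> bool" where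
  "outputs s S \<longleftrightarrow> ints s ''m'' 0 = int (card S) \<and>
     (\<forall>i<card S. ints s ''out'' i = int (sorted_list_of_set S ! i))"

end

theory Submission
  imports Defs "HOL-Library.Log_Nat"
begin

text \<open>
  Only comparisons of squared gains are needed, and the square of the CUSUM statistic is a rational
  function of prefix sums; so all best splits and gains cost as many steps as the total length of the
  seeded intervals, which is \<open>O(T log T)\<close>: each of the \<open>O(log T)\<close> layers contributes \<open>O(T)\<close>, and there
  are \<open>O(T)\<close> intervals by a geometric sum. The intervals are then sorted once, by decreasing gain or
  by increasing length, ties being broken lexicographically. With this order, selection with
  threshold \<open>\<kappa>\<close> is a single pass over the list that accepts an interval iff its gain exceeds \<open>\<kappa>\<close> and it
  contains no earlier change point; testing the latter by walking through the interval again costs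
  only the total length.

  For the narrowest-over-threshold method such a pass is made for each of the \<open>O(T)\<close> thresholds. For the
  greedy method the segmentations are nested: all of them are prefixes of the result for the smallest
  threshold. Deleting its split points from last to first in a doubly linked list updates the residual
  sum of squares in constant time per deletion.
\<close>

text \<open>The tie-breaking rules are part of the construction. A rule sees only the set of tied
  candidates, so the sort compares end points and not list positions. The generated list may repeat
  an interval; this is harmless, since an accepted interval contains its own split and thereby
  blocks its copies.

  The greedy search needs two directions. The penalty can be updated only when a point is added,
  whereas the linked list gives the two neighbours of a point in constant time only when points are
  removed. So the forward pass records the penalty of every prefix, and the backward pass maintains
  the residual sum of squares.

  Either search remembers only the best threshold, never a segmentation; the output is recomputed
  from that threshold, which keeps the memory linear.

  All integers stay below a bound \<open>W\<close> that is linear in \<open>T\<close>, and the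
  number of variable names does not depend on \<open>T\<close>; together this is the whole memory
  bound. The machine has no roots, logarithms or rounding, hence squared gains, the loop guard
  \<open>(1/a)^k < T\<close> in place of the number of layers, and roundings found by
  counting.\<close>

abbreviation IV :: "vname \<Rightarrow> iexp" where "IV x \<equiv> ICell x (Num 0)"
abbreviation RV :: "vname \<Rightarrow> rexp" where "RV x \<equiv> RCell x (Num 0)"
abbreviation ILt :: "iexp \<Rightarrow> iexp \<Rightarrow> bexp" where "ILt d e \<equiv> Neg (ILe e d)"
abbreviation RLt :: "rexp \<Rightarrow> rexp \<Rightarrow> bexp" where "RLt d e \<equiv> Neg (RLe e d)"
abbreviation Disj :: "bexp \<Rightarrow> bexp \<Rightarrow> bexp" where "Disj b b' \<equiv> Neg (Conj (Neg b) (Neg b'))"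
abbreviation ISet :: "vname \<Rightarrow> iexp \<Rightarrow> com" where "ISet x e \<equiv> IAssign x (Num 0) e"
abbreviation RSet :: "vname \<Rightarrow> rexp \<Rightarrow> com" where "RSet x e \<equiv> RAssign x (Num 0) e"
notation Seq (infixr ";;" 60)

section \<open>Reasoning about programs\<close>

text \<open>A loop is charged one guard and one body, a conditional both branches; repetition enters
  only through the factor \<open>1 + n\<close> in \<open>run\<close>.\<close>

fun step_cost :: "nat \<Rightarrow> com \<Rightarrow> nat" where
  "step_cost c Skip = 1"
| "step_cost c (IAssign x i e) = 1 + itime i + itime e"
| "step_cost c (RAssign x i e) = 1 + itime i + rtime e"
| "step_cost c (PenUpd x i p n v h) = 1 + c + itime i + itime n + rtime v + itime h"
| "step_cost c (p ;; q) = step_cost c p + step_cost c q"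
| "step_cost c (Cond b p q) = 1 + btime b + step_cost c p + step_cost c q"
| "step_cost c (While b p) = 1 + btime b + step_cost c p"

fun int_vars :: "com \<Rightarrow> vname set" where
  "int_vars (IAssign x i e) = {x}"
| "int_vars (p ;; q) = int_vars p \<union> int_vars q"
| "int_vars (Cond b p q) = int_vars p \<union> int_vars q"
| "int_vars (While b p) = int_vars p"
| "int_vars _ = {}"

fun real_vars :: "com \<Rightarrow> vname set" where
  "real_vars (RAssign x i e) = {x}"
| "real_vars (PenUpd x i p n v h) = {x}"
| "real_vars (p ;; q) = real_vars p \<union> real_vars q"
| "real_vars (Cond b p q) = real_vars p \<union> real_vars q"
| "real_vars (While b p) = real_vars p"
| "real_vars _ = {}"

text \<open>The frame condition, read off from the syntax. The composition and loop rules hand it to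
  the user, so that an invariant need mention only what its loop modifies.\<close>

definition unchanged :: "com \<Rightarrow> state \<Rightarrow> state \<Rightarrow> bool" where
  "unchanged p s s' \<longleftrightarrow> (\<forall>x. x \<notin> int_vars p \<longrightarrow> ints s' x = ints s x) \<and>
     (\<forall>x. x \<notin> real_vars p \<longrightarrow> reals s' x = reals s x)"

lemma unchanged_ints: "unchanged p s s' \<Longrightarrow> x \<notin> int_vars p \<Longrightarrow> ints s' x = ints s x"
  and unchanged_reals: "unchanged p s s' \<Longrightarrow> x \<notin> real_vars p \<Longrightarrow> reals s' x = reals s x"
  by (auto simp: unchanged_def)

lemma ints_set_int: "ints (set_int x i v s) = (ints s)(x := (ints s x)(i := v))"
  and ints_set_real: "ints (set_real x i w s) = ints s"
  and reals_set_int: "reals (set_int x i v s) = reals s"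
  and reals_set_real: "reals (set_real x i w s) = (reals s)(x := (reals s x)(i := w))"
  by (simp_all add: set_int_def set_real_def)

lemmas state_simps = ints_set_int ints_set_real reals_set_int reals_set_real

lemma exec_unchanged: "exec W upd c p s s' t A \<Longrightarrow> unchanged p s s'"
  by (induction rule: exec.induct) (auto simp: unchanged_def state_simps)

text \<open>Since the time of a pass through straight-line code is at most its syntactic size, the
  running time is governed by the number \<open>n\<close> of loop iterations.\<close>

definition run :: "int \<Rightarrow> (nat set \<Rightarrow> real \<Rightarrow> nat \<Rightarrow> real) \<Rightarrow> nat \<Rightarrow>
    com \<Rightarrow> state \<Rightarrow> nat \<Rightarrow> (state \<Rightarrow> bool) \<Rightarrow> bool" where
  "run W upd c p s n Q \<longleftrightarrow>
     (\<exists>s' t A. exec W upd c p s s' t A \<and> t \<le> step_cost c p * (1 + n) \<and> Q s')"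

lemma run_conseq:
  assumes "run W upd c p s n Q" "n \<le> n'" "\<And>s'. unchanged p s s' \<Longrightarrow> Q s' \<Longrightarrow> Q' s'"
  shows "run W upd c p s n' Q'"
proof -
  obtain s' t A where *: "exec W upd c p s s' t A" "t \<le> step_cost c p * (1 + n)" "Q s'"
    using assms(1) by (auto simp: run_def)
  have "t \<le> step_cost c p * (1 + n')"
    using *(2) assms(2) by (meson add_left_mono le_trans mult_le_mono2)
  then show ?thesis
    using * assms(3) exec_unchanged unfolding run_def by blast
qed

text \<open>Iteration counts simply add, because
  \<open>x * (1 + m) + y * (1 + n) \<le> (x + y) * (1 + (m + n))\<close>.\<close>

lemma run_Seq:
  assumes "run W upd c p s m Q" "\<And>s'. unchanged p s s' \<Longrightarrow> Q s' \<Longrightarrow> run W upd c q s' n R"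
  shows "run W upd c (p ;; q) s (m + n) R"
proof -
  obtain s1 t1 A1 where 1: "exec W upd c p s s1 t1 A1" "t1 \<le> step_cost c p * (1 + m)" "Q s1"
    using assms(1) by (auto simp: run_def)
  obtain s2 t2 A2 where 2: "exec W upd c q s1 s2 t2 A2" "t2 \<le> step_cost c q * (1 + n)" "R s2"
    using assms(2)[OF exec_unchanged[OF 1(1)] 1(3)] by (auto simp: run_def)
  have "t1 \<le> step_cost c p * (1 + (m + n))" "t2 \<le> step_cost c q * (1 + (m + n))"
    using 1(2) 2(2) by (simp_all add: algebra_simps)
  then have "t1 + t2 \<le> step_cost c (p ;; q) * (1 + (m + n))"
    by (simp add: algebra_simps)
  then show ?thesis
    using exec.Seq[OF 1(1) 2(1)] 2(3) unfolding run_def by blast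
qed

text \<open>Weakest preconditions for loop-free code. The value \<open>False\<close> on loops makes
  \<open>run_wp\<close> void for them, so every loop has to go through \<open>run_While\<close> or
  \<open>run_for\<close>.\<close>

fun wp :: "int \<Rightarrow> (nat set \<Rightarrow> real \<Rightarrow> nat \<Rightarrow> real) \<Rightarrow> com \<Rightarrow> (state \<Rightarrow> bool) \<Rightarrow> state \<Rightarrow> bool" where
  "wp W upd Skip Q s = Q s"
| "wp W upd (IAssign x i e) Q s =
     (isafe W s i \<and> 0 \<le> ival s i \<and> isafe W s e \<and> Q (set_int x (nat (ival s i)) (ival s e) s))"
| "wp W upd (RAssign x i e) Q s =
     (isafe W s i \<and> 0 \<le> ival s i \<and> rsafe W s e \<and> Q (set_real x (nat (ival s i)) (rval s e) s))"
| "wp W upd (PenUpd x i p n v h) Q s =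
     (isafe W s i \<and> 0 \<le> ival s i \<and> isafe W s n \<and> 0 \<le> ival s n \<and> rsafe W s v \<and>
      isafe W s h \<and> 0 \<le> ival s h \<and>
      Q (set_real x (nat (ival s i))
        (upd ((\<lambda>j. nat (ints s p j)) ` {..<nat (ival s n)}) (rval s v) (nat (ival s h))) s))"
| "wp W upd (p ;; q) Q s = wp W upd p (wp W upd q Q) s"
| "wp W upd (Cond b p q) Q s =
     (bsafe W s b \<and> (bval s b \<longrightarrow> wp W upd p Q s) \<and> (\<not> bval s b \<longrightarrow> wp W upd q Q s))"
| "wp W upd (While b p) Q s = False"

lemma wp_exec: "wp W upd p Q s \<Longrightarrow> \<exists>s' t A. exec W upd c p s s' t A \<and> t \<le> step_cost c p \<and> Q s'"
proof (induction p arbitrary: s Q)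
  case Skip
  then show ?case by (fastforce intro: exec.intros)
next
  case (IAssign x i e)
  then show ?case
    using exec.IAssign[of W s i e upd c x] by auto
next
  case (RAssign x i e)
  then show ?case
    using exec.RAssign[of W s i e upd c x] by auto
next
  case (PenUpd x i p n v h)
  then show ?case
    using exec.PenUpd[of W s i n v h upd c x p] by auto
next
  case (Seq p q)
  have "wp W upd p (wp W upd q Q) s" using Seq.prems by simp
  then obtain s1 t1 A1 where 1: "exec W upd c p s s1 t1 A1" "t1 \<le> step_cost c p" "wp W upd q Q s1"
    using Seq.IH(1) by blast
  from Seq.IH(2)[OF 1(3)] obtain s2 t2 A2
    where 2: "exec W upd c q s1 s2 t2 A2" "t2 \<le> step_cost c q" "Q s2" by blast
  show ?case
    using exec.Seq[OF 1(1) 2(1)] 1(2) 2(2,3) by (metis add_mono step_cost.simps(5))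
next
  case (Cond b p q)
  show ?case
  proof (cases "bval s b")
    case True
    then have "wp W upd p Q s" using Cond.prems by simp
    then obtain s' t A where 1: "exec W upd c p s s' t A" "t \<le> step_cost c p" "Q s'"
      using Cond.IH(1) by blast
    have "exec W upd c (Cond b p q) s s' (1 + btime b + t) (bcells s b \<union> A)"
      using exec.CondTrue 1(1) True Cond.prems by simp
    then show ?thesis using 1(2,3)
      by (metis (no_types, lifting) add_le_mono le_add1 le_trans nat_add_left_cancel_le step_cost.simps(6))
  next
    case False
    then have "wp W upd q Q s" using Cond.prems by simp
    then obtain s' t A where 1: "exec W upd c q s s' t A" "t \<le> step_cost c q" "Q s'"
      using Cond.IH(2) by blast
    have 2: "exec W upd c (Cond b p q) s s' (1 + btime b + t) (bcells s b \<union> A)"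
      using exec.CondFalse 1(1) False Cond.prems by simp
    have "1 + btime b + t \<le> step_cost c (Cond b p q)" using 1(2) by simp
    then show ?thesis using 1(3) 2 by blast
  qed
qed simp

lemma run_wp: "wp W upd p Q s \<Longrightarrow> run W upd c p s n Q"
  unfolding run_def using wp_exec[of W upd p Q s c] by (fastforce intro: order_trans)

text \<open>The ghost value \<open>g\<close> describes the progress of the loop; \<open>\<Phi> g\<close> bounds the number of iterations,
  those of inner loops included, that are still to come.\<close>

lemma run_While:
  assumes inv: "I g s0"
    and safe: "\<And>g s. I g s \<Longrightarrow> unchanged p s0 s \<Longrightarrow> bsafe W s b"
    and body: "\<And>g s. I g s \<Longrightarrow> unchanged p s0 s \<Longrightarrow> bval s b \<Longrightarrow>
       run W upd c p s (f g) (\<lambda>s'. \<exists>g'. I g' s' \<and> \<Phi> g' + f g + 1 \<le> \<Phi> g)"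
    and exit: "\<And>g s. I g s \<Longrightarrow> unchanged p s0 s \<Longrightarrow> \<not> bval s b \<Longrightarrow> Q s"
  shows "run W upd c (While b p) s0 (\<Phi> g) Q"
proof -
  have *: "I g s \<Longrightarrow> unchanged p s0 s \<Longrightarrow> run W upd c (While b p) s (\<Phi> g) Q" for s
  proof (induction "\<Phi> g" arbitrary: g s rule: less_induct)
    case less
    show ?case
    proof (cases "bval s b")
      case False
      then show ?thesis
        using exec.WhileFalse[OF safe[OF less.prems] False] exit[OF less.prems False]
        unfolding run_def by fastforce
    next
      case True
      obtain s1 t1 A1 g' where 1: "exec W upd c p s s1 t1 A1"
        "t1 \<le> step_cost c p * (1 + f g)" "I g' s1" "\<Phi> g' + f g + 1 \<le> \<Phi> g"
        using body[OF less.prems True] unfolding run_def by blast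
      have "unchanged p s0 s1"
        using exec_unchanged[OF 1(1)] less.prems(2) by (simp add: unchanged_def)
      with less.hyps[of g' s1] 1 obtain s2 t2 A2 where 2: "exec W upd c (While b p) s1 s2 t2 A2"
        "t2 \<le> step_cost c (While b p) * (1 + \<Phi> g')" "Q s2"
        unfolding run_def by fastforce
      let ?D = "step_cost c (While b p)"
      have "1 + btime b + t1 \<le> ?D * (1 + f g)"
        using 1(2) by (simp add: algebra_simps)
      then have "1 + btime b + t1 + t2 \<le> ?D * (1 + f g) + ?D * (1 + \<Phi> g')"
        using 2(2) by linarith
      \<comment> \<open>This identity is why each iteration must release one unit of
        \<open>\<Phi>\<close> beyond \<open>f g\<close>: the extra unit pays for the second
        \<open>1 +\<close>.\<close>
      also have "\<dots> = ?D * (1 + (\<Phi> g' + f g + 1))"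
        by (simp only: ring_distribs mult_1_right)
      also have "\<dots> \<le> ?D * (1 + \<Phi> g)"
        by (intro mult_le_mono2) (use 1(4) in simp)
      finally show ?thesis
        using exec.WhileTrue[OF safe[OF less.prems] True 1(1) 2(1)] 2(3)
        unfolding run_def by blast
    qed
  qed
  show ?thesis by (rule *[OF inv]) (simp add: unchanged_def)
qed

text \<open>The ghost value is the iteration counter and the potential the tail of the sum;
  \<open>Suc (f i)\<close> counts iteration \<open>i\<close> itself and the inner iterations it
  causes.\<close>

lemma run_for:
  assumes inv: "I 0 s0"
    and step: "\<And>i s. i < n \<Longrightarrow> I i s \<Longrightarrow> unchanged p s0 s \<Longrightarrow>
       bsafe W s b \<and> bval s b \<and> run W upd c p s (f i) (I (Suc i))"
    and exit: "\<And>s. I n s \<Longrightarrow> unchanged p s0 s \<Longrightarrow> bsafe W s b \<and> \<not> bval s b"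
  shows "run W upd c (While b p) s0 (\<Sum>i<n. Suc (f i)) (I n)"
proof -
  have split: "(\<Sum>i=i..<n. Suc (f i)) = Suc (f i) + (\<Sum>i=Suc i..<n. Suc (f i))" if "i < n" for i
    using that by (simp add: sum.atLeast_Suc_lessThan)
  have "run W upd c (While b p) s0 (\<Sum>i=0..<n. Suc (f i)) (I n)"
  proof (rule run_While[where I = "\<lambda>i s. i \<le> n \<and> I i s" and f = f
        and \<Phi> = "\<lambda>i. \<Sum>i=i..<n. Suc (f i)"])
    fix i s assume *: "i \<le> n \<and> I i s" "unchanged p s0 s"
    show "bsafe W s b" using step[of i s] exit[of s] * by (cases "i = n") simp_all
    show "I n s" if "\<not> bval s b" using * that step[of i s] by (cases "i = n") auto
    show "run W upd c p s (f i) (\<lambda>s'. \<exists>g'. (g' \<le> n \<and> I g' s') \<and>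
        (\<Sum>i=g'..<n. Suc (f i)) + f i + 1 \<le> (\<Sum>i=i..<n. Suc (f i)))" if b: "bval s b"
    proof -
      have "i < n" using * b exit[of s] by (cases "i = n") auto
      then have "run W upd c p s (f i) (I (Suc i))" using step[of i s] * by simp
      then show ?thesis
      proof (rule run_conseq)
        fix s' assume "I (Suc i) s'"
        then show "\<exists>g'. (g' \<le> n \<and> I g' s') \<and>
            (\<Sum>i=g'..<n. Suc (f i)) + f i + 1 \<le> (\<Sum>i=i..<n. Suc (f i))"
          using \<open>i < n\<close> split by (intro exI[of _ "Suc i"]) simp
      qed simp
    qed
  qed (use inv in auto)
  then show ?thesis by (simp add: atLeast0LessThan)
qed

text \<open>Every address is the value of an integer expression, so the bound on the integers also
  bounds the memory.\<close>

fun inames :: "iexp \<Rightarrow> vname set" where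
  "inames (Num n) = {}"
| "inames (ICell x i) = insert x (inames i)"
| "inames (IAdd e1 e2) = inames e1 \<union> inames e2"
| "inames (ISub e1 e2) = inames e1 \<union> inames e2"
| "inames (IMul e1 e2) = inames e1 \<union> inames e2"
| "inames (IDiv e1 e2) = inames e1 \<union> inames e2"

fun rnames :: "rexp \<Rightarrow> vname set" where
  "rnames (RCell x i) = insert x (inames i)"
| "rnames (OfInt e) = inames e"
| "rnames (RAdd e1 e2) = rnames e1 \<union> rnames e2"
| "rnames (RSub e1 e2) = rnames e1 \<union> rnames e2"
| "rnames (RMul e1 e2) = rnames e1 \<union> rnames e2"
| "rnames (RDiv e1 e2) = rnames e1 \<union> rnames e2"

fun bnames :: "bexp \<Rightarrow> vname set" where
  "bnames (ILe e1 e2) = inames e1 \<union> inames e2"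
| "bnames (RLe e1 e2) = rnames e1 \<union> rnames e2"
| "bnames (Neg b) = bnames b"
| "bnames (Conj b1 b2) = bnames b1 \<union> bnames b2"

fun names :: "com \<Rightarrow> vname set" where
  "names Skip = {}"
| "names (IAssign x i e) = insert x (inames i \<union> inames e)"
| "names (RAssign x i e) = insert x (inames i \<union> rnames e)"
| "names (PenUpd x i p n v h) = {x, p} \<union> inames i \<union> inames n \<union> rnames v \<union> inames h"
| "names (p ;; q) = names p \<union> names q"
| "names (Cond b p q) = bnames b \<union> names p \<union> names q"
| "names (While b p) = bnames b \<union> names p"

definition cells_upto :: "vname set \<Rightarrow> int \<Rightarrow> addr set" where
  "cells_upto N W = (\<lambda>(x, j). IAddr x j) ` (N \<times> {..nat W}) \<union> (\<lambda>(x, j). RAddr x j) ` (N \<times> {..nat W})"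

lemma IAddr_cells_upto: "IAddr x j \<in> cells_upto N W \<longleftrightarrow> x \<in> N \<and> j \<le> nat W"
  and RAddr_cells_upto: "RAddr x j \<in> cells_upto N W \<longleftrightarrow> x \<in> N \<and> j \<le> nat W"
  by (auto simp: cells_upto_def)

lemma cells_upto_Un: "cells_upto (N \<union> M) W = cells_upto N W \<union> cells_upto M W"
  by (auto simp: cells_upto_def)

lemma cells_upto_insertI: "z \<in> cells_upto N W \<Longrightarrow> z \<in> cells_upto (insert x N) W"
  by (auto simp: cells_upto_def)

lemma finite_names: "finite (inames e)" "finite (rnames e')" "finite (bnames b)" "finite (names p)"
proof -
  show i: "finite (inames e)" for e by (induction e) auto
  show r: "finite (rnames e)" for e by (induction e) (auto simp: i)
  show b: "finite (bnames b)" for b by (induction b) (auto simp: i r)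
  show "finite (names p)" by (induction p) (auto simp: i r b)
qed

lemma isafe_bound: "isafe W s e \<Longrightarrow> \<bar>ival s e\<bar> \<le> W"
  by (cases e) auto

lemma icells_upto: "isafe W s e \<Longrightarrow> icells s e \<subseteq> cells_upto (inames e) W"
proof (induction e)
  case (ICell x e)
  then show ?case
    using isafe_bound[of W s e]
    by (auto simp: IAddr_cells_upto cells_upto_Un intro!: cells_upto_insertI)
qed (auto simp: cells_upto_Un)

lemma rcells_upto: "rsafe W s e \<Longrightarrow> rcells s e \<subseteq> cells_upto (rnames e) W"
proof (induction e)
  case (RCell x e)
  then show ?case
    using isafe_bound[of W s e]
      icells_upto[of W s e]
    by (auto simp: RAddr_cells_upto cells_upto_Un intro!: cells_upto_insertI)
qed (auto simp: cells_upto_Un dest: icells_upto)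

lemma bcells_upto: "bsafe W s b \<Longrightarrow> bcells s b \<subseteq> cells_upto (bnames b) W"
  by (induction b) (auto simp: cells_upto_Un dest: icells_upto rcells_upto)

lemma exec_cells_upto: "exec W upd c p s s' t A \<Longrightarrow> A \<subseteq> cells_upto (names p) W"
proof (induction rule: exec.induct)
  case (IAssign s i e x)
  then show ?case
    using isafe_bound[of W s i] icells_upto[of W s i] icells_upto[of W s e]
    by (auto simp: IAddr_cells_upto cells_upto_Un intro!: cells_upto_insertI)
next
  case (RAssign s i e x)
  then show ?case
    using isafe_bound[of W s i] icells_upto[of W s i] rcells_upto[of W s e]
    by (auto simp: RAddr_cells_upto cells_upto_Un intro!: cells_upto_insertI)
next
  case (PenUpd s i n v h x p)
  \<comment> \<open>A penalty update reads \<open>n\<close> cells of \<open>p\<close> at once; they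
    are in range because \<open>n\<close> is itself the value of a safe expression.\<close>
  have "j \<le> nat W" if "j < nat (ival s n)" for j
    using isafe_bound[OF PenUpd(3)] that by linarith
  then have "IAddr p ` {..<nat (ival s n)} \<subseteq> cells_upto (names (PenUpd x i p n v h)) W"
    by (auto simp: IAddr_cells_upto)
  moreover have "icells s i \<union> icells s n \<union> rcells s v \<union> icells s h
      \<subseteq> cells_upto (names (PenUpd x i p n v h)) W"
    using icells_upto[OF PenUpd(1)] icells_upto[OF PenUpd(3)] rcells_upto[OF PenUpd(5)]
      icells_upto[OF PenUpd(6)]
    by (auto simp: cells_upto_Un intro!: cells_upto_insertI)
  moreover have "RAddr x (nat (ival s i)) \<in> cells_upto (names (PenUpd x i p n v h)) W"
    using isafe_bound[OF PenUpd(1)] by (simp add: RAddr_cells_upto)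
  ultimately show ?case by simp
qed (auto simp: cells_upto_Un dest: bcells_upto)

lemma card_cells_upto:
  assumes "finite N"
  shows "card (cells_upto N W) \<le> 2 * card N * (nat W + 1)" "finite (cells_upto N W)"
proof -
  have fin: "finite (N \<times> {..nat W})" using assms by simp
  show "finite (cells_upto N W)" using fin by (simp add: cells_upto_def)
  have "card (cells_upto N W) \<le> card (N \<times> {..nat W}) + card (N \<times> {..nat W})"
    unfolding cells_upto_def by (rule order_trans[OF card_Un_le add_mono]) (intro card_image_le fin)+
  then show "card (cells_upto N W) \<le> 2 * card N * (nat W + 1)"
    by (simp add: card_cartesian_product)
qed

lemma exec_card_cells:
  assumes "exec W upd c p s s' t A"
  shows "card A \<le> 2 * card (names p) * (nat W + 1)"
  using card_mono[OF card_cells_upto(2)[OF finite_names(4)] exec_cells_upto[OF assms]]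
    card_cells_upto(1)[OF finite_names(4), of p W] by linarith

text \<open>Loop-free initialisation takes no iterations, so the count \<open>n\<close> of the
  remaining program is kept.\<close>

lemma run_init:
  assumes "wp W upd p Q s" "\<And>s'. unchanged p s s' \<Longrightarrow> Q s' \<Longrightarrow> run W upd c q s' n R"
  shows "run W upd c (p ;; q) s n R"
  using run_Seq[OF run_wp[OF assms(1), where n = 0], where n = n and R = R] assms(2) by simp

lemma nat_offset:
  "nat (int i + 1) = Suc i" "nat (1 + int i) = Suc i" "nat (int i - 1) = i - 1" "nat (int i + int j) = i + j"
  "nat (int i div 2) = i div 2" "nat (2 * int i) = 2 * i" "nat (2 * int i + 1) = 2 * i + 1"
  by (auto simp: nat_div_distrib nat_mult_distrib)

section \<open>Prefix sums and best splits\<close>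

text \<open>The gains need \<open>P\<close> only; the residual sums of squares need both
  \<open>P\<close> and \<open>Q\<close>.\<close>

definition prefix_sums :: com where
  "prefix_sums =
     (ISet ''t'' (Num 0) ;;
      RAssign ''P'' (Num 0) (OfInt (Num 0)) ;;
      RAssign ''Q'' (Num 0) (OfInt (Num 0))) ;;
     While (ILt (IV ''t'') (IV ''T''))
      (ISet ''t'' (IAdd (IV ''t'') (Num 1)) ;;
       RAssign ''P'' (IV ''t'') (RAdd (RCell ''P'' (ISub (IV ''t'') (Num 1))) (RCell ''X'' (IV ''t''))) ;;
       RAssign ''Q'' (IV ''t'') (RAdd (RCell ''Q'' (ISub (IV ''t'') (Num 1)))
         (RMul (RCell ''X'' (IV ''t'')) (RCell ''X'' (IV ''t'')))))"

definition has_sums :: "(nat \<Rightarrow> real) \<Rightarrow> nat \<Rightarrow> state \<Rightarrow> bool" where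
  "has_sums X T s \<longleftrightarrow> (\<forall>t\<le>T. reals s ''P'' t = (\<Sum>u\<in>{0<..t}. X u) \<and>
     reals s ''Q'' t = (\<Sum>u\<in>{0<..t}. (X u)\<^sup>2))"

lemma prefix_sums_run:
  assumes T: "ints s ''T'' 0 = int T" and X: "\<And>t. t \<in> {1..T} \<Longrightarrow> reals s ''X'' t = X t" and W: "int T < W"
  shows "run W upd c prefix_sums s T (has_sums X T)"
  unfolding prefix_sums_def
proof (rule run_init[where Q = "\<lambda>s'. ints s' ''t'' 0 = 0 \<and> reals s' ''P'' 0 = 0 \<and> reals s' ''Q'' 0 = 0"],
    goal_cases)
  case 1
  then show ?case using W by (simp add: state_simps)
next
  case (2 s0)
  have s0: "ints s0 ''T'' 0 = int T" "reals s0 ''X'' = reals s ''X''"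
    using 2(1) T by (simp_all add: unchanged_ints unchanged_reals)
  show ?case
  proof (rule run_conseq[OF run_for[where n = T and f = "\<lambda>_. 0" and
      I = "\<lambda>i s1. ints s1 ''t'' 0 = int i \<and> has_sums X i s1"]], goal_cases)
    case 1
    then show ?case using 2(2) by (simp add: has_sums_def)
  next
    case (2 i s1)
    have *: "{0<..Suc i} = insert (Suc i) {0<..i}" by auto
    have s1: "ints s1 ''T'' 0 = int T" "reals s1 ''X'' (Suc i) = X (Suc i)"
      using 2(1,3) X s0 by (simp_all add: unchanged_ints unchanged_reals)
    show ?case using 2(1,2) s1 W
      by (intro conjI run_wp)
        (auto simp: has_sums_def state_simps nat_offset le_Suc_eq * power2_eq_square)
  next
    case (3 s1)
    then have "ints s1 ''T'' 0 = int T" using s0 by (simp add: unchanged_ints)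
    then show ?case using 3 W by simp
  qed auto
qed

text \<open>A list and not a set: after rounding, the generator may emit the same interval several
  times, and copies are not removed.\<close>

definition has_intervals :: "interval list \<Rightarrow> state \<Rightarrow> bool" where
  "has_intervals xs s \<longleftrightarrow> ints s ''n'' 0 = int (length xs) \<and>
     (\<forall>i<length xs. ints s ''L'' i = int (fst (xs ! i)) \<and> ints s ''R'' i = int (snd (xs ! i)))"

definition has_gains :: "(nat \<Rightarrow> real) \<Rightarrow> interval list \<Rightarrow> state \<Rightarrow> bool" where
  "has_gains X xs s \<longleftrightarrow> (\<forall>i<length xs. ints s ''B'' i = int (best_split Min X (xs ! i)) \<and>
     reals s ''G'' i = (max_gain Min X (xs ! i))\<^sup>2)"

definition proper_intervals :: "nat \<Rightarrow> interval list \<Rightarrow> bool" where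
  "proper_intervals T xs \<longleftrightarrow> (\<forall>I\<in>set xs. fst I + 2 \<le> snd I \<and> snd I \<le> T)"

lemma proper_nth:
  "proper_intervals T xs \<Longrightarrow> i < length xs \<Longrightarrow> fst (xs ! i) + 2 \<le> snd (xs ! i) \<and> snd (xs ! i) \<le> T"
  by (simp add: proper_intervals_def)

definition scan_cost :: "interval list \<Rightarrow> nat" where
  "scan_cost xs = (\<Sum>i<length xs. Suc (snd (xs ! i) - fst (xs ! i)))"

text \<open>Both coefficients contain the factor \<open>sqrt (v * u / n)\<close>, so the statistic
  is this root times the difference of the two segment means. Its square is rational in prefix sums
  and can be evaluated on the machine.\<close>

lemma cusum_square:
  assumes "l < s" "s < r"
  shows "(cusum X (l, r) s)\<^sup>2 = real (r - s) * real (s - l) / real (r - l) *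
     ((\<Sum>t\<in>{l<..s}. X t) / real (s - l) - (\<Sum>t\<in>{s<..r}. X t) / real (r - s))\<^sup>2"
proof -
  define u v n A B where "u = real (s - l)" and "v = real (r - s)" and "n = real (r - l)"
    and "A = (\<Sum>t\<in>{l<..s}. X t)" and "B = (\<Sum>t\<in>{s<..r}. X t)"
  have pos: "u > 0" "v > 0" "n > 0" using assms by (auto simp: u_def v_def n_def)
  have "v / (n * u) = (v * u / n) / u\<^sup>2" "u / (n * v) = (v * u / n) / v\<^sup>2"
    using pos by (simp_all add: field_simps power2_eq_square)
  then have "sqrt (v / (n * u)) = sqrt (v * u / n) / u" "sqrt (u / (n * v)) = sqrt (v * u / n) / v"
    using pos by (simp_all add: real_sqrt_divide real_sqrt_mult)
  then have "cusum X (l, r) s = sqrt (v * u / n) * (A / u - B / v)"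
    by (simp add: cusum_def u_def v_def n_def A_def B_def algebra_simps)
  then have "(cusum X (l, r) s)\<^sup>2 = v * u / n * (A / u - B / v)\<^sup>2"
    using pos by (simp add: power_mult_distrib)
  then show ?thesis by (simp add: u_def v_def n_def A_def B_def)
qed

lemma sum_between:
  fixes f :: "nat \<Rightarrow> real"
  assumes "i \<le> j"
  shows "(\<Sum>t\<in>{i<..j}. f t) = (\<Sum>t\<in>{0<..j}. f t) - (\<Sum>t\<in>{0<..i}. f t)"
proof -
  have "{0<..j} = {0<..i} \<union> {i<..j}" using assms by auto
  then have "(\<Sum>t\<in>{0<..j}. f t) = (\<Sum>t\<in>{0<..i}. f t) + (\<Sum>t\<in>{i<..j}. f t)"
    by (simp add: sum.union_disjoint ivl_disj_int)
  then show ?thesis by simp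
qed

lemma has_sums_between:
  assumes "has_sums X T s" "i \<le> j" "j \<le> T"
  shows "reals s ''P'' j - reals s ''P'' i = (\<Sum>t\<in>{i<..j}. X t)"
    "reals s ''Q'' j - reals s ''Q'' i = (\<Sum>t\<in>{i<..j}. (X t)\<^sup>2)"
  using assms by (simp_all add: has_sums_def sum_between[OF assms(2)])

text \<open>A champion that is replaced only upon strict improvement is the first maximiser, which
  is the one chosen by the tie rule \<open>Min\<close>.\<close>

lemma best_split_eqI:
  assumes b: "b \<in> {l<..<r}" and max: "\<And>u. u \<in> {l<..<r} \<Longrightarrow> (cusum X (l, r) u)\<^sup>2 \<le> (cusum X (l, r) b)\<^sup>2"
    and first: "\<And>u. u \<in> {l<..<b} \<Longrightarrow> (cusum X (l, r) u)\<^sup>2 < (cusum X (l, r) b)\<^sup>2"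
  shows "best_split Min X (l, r) = b" "(max_gain Min X (l, r))\<^sup>2 = (cusum X (l, r) b)\<^sup>2"
proof -
  show *: "best_split Min X (l, r) = b"
    unfolding best_split_def
  proof (rule Min_eqI, goal_cases)
    case (2 u)
    then have "(cusum X (l, r) b)\<^sup>2 \<le> (cusum X (l, r) u)\<^sup>2" "l < u"
      using b by (auto simp: abs_le_square_iff)
    then show ?case using first[of u] by force
  qed (use b max in \<open>auto simp: abs_le_square_iff\<close>)
  show "(max_gain Min X (l, r))\<^sup>2 = (cusum X (l, r) b)\<^sup>2"
    by (simp add: max_gain_def *)
qed

lemma best_split_in:
  assumes "fst I + 2 \<le> snd I"
  shows "best_split Min X I \<in> {fst I<..<snd I}"
proof -
  have "finite {fst I<..<snd I}" "Suc (fst I) \<in> {fst I<..<snd I}" using assms by auto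
  then have "Max ((\<lambda>s. \<bar>cusum X I s\<bar>) ` {fst I<..<snd I}) \<in> (\<lambda>s. \<bar>cusum X I s\<bar>) ` {fst I<..<snd I}"
    by (intro Max_in) auto
  then obtain s where "s \<in> {fst I<..<snd I}"
    "\<bar>cusum X I s\<bar> = Max ((\<lambda>s. \<bar>cusum X I s\<bar>) ` {fst I<..<snd I})"
    by (metis (no_types, lifting) imageE)
  then have s: "s \<in> {fst I<..<snd I}" "\<forall>s'\<in>{fst I<..<snd I}. \<bar>cusum X I s'\<bar> \<le> \<bar>cusum X I s\<bar>"
    by simp_all
  show ?thesis
    unfolding best_split_def
    by (rule subsetD[OF _ Min_in]) (use s in auto)
qed

definition try_split :: com where
  "try_split =
     RSet ''d'' (RSub
       (RDiv (RSub (RCell ''P'' (IV ''s'')) (RCell ''P'' (IV ''l''))) (OfInt (ISub (IV ''s'') (IV ''l''))))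
       (RDiv (RSub (RCell ''P'' (IV ''r'')) (RCell ''P'' (IV ''s''))) (OfInt (ISub (IV ''r'') (IV ''s''))))) ;;
     RSet ''g'' (RMul
       (RDiv (RMul (OfInt (ISub (IV ''r'') (IV ''s''))) (OfInt (ISub (IV ''s'') (IV ''l''))))
         (OfInt (ISub (IV ''r'') (IV ''l''))))
       (RMul (RV ''d'') (RV ''d''))) ;;
     Cond (RLt (RV ''bg'') (RV ''g'')) (RSet ''bg'' (RV ''g'') ;; ISet ''bs'' (IV ''s'')) Skip ;;
     ISet ''s'' (IAdd (IV ''s'') (Num 1))"

text \<open>The start value \<open>-1\<close> of \<open>bg\<close> lies below every squared gain, so
  the first split is taken even if its gain is zero.\<close>

definition best_split_step :: com where
  "best_split_step =
      (ISet ''l'' (ICell ''L'' (IV ''i'')) ;; ISet ''r'' (ICell ''R'' (IV ''i'')) ;;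
        ISet ''s'' (IAdd (IV ''l'') (Num 1)) ;; RSet ''bg'' (OfInt (Num (-1)))) ;;
       While (ILt (IV ''s'') (IV ''r'')) try_split ;;
       (IAssign ''B'' (IV ''i'') (IV ''bs'') ;; RAssign ''G'' (IV ''i'') (RV ''bg'') ;;
        ISet ''i'' (IAdd (IV ''i'') (Num 1)))"

definition best_splits :: com where
  "best_splits =
     ISet ''i'' (Num 0) ;;
     While (ILt (IV ''i'') (IV ''n''))
      best_split_step"

lemma best_split_loop_run:
  assumes s0: "ints s0 ''l'' 0 = int l" "ints s0 ''r'' 0 = int r" "ints s0 ''s'' 0 = int l + 1"
      "reals s0 ''bg'' 0 = -1" "has_sums X T s0"
    and lr: "l + 2 \<le> r" "r \<le> T" and W: "int T < W"
  shows "run W upd c (While (ILt (IV ''s'') (IV ''r'')) try_split) s0 (r - l)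
     (\<lambda>s. ints s ''bs'' 0 = int (best_split Min X (l, r)) \<and> reals s ''bg'' 0 = (max_gain Min X (l, r))\<^sup>2)"
proof -
  define q where "q u = (cusum X (l, r) u)\<^sup>2" for u
  \<comment> \<open>Before the first split is tried \<open>bs\<close> carries no information, hence
    the separate case \<open>i = 0\<close>.\<close>
  define I where "I i s \<longleftrightarrow> ints s ''s'' 0 = int (l + 1 + i) \<and> (if i = 0 then reals s ''bg'' 0 = -1 else
     (\<exists>b\<in>{l<..l + i}. ints s ''bs'' 0 = int b \<and> reals s ''bg'' 0 = q b \<and> (\<forall>u\<in>{l<..l + i}. q u \<le> q b) \<and>
       (\<forall>u\<in>{l<..<b}. q u < q b)))" for i and s :: state
  have frame: "ints s ''l'' 0 = int l \<and> ints s ''r'' 0 = int r \<and> has_sums X T s"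
    if "unchanged try_split s0 s" for s
    using that s0 by (simp add: unchanged_ints unchanged_reals try_split_def has_sums_def)
  show ?thesis
  proof (rule run_conseq[OF run_for[where n = "r - l - 1" and f = "\<lambda>_. 0" and I = I]], goal_cases)
    case 1
    then show ?case using s0 by (simp add: I_def)
  next
    case (2 i s)
    note fr = frame[OF 2(3)]
    define d where "d = reals s ''P'' (Suc (l + i)) - reals s ''P'' l"
    define e where "e = reals s ''P'' r - reals s ''P'' (Suc (l + i))"
    have ir: "Suc (l + i) < r" using 2(1) by simp
    have q: "q (Suc (l + i)) = real_of_int (int r - (1 + (int l + int i))) * real_of_int (1 + int i) /
        real_of_int (int r - int l) *
        ((d / real_of_int (1 + int i) - e / real_of_int (int r - (1 + (int l + int i)))) *
         (d / real_of_int (1 + int i) - e / real_of_int (int r - (1 + (int l + int i)))))"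
      unfolding q_def using ir lr has_sums_between(1)[of X T s] fr
      by (subst cusum_square) (auto simp: d_def e_def power2_eq_square of_nat_diff)
    have pos: "q u \<ge> 0" for u by (simp add: q_def)
    have sv: "ints s ''s'' 0 = 1 + (int l + int i)" using 2(2) by (simp add: I_def)
    have nat: "nat (1 + (int l + int i)) = Suc (l + i)" by simp
    have ext: "{l<..Suc (l + i)} = insert (Suc (l + i)) {l<..l + i}" by auto
    have wp: "wp W upd try_split (I (Suc i)) s"
    proof (cases "reals s ''bg'' 0 < q (Suc (l + i))")
      case True
      have "\<forall>u\<in>{l<..l + i}. q u < q (Suc (l + i))"
        using 2(2) True by (auto simp: I_def split: if_splits)
      then have "I (Suc i) (set_int ''s'' 0 (2 + (int l + int i)) (set_int ''bs'' 0 (1 + (int l + int i))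
         (set_real ''bg'' 0 (q (Suc (l + i))) (set_real ''g'' 0 y (set_real ''d'' 0 z s)))))" for y z
        using sv by (auto simp: I_def state_simps ext intro!: bexI[of _ "Suc (l + i)"] less_imp_le)
      then show ?thesis
        using True fr ir lr W sv
        by (auto simp: try_split_def state_simps nat q d_def[symmetric] e_def[symmetric])
    next
      case False
      have "i \<noteq> 0" using False 2(2) pos[of "Suc (l + i)"] by (auto simp: I_def split: if_splits)
      then have "I (Suc i) (set_int ''s'' 0 (2 + (int l + int i)) (set_real ''g'' 0 y (set_real ''d'' 0 z s)))" for y z
        using False 2(2) sv by (auto simp: I_def state_simps ext)
      then show ?thesis
        using False fr ir lr W sv
        by (auto simp: try_split_def state_simps nat q d_def[symmetric] e_def[symmetric])
    qed
    then show ?case using fr ir lr W sv by (auto intro: run_wp)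
  next
    case (3 s)
    then show ?case using frame[OF 3(2)] lr W by (auto simp: I_def)
  next
    case 4
    show ?case using lr by simp
  next
    case (5 s)
    have "r - l - 1 \<noteq> 0" "l + (r - l - 1) = r - 1" using lr by auto
    with 5(2) obtain b where b: "b \<in> {l<..r - 1}" "ints s ''bs'' 0 = int b" "reals s ''bg'' 0 = q b"
      "\<forall>u\<in>{l<..r - 1}. q u \<le> q b" "\<forall>u\<in>{l<..<b}. q u < q b"
      by (auto simp: I_def)
    have "best_split Min X (l, r) = b" "(max_gain Min X (l, r))\<^sup>2 = (cusum X (l, r) b)\<^sup>2"
      using b lr by (auto simp: q_def intro!: best_split_eqI)
    then show ?case using b by (simp add: q_def)
  qed
qed

lemma best_splits_run:
  assumes s: "has_sums X T s" "has_intervals xs s"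
    and xs: "proper_intervals T xs" and W: "int T < W" "int (length xs) < W"
  shows "run W upd c best_splits s (scan_cost xs) (has_gains X xs)"
  unfolding best_splits_def
proof (rule run_init[where Q = "\<lambda>s'. ints s' ''i'' 0 = 0"], goal_cases)
  case 1
  then show ?case using W by (simp add: state_simps)
next
  case (2 s0)
  have s0: "has_sums X T s0 \<and> has_intervals xs s0"
    using 2(1) s by (simp add: unchanged_ints unchanged_reals has_sums_def has_intervals_def)
  show ?case
  proof (rule run_conseq[OF run_for[where n = "length xs" and f = "\<lambda>i. snd (xs ! i) - fst (xs ! i)" and
      I = "\<lambda>i s1. ints s1 ''i'' 0 = int i \<and> has_gains X (take i xs) s1"]], goal_cases)
    case 1
    then show ?case using 2(2) by (simp add: has_gains_def)
  next
    case (2 i s1)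
    have s1: "has_sums X T s1" "ints s1 ''n'' 0 = int (length xs)"
      "ints s1 ''L'' i = int (fst (xs ! i))" "ints s1 ''R'' i = int (snd (xs ! i))"
      using 2(1,3) s0
      by (simp_all add: unchanged_ints unchanged_reals has_sums_def has_intervals_def best_split_step_def try_split_def)
    have "run W upd c best_split_step s1 (snd (xs ! i) - fst (xs ! i) + 0)
       (\<lambda>s1. ints s1 ''i'' 0 = int (Suc i) \<and> has_gains X (take (Suc i) xs) s1)"
    unfolding best_split_step_def
    proof (rule run_init[where Q = "\<lambda>s'. ints s' ''l'' 0 = int (fst (xs ! i)) \<and>
        ints s' ''r'' 0 = int (snd (xs ! i)) \<and> ints s' ''s'' 0 = int (fst (xs ! i)) + 1 \<and> reals s' ''bg'' 0 = -1"],
        goal_cases)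
      case 1
      then show ?case using 2 s1 W proper_nth[OF xs 2(1)] by (simp add: state_simps)
    next
      case (2 s2)
      have "has_sums X T s2" using 2(1) s1 by (simp add: unchanged_reals has_sums_def)
      then show ?case
        using 2(2) proper_nth[OF xs \<open>i < length xs\<close>] W
      proof (intro run_Seq[OF best_split_loop_run[where X = X and T = T and l = "fst (xs ! i)" and r = "snd (xs ! i)"]],
          goal_cases)
        case (9 s3)
        have "ints s3 ''B'' = ints s1 ''B''" "reals s3 ''G'' = reals s1 ''G''" "ints s3 ''i'' 0 = int i"
          using 9 2(1) \<open>ints s1 ''i'' 0 = int i \<and> _\<close>
          by (simp_all add: unchanged_ints unchanged_reals try_split_def)
        moreover have "best_split Min X (xs ! i) \<le> T"
          using best_split_in[of "xs ! i" X] proper_nth[OF xs \<open>i < length xs\<close>] by simp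
        ultimately show ?case
          using 9 W \<open>ints s1 ''i'' 0 = int i \<and> _\<close> \<open>i < length xs\<close>
          by (intro run_wp) (auto simp: state_simps has_gains_def less_Suc_eq)
      qed auto
    qed
    then show ?case using 2(2) s1 W 2(1) by simp
  next
    case (3 s1)
    then have "ints s1 ''n'' 0 = int (length xs)"
      using s0 by (simp add: unchanged_ints has_intervals_def best_split_step_def try_split_def)
    then show ?case using 3 W by simp
  next
    case (5 s1)
    then show ?case by simp
  qed (auto simp: scan_cost_def)
qed

section \<open>Sorting with a tournament tree\<close>

definition lex_le :: "interval \<Rightarrow> interval \<Rightarrow> bool" where
  "lex_le I J \<longleftrightarrow> fst I < fst J \<or> fst I = fst J \<and> snd I \<le> snd J"

text \<open>Equal keys are ordered by end points: the resulting choice must be a function of the set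
  of candidates, which an order by list position would not give.\<close>

definition before :: "(nat \<Rightarrow> real) \<Rightarrow> interval list \<Rightarrow> nat \<Rightarrow> nat \<Rightarrow> bool" where
  "before K xs x y \<longleftrightarrow> K y < K x \<or> K x = K y \<and> lex_le (xs ! x) (xs ! y)"

lemma before_refl: "before K xs x x"
  and before_total: "before K xs x y \<or> before K xs y x"
  and before_trans: "before K xs x y \<Longrightarrow> before K xs y z \<Longrightarrow> before K xs x z"
  by (auto simp: before_def lex_le_def)

definition before_exp :: "iexp \<Rightarrow> iexp \<Rightarrow> bexp" where
  "before_exp d e = Conj (RLe (RCell ''K'' e) (RCell ''K'' d))
     (Disj (RLt (RCell ''K'' e) (RCell ''K'' d))
       (Conj (ILe (ICell ''L'' d) (ICell ''L'' e))
         (Disj (ILt (ICell ''L'' d) (ICell ''L'' e)) (ILe (ICell ''R'' d) (ICell ''R'' e)))))"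

text \<open>The tree is stored in \<open>w[1], \<dots>, w[2n-1]\<close>: node \<open>v\<close> has the children \<open>2v\<close> and \<open>2v+1\<close>, the leaf of the
  \<open>i\<close>-th interval is \<open>n+i\<close>, and \<open>w[v]\<close> is the winner among the leaves below \<open>v\<close>. Keys are nonnegative;
  extracted intervals get the key \<open>-1\<close>.\<close>

definition play :: com where
  "play = Cond (before_exp (ICell ''w'' (IMul (Num 2) (IV ''v'')))
                (ICell ''w'' (IAdd (IMul (Num 2) (IV ''v'')) (Num 1))))
     (IAssign ''w'' (IV ''v'') (ICell ''w'' (IMul (Num 2) (IV ''v''))))
     (IAssign ''w'' (IV ''v'') (ICell ''w'' (IAdd (IMul (Num 2) (IV ''v'')) (Num 1))))"

definition sort_init :: "rexp \<Rightarrow> com" where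
  "sort_init e = ISet ''v'' (Num 0) ;;
     While (ILt (IV ''v'') (IV ''n''))
       (RAssign ''K'' (IV ''v'') e ;;
        IAssign ''w'' (IAdd (IV ''n'') (IV ''v'')) (IV ''v'') ;;
        ISet ''v'' (IAdd (IV ''v'') (Num 1)))"

definition sort_build :: com where
  "sort_build = ISet ''v'' (ISub (IV ''n'') (Num 1)) ;;
     While (ILe (Num 1) (IV ''v'')) (play ;; ISet ''v'' (ISub (IV ''v'') (Num 1)))"

definition replay :: com where
  "replay = While (ILe (Num 1) (IV ''v'')) (play ;; ISet ''v'' (IDiv (IV ''v'') (Num 2)))"

definition extract_step :: com where
  "extract_step =
       (IAssign ''ord'' (IV ''j'') (ICell ''w'' (Num 1)) ;;
         RAssign ''K'' (ICell ''w'' (Num 1)) (OfInt (Num (-1))) ;;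
         ISet ''v'' (IDiv (IAdd (IV ''n'') (ICell ''w'' (Num 1))) (Num 2))) ;;
        replay ;;
        ISet ''j'' (IAdd (IV ''j'') (Num 1))"

definition sort_extract :: com where
  "sort_extract = ISet ''j'' (Num 0) ;;
     While (ILt (IV ''j'') (IV ''n''))
       extract_step"

definition sort_intervals :: "rexp \<Rightarrow> com" where
  "sort_intervals e = sort_init e ;; sort_build ;; sort_extract"

section \<open>Ancestors and winners in the heap numbering of the tree\<close>

definition anc :: "nat \<Rightarrow> nat \<Rightarrow> bool" where
  "anc u m \<longleftrightarrow> (\<exists>k. m div 2 ^ k = u)"

lemma anc_refl: "anc u u"
  unfolding anc_def by (rule exI[of _ 0]) simp

lemma half_anc: "anc u m \<Longrightarrow> anc (u div 2) m"
  unfolding anc_def by (metis div_mult2_eq power_Suc2)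

lemma anc_split: "anc u m \<Longrightarrow> u = m \<or> anc u (m div 2)"
  unfolding anc_def
proof (elim exE)
  fix k assume "m div 2 ^ k = u"
  then show "u = m \<or> (\<exists>k. m div 2 div 2 ^ k = u)"
    by (cases k) (auto simp: div_mult2_eq)
qed

text \<open>The lower end \<open>k\<close> lets the property grow from the leaves to the root while
  the tree is built. Requiring each winner to lie below its node fixes the leaves
  (\<open>tree_leaf\<close>) and confines the effect of a changed key to one path.\<close>

definition tree_range :: "nat \<Rightarrow> (nat \<Rightarrow> int) \<Rightarrow> nat \<Rightarrow> bool" where
  "tree_range N w k \<longleftrightarrow>
     (\<forall>u. k \<le> u \<and> u < 2 * N \<longrightarrow> 0 \<le> w u \<and> w u < int N \<and> anc u (N + nat (w u)))"

definition node_ok :: "(nat \<Rightarrow> real) \<Rightarrow> interval list \<Rightarrow> (nat \<Rightarrow> int) \<Rightarrow> nat \<Rightarrow> bool" where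
  "node_ok K xs w u \<longleftrightarrow>
     w u = (if before K xs (nat (w (2 * u))) (nat (w (2 * u + 1))) then w (2 * u) else w (2 * u + 1))"

text \<open>Along the path from \<open>u\<close> up to the root every winner comes before, or
  equals, the winner one level below; transitivity of \<open>before\<close> does the rest.\<close>

lemma tree_top:
  assumes "\<And>u. 1 \<le> u \<Longrightarrow> u < N \<Longrightarrow> node_ok K xs w u" "1 \<le> u" "u < 2 * N"
  shows "before K xs (nat (w 1)) (nat (w u))"
  using assms(2,3)
proof (induction u rule: less_induct)
  case (less u)
  show ?case
  proof (cases "u = 1")
    case True
    then show ?thesis by (simp add: before_refl)
  next
    case False
    let ?p = "u div 2"
    have p: "1 \<le> ?p" "?p < N" "?p < u" using False less.prems by auto
    have "before K xs (nat (w 1)) (nat (w ?p))" using less.IH[of ?p] p by simp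
    moreover have "before K xs (nat (w ?p)) (nat (w u))"
      using assms(1)[OF p(1,2)] before_total[of K xs "nat (w (2 * ?p))" "nat (w (2 * ?p + 1))"]
      unfolding node_ok_def by (cases "even u") (auto simp: before_refl elim!: evenE oddE)
    ultimately show ?thesis by (rule before_trans)
  qed
qed

text \<open>Both children of \<open>v\<close> have larger numbers, so validity of the nodes from
  \<open>Suc v\<close> on suffices to play at \<open>v\<close>.\<close>

lemma play_wp:
  assumes s: "has_intervals xs s" "ints s ''v'' 0 = int v" and v: "1 \<le> v" "v < length xs"
    and w: "tree_range (length xs) (ints s ''w'') (Suc v)"
    and xs: "proper_intervals T xs" and W: "int T < W" "2 * int (length xs) < W"
  shows "wp W upd play (\<lambda>s'. (\<exists>z. s' = set_int ''w'' v z s) \<and>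
     tree_range (length xs) (ints s' ''w'') v \<and> node_ok (reals s ''K'') xs (ints s' ''w'') v) s"
proof -
  let ?N = "length xs"
  define x where "x = nat (ints s ''w'' (2 * v))"
  define y where "y = nat (ints s ''w'' (2 * v + 1))"
  have x: "ints s ''w'' (2 * v) = int x" "x < ?N" "anc (2 * v) (?N + x)"
    using w v by (auto simp: tree_range_def x_def nat_less_iff)
  have y: "ints s ''w'' (Suc (2 * v)) = int y" "y < ?N" "anc (2 * v + 1) (?N + y)"
    using w v by (auto simp: tree_range_def y_def nat_less_iff)
  have a: "anc v (?N + x)" "anc v (?N + y)"
    using half_anc[OF x(3)] half_anc[OF y(3)] by auto
  have t: "tree_range ?N (ints (set_int ''w'' v (int z) s) ''w'') v" if "z < ?N" "anc v (?N + z)" for z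
    using w that by (auto simp: tree_range_def state_simps)
  have 1: "ints s ''L'' x = int (fst (xs ! x))" "ints s ''R'' x = int (snd (xs ! x))"
    "ints s ''L'' y = int (fst (xs ! y))" "ints s ''R'' y = int (snd (xs ! y))"
    "ints s ''n'' 0 = int ?N"
    using s(1) x y by (auto simp: has_intervals_def)
  have 2: "nat (2 * int v) = 2 * v" "nat (2 * int v + 1) = Suc (2 * v)" by auto
  note b = proper_nth[OF xs x(2)] proper_nth[OF xs y(2)]
  have bv: "bval s (before_exp (ICell ''w'' (IMul (Num 2) (IV ''v'')))
                (ICell ''w'' (IAdd (IMul (Num 2) (IV ''v'')) (Num 1)))) \<longleftrightarrow> before (reals s ''K'') xs x y"
    using x(1) y(1) s(2) 1 2 by (auto simp: before_exp_def before_def lex_le_def)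
  have bs: "bsafe W s (before_exp (ICell ''w'' (IMul (Num 2) (IV ''v'')))
                (ICell ''w'' (IAdd (IMul (Num 2) (IV ''v'')) (Num 1))))"
    using x(1,2) y(1,2) s(2) 1 2 v W b by (auto simp: before_exp_def)
  show ?thesis
    using bs x(1,2) y(1,2) s(2) 2 v W t[OF x(2) a(1)] t[OF y(2) a(2)]
    by (auto simp: play_def bv node_ok_def state_simps)
qed

text \<open>The key expression is evaluated in the middle of the loop, so its value is required in
  every state that differs from \<open>s\<close> only in what the loop writes.\<close>

lemma sort_init_run:
  assumes s: "has_intervals xs s"
    and e: "\<And>i s1. i < length xs \<Longrightarrow> ints s1 ''v'' 0 = int i \<Longrightarrow>
       (\<forall>x. x \<noteq> ''v'' \<and> x \<noteq> ''w'' \<longrightarrow> ints s1 x = ints s x) \<Longrightarrow>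
       (\<forall>x. x \<noteq> ''K'' \<longrightarrow> reals s1 x = reals s x) \<Longrightarrow> rsafe W s1 e \<and> rval s1 e = key i"
    and W: "2 * int (length xs) < W"
  shows "run W upd c (sort_init e) s (length xs)
     (\<lambda>s'. (\<forall>i<length xs. reals s' ''K'' i = key i) \<and> (\<forall>i<length xs. ints s' ''w'' (length xs + i) = int i))"
  unfolding sort_init_def
proof (rule run_init[where Q = "\<lambda>s'. ints s' ''v'' 0 = 0"], goal_cases)
  case 1
  then show ?case using W by (simp add: state_simps)
next
  case (2 s0)
  show ?case
  proof (rule run_conseq[OF run_for[where n = "length xs" and f = "\<lambda>_. 0" and
      I = "\<lambda>k s1. ints s1 ''v'' 0 = int k \<and> (\<forall>i<k. reals s1 ''K'' i = key i) \<and>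
        (\<forall>i<k. ints s1 ''w'' (length xs + i) = int i)"]], goal_cases)
    case 1
    then show ?case using 2(2) by simp
  next
    case (2 i s1)
    have n: "ints s1 ''n'' 0 = int (length xs)"
      using 2(3) \<open>unchanged _ s s0\<close> s by (simp add: unchanged_ints has_intervals_def)
    have "\<forall>x. x \<noteq> ''v'' \<and> x \<noteq> ''w'' \<longrightarrow> ints s1 x = ints s x" "\<forall>x. x \<noteq> ''K'' \<longrightarrow> reals s1 x = reals s x"
      using 2(3) \<open>unchanged _ s s0\<close> by (simp_all add: unchanged_ints unchanged_reals)
    then have "rsafe W s1 e \<and> rval s1 e = key i" using e[of i s1] 2(1,2) by simp
    then show ?case
      using 2(1,2) n W by (intro conjI run_wp) (auto simp: state_simps nat_offset less_Suc_eq)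
  next
    case (3 s1)
    have n: "ints s1 ''n'' 0 = int (length xs)"
      using 3(2) \<open>unchanged _ s s0\<close> s by (simp add: unchanged_ints has_intervals_def)
    then show ?case using 3 W by simp
  qed auto
qed

lemma tree_range_leaves:
  assumes "\<forall>i<N. w (N + i) = int i"
  shows "tree_range N w N"
  unfolding tree_range_def
proof (intro allI impI)
  fix u assume u: "N \<le> u \<and> u < 2 * N"
  then have "u - N < N" "N + (u - N) = u" by auto
  then have "w u = int (u - N)" using assms by metis
  then have a: "N + nat (w u) = u" using u by linarith
  then show "0 \<le> w u \<and> w u < int N \<and> anc u (N + nat (w u))"
    using u \<open>w u = int (u - N)\<close> anc_refl[of u] unfolding a by auto
qed

text \<open>A leaf has nothing but itself below it: proper descendants of \<open>N + y\<close> would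
  have numbers of at least \<open>2 * N\<close>.\<close>

lemma tree_leaf:
  assumes "tree_range N w 1" "y < N"
  shows "w (N + y) = int y"
proof -
  have r: "0 \<le> w (N + y)" "w (N + y) < int N" "anc (N + y) (N + nat (w (N + y)))"
    using assms by (auto simp: tree_range_def)
  have "N + nat (w (N + y)) = N + y"
  proof (rule ccontr)
    assume "N + nat (w (N + y)) \<noteq> N + y"
    then have "anc (N + y) ((N + nat (w (N + y))) div 2)" using anc_split[OF r(3)] by simp
    then have "N + y \<le> (N + nat (w (N + y))) div 2" unfolding anc_def by (metis div_le_dividend)
    moreover have "nat (w (N + y)) < N" using r(1,2) by (simp add: nat_less_iff)
    ultimately show False by linarith
  qed
  then show ?thesis using r(1) by simp
qed

lemma sort_build_run:
  assumes s: "has_intervals xs s" "\<forall>i<length xs. ints s ''w'' (length xs + i) = int i"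
    and xs: "proper_intervals T xs" "xs \<noteq> []" and W: "int T < W" "2 * int (length xs) < W"
  shows "run W upd c sort_build s (length xs)
     (\<lambda>s'. tree_range (length xs) (ints s' ''w'') 1 \<and>
        (\<forall>u. 1 \<le> u \<and> u < length xs \<longrightarrow> node_ok (reals s' ''K'') xs (ints s' ''w'') u))"
  unfolding sort_build_def
proof (rule run_init[where Q = "\<lambda>s'. ints s' ''v'' 0 = int (length xs - 1)"], goal_cases)
  case 1
  show ?case using W s(1) xs(2) by (cases xs) (simp_all add: state_simps has_intervals_def)
next
  case (2 s0)
  let ?N = "length xs"
  have N: "1 \<le> ?N" using xs(2) by (cases xs) auto
  have s0: "has_intervals xs s0" "tree_range ?N (ints s0 ''w'') ?N"
    using 2(1) s by (simp_all add: unchanged_ints has_intervals_def tree_range_leaves)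
  show ?case
  proof (rule run_conseq[OF run_for[where n = "?N - 1" and f = "\<lambda>_. 0" and
      I = "\<lambda>i s1. ints s1 ''v'' 0 = int (?N - 1 - i) \<and> tree_range ?N (ints s1 ''w'') (?N - i) \<and>
        (\<forall>u. ?N - i \<le> u \<and> u < ?N \<longrightarrow> node_ok (reals s0 ''K'') xs (ints s1 ''w'') u)"]], goal_cases)
    case 1
    then show ?case using 2(2) s0 by auto
  next
    case (2 i s1)
    have s1: "has_intervals xs s1" "reals s1 ''K'' = reals s0 ''K''"
      using 2(3) s0 by (simp_all add: unchanged_ints unchanged_reals has_intervals_def play_def)
    define v where "v = ?N - 1 - i"
    have v: "1 \<le> v" "v < ?N" "?N - i = Suc v" "?N - Suc i = v" "?N - 1 - Suc i = v - 1"
      using 2(1) by (auto simp: v_def)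
    have vv: "ints s1 ''v'' 0 = int v" "tree_range ?N (ints s1 ''w'') (Suc v)"
      using 2(2) by (simp add: v_def) (use 2(2) in \<open>simp add: v(3)\<close>)
    have "run W upd c (play ;; ISet ''v'' (ISub (IV ''v'') (Num 1))) s1 0
      (\<lambda>s1. ints s1 ''v'' 0 = int (v - 1) \<and> tree_range ?N (ints s1 ''w'') v \<and>
        (\<forall>u. v \<le> u \<and> u < ?N \<longrightarrow> node_ok (reals s0 ''K'') xs (ints s1 ''w'') u))"
    proof (rule run_init[OF play_wp[OF s1(1) vv(1) v(1,2) vv(2) xs(1) W]], goal_cases)
      case (1 s2)
      then obtain z where z: "s2 = set_int ''w'' v z s1" by blast
      have "node_ok (reals s0 ''K'') xs (ints s2 ''w'') u" if "v \<le> u" "u < ?N" for u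
      proof (cases "u = v")
        case True
        then show ?thesis using 1(2) s1(2) by simp
      next
        case False
        then have "node_ok (reals s0 ''K'') xs (ints s1 ''w'') u"
          using 2(2) v that by auto
        then show ?thesis
          using False that v(1) by (simp add: node_ok_def z state_simps)
      qed
      then show ?case
        using 1(2) z vv(1) v(1,2) W by (intro run_wp) (auto simp: state_simps of_nat_diff)
    qed
    then show ?case
      using vv(1) v W by simp
  next
    case (3 s1)
    then show ?case using W by simp
  next
    case (5 s1)
    have "reals s1 ''K'' = reals s0 ''K''"
      using 5(1) by (simp add: unchanged_reals play_def)
    moreover have "?N - (?N - 1) = 1" using N by simp
    ultimately show ?case using 5(2) by simp
  qed auto
qed

lemma floorlog_half: "1 \<le> v \<Longrightarrow> floorlog 2 v = Suc (floorlog 2 (v div 2))"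
  using compute_floorlog[of 2 v] by simp

text \<open>Only \<open>v\<close> and its ancestors may be wrong. Playing at \<open>v\<close>
  repairs it and leaves the ancestors of \<open>v div 2\<close> in doubt; at \<open>v = 0\<close>
  none is left. The number of halvings is \<open>floorlog 2 v\<close>.\<close>

lemma replay_run:
  assumes s: "has_intervals xs s" "ints s ''v'' 0 = int v" and v: "v < length xs"
    and tree: "tree_range (length xs) (ints s ''w'') 1"
      "\<forall>u. 1 \<le> u \<and> u < length xs \<and> \<not> anc u v \<longrightarrow> node_ok (reals s ''K'') xs (ints s ''w'') u"
    and xs: "proper_intervals T xs" and W: "int T < W" "2 * int (length xs) < W"
  shows "run W upd c replay s (floorlog 2 v)
     (\<lambda>s'. tree_range (length xs) (ints s' ''w'') 1 \<and>
        (\<forall>u. 1 \<le> u \<and> u < length xs \<longrightarrow> node_ok (reals s ''K'') xs (ints s' ''w'') u))"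
  unfolding replay_def
proof (rule run_While[where \<Phi> = "floorlog 2" and f = "\<lambda>_. 0" and g = v and
      I = "\<lambda>v s1. v < length xs \<and> ints s1 ''v'' 0 = int v \<and> tree_range (length xs) (ints s1 ''w'') 1 \<and>
        (\<forall>u. 1 \<le> u \<and> u < length xs \<and> \<not> anc u v \<longrightarrow> node_ok (reals s ''K'') xs (ints s1 ''w'') u)"],
      goal_cases)
  case 1
  then show ?case using s v tree by simp
next
  case (2 v s1)
  then show ?case using W by simp
next
  case (3 v s1)
  let ?N = "length xs"
  have s1: "has_intervals xs s1" "reals s1 ''K'' = reals s ''K''"
    using 3(2) s by (simp_all add: unchanged_ints unchanged_reals has_intervals_def play_def)
  have v: "1 \<le> v" "v < ?N" and vv: "ints s1 ''v'' 0 = int v" using 3 by auto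
  have tr: "tree_range ?N (ints s1 ''w'') (Suc v)"
    using 3(1) by (auto simp: tree_range_def)
  show ?case
  proof (rule run_init[OF play_wp[OF s1(1) vv v tr xs W]], goal_cases)
    case (1 s2)
    then obtain z where z: "s2 = set_int ''w'' v z s1" by blast
    have "node_ok (reals s ''K'') xs (ints s2 ''w'') u"
      if "1 \<le> u" "u < ?N" "\<not> anc u (v div 2)" for u
    proof (cases "u = v")
      case True
      then show ?thesis using 1(2) s1(2) by simp
    next
      case False
      then have "\<not> anc u v" using anc_split that(3) by blast
      then have "node_ok (reals s ''K'') xs (ints s1 ''w'') u" using 3(1) that by auto
      \<comment> \<open>The only node having \<open>v\<close> as a child is \<open>v div 2\<close>,
        which is still to be replayed; so the new entry at \<open>v\<close> cannot invalidate
        \<open>u\<close>.\<close>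
      moreover have "2 * u \<noteq> v" "2 * u + 1 \<noteq> v" using that(3) anc_refl[of u] by auto
      ultimately show ?thesis
        using False by (simp add: node_ok_def z state_simps)
    qed
    moreover have "tree_range ?N (ints s2 ''w'') 1"
      using 3(1) 1(2) by (auto simp: tree_range_def z state_simps)
    ultimately show ?case
      using z vv v W floorlog_half[OF v(1)]
      by (intro run_wp) (auto simp: state_simps zdiv_int intro!: exI[of _ "v div 2"])
  qed
next
  case (4 v s1)
  then have "v = 0" by simp
  moreover have "\<not> anc u 0" if "1 \<le> u" for u using that by (auto simp: anc_def)
  ultimately show ?case using 4 by auto
qed

definition has_order :: "(nat \<Rightarrow> real) \<Rightarrow> interval list \<Rightarrow> nat list \<Rightarrow> state \<Rightarrow> bool" where
  "has_order key xs os s \<longleftrightarrow> distinct os \<and> set os = {..<length xs} \<and>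
     (\<forall>j<length xs. ints s ''ord'' j = int (os ! j)) \<and> sorted_wrt (before key xs) os"

lemma sort_extract_run:
  assumes s: "has_intervals xs s" "\<forall>i<length xs. reals s ''K'' i = key i"
    and key: "\<forall>i<length xs. 0 \<le> key i"
    and tree: "tree_range (length xs) (ints s ''w'') 1"
      "\<forall>u. 1 \<le> u \<and> u < length xs \<longrightarrow> node_ok (reals s ''K'') xs (ints s ''w'') u"
    and xs: "proper_intervals T xs" and W: "int T < W" "2 * int (length xs) < W"
  shows "run W upd c sort_extract s (length xs * Suc (floorlog 2 (length xs))) (\<lambda>s'. \<exists>os. has_order key xs os s')"
  unfolding sort_extract_def
proof (rule run_init[where Q = "\<lambda>s'. ints s' ''j'' 0 = 0"], goal_cases)
  case 1
  then show ?case using W by (simp add: state_simps)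
next
  case (2 s0)
  let ?N = "length xs"
  have s0: "has_intervals xs s0"
    using 2(1) s by (simp add: unchanged_ints has_intervals_def)
  define I where "I j s1 \<longleftrightarrow> ints s1 ''j'' 0 = int j \<and> tree_range ?N (ints s1 ''w'') 1 \<and>
     (\<forall>u. 1 \<le> u \<and> u < ?N \<longrightarrow> node_ok (reals s1 ''K'') xs (ints s1 ''w'') u) \<and>
     (\<exists>os. length os = j \<and> distinct os \<and> set os \<subseteq> {..<?N} \<and> (\<forall>i<j. ints s1 ''ord'' i = int (os ! i)) \<and>
       sorted_wrt (before key xs) os \<and> (\<forall>x\<in>set os. \<forall>y<?N. y \<notin> set os \<longrightarrow> before key xs x y) \<and>
       (\<forall>y<?N. reals s1 ''K'' y = (if y \<in> set os then -1 else key y)))" for j and s1 :: state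
  show ?case
  proof (rule run_conseq[OF run_for[where n = "?N" and f = "\<lambda>_. floorlog 2 ?N" and I = I]], goal_cases)
    case 1
    have "reals s0 = reals s" "ints s0 ''w'' = ints s ''w''"
      using 2(1) by (auto simp: unchanged_ints unchanged_reals)
    then show ?case using 2(2) s(2) tree by (simp add: I_def)
  next
    case (2 j s1)
    have s1: "has_intervals xs s1"
      using 2(3) s0 by (simp add: unchanged_ints has_intervals_def extract_step_def play_def replay_def)
    have j: "ints s1 ''j'' 0 = int j" and tr: "tree_range ?N (ints s1 ''w'') 1"
      and ok: "\<And>u. 1 \<le> u \<Longrightarrow> u < ?N \<Longrightarrow> node_ok (reals s1 ''K'') xs (ints s1 ''w'') u"
      using 2(2) by (auto simp: I_def)
    obtain os where os: "length os = j" "distinct os" "set os \<subseteq> {..<?N}"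
      "\<forall>i<j. ints s1 ''ord'' i = int (os ! i)" "sorted_wrt (before key xs) os"
      "\<forall>x\<in>set os. \<forall>y<?N. y \<notin> set os \<longrightarrow> before key xs x y"
      "\<forall>y<?N. reals s1 ''K'' y = (if y \<in> set os then -1 else key y)"
      using 2(2) by (auto simp: I_def)
    define x where "x = nat (ints s1 ''w'' 1)"
    have x: "ints s1 ''w'' 1 = int x" "ints s1 ''w'' (Suc 0) = int x" "x < ?N"
      using tr 2(1) by (auto simp: tree_range_def x_def nat_less_iff)
    have top: "before (reals s1 ''K'') xs x y" if "y < ?N" for y
    proof -
      have "before (reals s1 ''K'') xs x (nat (ints s1 ''w'' (?N + y)))"
        using tree_top[where u = "?N + y" and N = ?N, OF ok] that by (simp add: x_def)
      moreover have "ints s1 ''w'' (?N + y) = int y" by (rule tree_leaf[OF tr that])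
      ultimately show ?thesis by simp
    qed
    have "card (set os) < ?N" using os(1,2) 2(1) by (simp add: distinct_card)
    then obtain y where y: "y < ?N" "y \<notin> set os"
      using card_mono[of "set os" "{..<?N}"] by (metis List.finite_set card_lessThan lessThan_iff not_le subsetI)
    \<comment> \<open>An extracted index has key \<open>-1\<close>, below the nonnegative key of the
      index \<open>y\<close> that is still present, so it cannot win at the root.\<close>
    have xos: "x \<notin> set os"
    proof
      assume "x \<in> set os"
      then have "reals s1 ''K'' x = -1" "reals s1 ''K'' y \<ge> 0" using os(7) x(3) y key by auto
      then show False using top[OF y(1)] by (auto simp: before_def)
    qed
    have xmin: "before key xs x y" if "y < ?N" "y \<notin> set os" for y
      using top[OF that(1)] that os(7) x(3) xos by (auto simp: before_def)
    define v where "v = (?N + x) div 2"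
    have v: "v < ?N" using x(3) by (simp add: v_def)
    have "run W upd c extract_step s1 (floorlog 2 v + 0) (I (Suc j))"
      unfolding extract_step_def
    proof (rule run_init[where Q = "\<lambda>s'. ints s' ''v'' 0 = int v \<and> ints s' ''ord'' = (ints s1 ''ord'')(j := int x) \<and>
          reals s' ''K'' = (reals s1 ''K'')(x := -1)"], goal_cases)
      case 1
      then show ?case
        using j x s1 W 2(1) by (simp add: state_simps has_intervals_def v_def zdiv_int)
    next
      case (2 s2)
      have s2: "has_intervals xs s2" "ints s2 ''w'' = ints s1 ''w''"
        using 2(1) s1 by (simp_all add: unchanged_ints has_intervals_def)
      have ok2: "\<forall>u. 1 \<le> u \<and> u < ?N \<and> \<not> anc u v \<longrightarrow> node_ok (reals s2 ''K'') xs (ints s2 ''w'') u"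
      proof (intro allI impI)
        fix u assume u: "1 \<le> u \<and> u < ?N \<and> \<not> anc u v"
        \<comment> \<open>The key of \<open>x\<close> enters the comparison at \<open>u\<close> only
          if \<open>x\<close> is the winner of a child of \<open>u\<close>; then \<open>u\<close> is
          an ancestor of the leaf of \<open>x\<close>, whose parent is \<open>v\<close>.\<close>
        have "nat (ints s1 ''w'' t) \<noteq> x" if "t = 2 * u \<or> t = 2 * u + 1" for t
        proof
          assume *: "nat (ints s1 ''w'' t) = x"
          have "anc t (?N + x)" using tr u that * by (auto simp: tree_range_def)
          then have "t = ?N + x \<or> anc t v" using anc_split v_def by blast
          then have "anc u v"
            using that half_anc[of t v] anc_refl[of u] by (auto simp: v_def)
          then show False using u by simp
        qed
        from this[of "2 * u"] this[of "2 * u + 1"]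
        show "node_ok (reals s2 ''K'') xs (ints s2 ''w'') u"
          using ok[of u] u 2(2) s2(2) by (simp add: node_ok_def before_def)
      qed
      show ?case
      proof (rule run_Seq[OF replay_run[OF s2(1) _ v _ ok2 xs W]], goal_cases)
        case 1 then show ?case using 2(2) by simp
      next
        case 2 then show ?case using tr s2(2) by simp
      next
        case (3 s3)
        have e: "ints s3 ''ord'' = (ints s1 ''ord'')(j := int x)" "reals s3 ''K'' = (reals s1 ''K'')(x := -1)"
          "reals s2 ''K'' = reals s3 ''K''" "ints s3 ''j'' 0 = int j"
          using 3(1) 2 j by (simp_all add: unchanged_ints unchanged_reals replay_def play_def)
        have "I (Suc j) (set_int ''j'' 0 (int j + 1) s3)"
          unfolding I_def
        proof (intro conjI exI[of _ "os @ [x]"], goal_cases)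
          case 7
          then show ?case using e(1) os(1,4) by (auto simp: state_simps nth_append less_Suc_eq)
        next
          case 8
          then show ?case using os(5,6) xmin xos x(3) by (auto simp: sorted_wrt_append)
        next
          case 9
          then show ?case using os(6) xmin by auto
        next
          case 10
          then show ?case using os(7) e(2) by (auto simp: state_simps)
        qed (use 3(2) e os xos x(3) in \<open>auto simp: state_simps\<close>)
        then show ?case
          using e(4) W \<open>j < ?N\<close> by (intro run_wp) auto
      qed
    qed
    moreover have "floorlog 2 v \<le> floorlog 2 ?N" using v by (simp add: floorlog_mono)
    ultimately have "run W upd c extract_step s1 (floorlog 2 ?N) (I (Suc j))"
      by (elim run_conseq) auto
    then show ?case using j s1 W 2(1) by (simp add: has_intervals_def)
  next
    case (3 s1)
    have "ints s1 ''n'' 0 = int ?N"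
      using 3(2) s0 by (simp add: unchanged_ints has_intervals_def extract_step_def play_def replay_def)
    then show ?case using 3 W by (simp add: I_def)
  next
    case (5 s1)
    then obtain os where os: "length os = ?N" "distinct os" "set os \<subseteq> {..<?N}"
      "\<forall>i<?N. ints s1 ''ord'' i = int (os ! i)" "sorted_wrt (before key xs) os"
      by (auto simp: I_def)
    have "set os = {..<?N}"
      using os by (intro card_subset_eq) (simp_all add: distinct_card)
    then show ?case using os by (auto simp: has_order_def)
  qed auto
qed

lemma sort_intervals_run:
  assumes s: "has_intervals xs s"
    and e: "\<And>i s1. i < length xs \<Longrightarrow> ints s1 ''v'' 0 = int i \<Longrightarrow>
       (\<forall>x. x \<noteq> ''v'' \<and> x \<noteq> ''w'' \<longrightarrow> ints s1 x = ints s x) \<Longrightarrow>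
       (\<forall>x. x \<noteq> ''K'' \<longrightarrow> reals s1 x = reals s x) \<Longrightarrow> rsafe W s1 e \<and> rval s1 e = key i"
    and key: "\<forall>i<length xs. 0 \<le> key i"
    and xs: "proper_intervals T xs" "xs \<noteq> []" and W: "int T < W" "2 * int (length xs) < W"
  shows "run W upd c (sort_intervals e) s (length xs * (3 + floorlog 2 (length xs)))
     (\<lambda>s'. \<exists>os. has_order key xs os s')"
proof -
  have "run W upd c (sort_intervals e) s
      (length xs + (length xs + length xs * Suc (floorlog 2 (length xs)))) (\<lambda>s'. \<exists>os. has_order key xs os s')"
    unfolding sort_intervals_def
  proof (rule run_Seq[OF sort_init_run[OF s e W(2)]], assumption+, goal_cases)
    case (1 s1)
    have s1: "has_intervals xs s1"
      using 1(1) s by (simp add: unchanged_ints has_intervals_def sort_init_def)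
    show ?case
    proof (rule run_Seq[OF sort_build_run[OF s1 _ xs W]], goal_cases)
      case 1
      then show ?case using \<open>_ \<and> _\<close> by simp
    next
      case (2 s2)
      have s2: "has_intervals xs s2" "reals s2 ''K'' = reals s1 ''K''"
        using 2(1) s1 by (simp_all add: unchanged_ints unchanged_reals has_intervals_def sort_build_def play_def)
      show ?case
        by (rule sort_extract_run[OF s2(1) _ key _ _ xs(1) W]) (use 1 2 s2 in auto)
    qed
  qed
  then show ?thesis by (rule run_conseq) (auto simp: algebra_simps)
qed

section \<open>Selection as one pass over a sorted list\<close>

text \<open>The tie rule for intervals that is realised by sorting with
  \<open>before\<close>.\<close>

definition lex_min :: "interval set \<Rightarrow> interval" where
  "lex_min A = (let l = Min (fst ` A) in (l, Min {r. (l, r) \<in> A}))"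

lemma finite_section: "finite A \<Longrightarrow> finite {r. (l, r) \<in> A}"
  by (rule finite_subset[of _ "snd ` A"]) force+

lemma tie_rule_lex_min: "tie_rule lex_min"
  unfolding tie_rule_def
proof (intro allI impI)
  fix A :: "interval set" assume A: "finite A \<and> A \<noteq> {}"
  let ?l = "Min (fst ` A)"
  have "?l \<in> fst ` A" using A by (intro Min_in) auto
  then have "{r. (?l, r) \<in> A} \<noteq> {}" by force
  then have "Min {r. (?l, r) \<in> A} \<in> {r. (?l, r) \<in> A}"
    using A by (intro Min_in finite_section) auto
  then show "lex_min A \<in> A" by (simp add: lex_min_def Let_def)
qed

lemma tie_rule_Min: "tie_rule (Min :: 'a::linorder set \<Rightarrow> 'a)"
  by (simp add: tie_rule_def)

lemma lex_min_eqI: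
  assumes "finite A" "I \<in> A" "\<And>J. J \<in> A \<Longrightarrow> lex_le I J"
  shows "lex_min A = I"
proof -
  have 1: "Min (fst ` A) = fst I"
    using assms by (intro Min_eqI) (force simp: lex_le_def)+
  have "Min {r. (fst I, r) \<in> A} = snd I"
    using assms finite_section[OF assms(1)] by (intro Min_eqI) (force simp: lex_le_def)+
  then show ?thesis by (simp add: lex_min_def 1)
qed

text \<open>One step of the pass. The picks form a list because the greedy search needs their order.
  As in the selection method, an interval contains its right end but not its left end.\<close>

definition pick :: "(interval \<Rightarrow> nat) \<Rightarrow> (interval \<Rightarrow> real) \<Rightarrow> real \<Rightarrow> interval list \<Rightarrow> interval \<Rightarrow> interval list" where
  "pick b g \<kappa> ps I =
     (if \<kappa> < g I \<and> (\<forall>J\<in>set ps. \<not> (fst I < b J \<and> b J \<le> snd I)) then ps @ [I] else ps)"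

abbreviation picks :: "(interval \<Rightarrow> nat) \<Rightarrow> (interval \<Rightarrow> real) \<Rightarrow> real \<Rightarrow> interval list \<Rightarrow> interval list" where
  "picks b g \<kappa> ys \<equiv> foldl (pick b g \<kappa>) [] ys"

lemma picks_snoc:
  "picks b g \<kappa> (ys @ [I]) =
     (if \<kappa> < g I \<and> (\<forall>J\<in>set (picks b g \<kappa> ys). \<not> (fst I < b J \<and> b J \<le> snd I))
      then picks b g \<kappa> ys @ [I] else picks b g \<kappa> ys)"
  by (simp only: foldl_append foldl.simps pick_def[of b g \<kappa> "picks b g \<kappa> ys" I])

text \<open>An interval contains its own split, so it is rejected once that split has been declared.
  Hence the splits are distinct, even if an interval occurs twice in the list.\<close>

lemma picks_props:
  assumes "\<And>I. I \<in> set ys \<Longrightarrow> fst I < b I \<and> b I < snd I"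
  shows "set (picks b g \<kappa> ys) \<subseteq> {I \<in> set ys. \<kappa> < g I} \<and> distinct (map b (picks b g \<kappa> ys)) \<and>
    length (picks b g \<kappa> ys) \<le> length ys \<and> (sorted_wrt P ys \<longrightarrow> sorted_wrt P (picks b g \<kappa> ys))"
  using assms
proof (induction ys rule: rev_induct)
  case (snoc I ys)
  have *: "fst I < b I" "b I \<le> snd I" using snoc.prems[of I] by auto
  have IH: "set (picks b g \<kappa> ys) \<subseteq> {I \<in> set ys. \<kappa> < g I}" "distinct (map b (picks b g \<kappa> ys))"
    "length (picks b g \<kappa> ys) \<le> length ys" "sorted_wrt P ys \<longrightarrow> sorted_wrt P (picks b g \<kappa> ys)"
    using snoc by auto
  have "b I \<notin> b ` set (picks b g \<kappa> ys)"
    if "\<forall>J\<in>set (picks b g \<kappa> ys). \<not> (fst I < b J \<and> b J \<le> snd I)"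
    using that * by force
  then show ?case
    using IH by (auto simp: picks_snoc sorted_wrt_append simp del: foldl_append)
qed simp

text \<open>As long as the gains exceed \<open>\<kappa>\<close>, they also exceed
  \<open>\<kappa>'\<close> and both passes act alike. Afterwards the pass with threshold
  \<open>\<kappa>\<close> accepts nothing, and what the other one accepts is filtered out.\<close>

lemma picks_filter:
  assumes "sorted_wrt (\<lambda>I J. g J \<le> g I) ys" "\<kappa>' \<le> \<kappa>"
  shows "picks b g \<kappa> ys = filter (\<lambda>I. \<kappa> < g I) (picks b g \<kappa>' ys)"
  using assms(1)
proof (induction ys rule: rev_induct)
  case (snoc I ys)
  have IH: "picks b g \<kappa> ys = filter (\<lambda>I. \<kappa> < g I) (picks b g \<kappa>' ys)"
    using snoc by (simp add: sorted_wrt_append)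
  show ?case
  proof (cases "\<kappa> < g I")
    case True
    have sub: "set (picks b g \<kappa>' zs) \<subseteq> set zs" for zs
      by (induction zs rule: rev_induct) (auto simp: picks_snoc simp del: foldl_append)
    have "\<kappa> < g J" if "J \<in> set (picks b g \<kappa>' ys)" for J
      using snoc.prems True that sub[of ys] by (force simp: sorted_wrt_append)
    then have "filter (\<lambda>I. \<kappa> < g I) (picks b g \<kappa>' ys) = picks b g \<kappa>' ys"
      by (simp add: filter_id_conv)
    then show ?thesis using IH True assms(2) by (simp add: picks_snoc del: foldl_append)
  next
    case False
    then show ?thesis using IH by (simp add: picks_snoc del: foldl_append)
  qed
qed simp

lemma max_gain_nonneg: "0 \<le> max_gain \<sigma> X I"
  by (simp add: max_gain_def)

lemma pick_square:
  assumes "0 \<le> \<kappa>"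
  shows "pick b (\<lambda>I. (max_gain \<sigma> X I)\<^sup>2) (\<kappa>\<^sup>2) = pick b (max_gain \<sigma> X) \<kappa>"
proof -
  have "\<kappa>\<^sup>2 < (max_gain \<sigma> X I)\<^sup>2 \<longleftrightarrow> \<kappa> < max_gain \<sigma> X I" for I
    using assms max_gain_nonneg[of \<sigma> X I] by (meson not_le power2_less_imp_less power2_le_imp_le power_mono power_strict_mono zero_less_numeral)
  then show ?thesis by (auto simp: pick_def fun_eq_iff)
qed

text \<open>The sort is by decreasing nonnegative keys; subtracting the length from \<open>T\<close>
  brings the shortest intervals to the front.\<close>

definition sort_key :: "selection \<Rightarrow> nat \<Rightarrow> (nat \<Rightarrow> real) \<Rightarrow> interval \<Rightarrow> real" where
  "sort_key sel T X I = (case sel of Greedy \<Rightarrow> (max_gain Min X I)\<^sup>2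
     | Narrowest \<Rightarrow> real T - (real (snd I) - real (fst I)))"

definition key_sorted :: "selection \<Rightarrow> nat \<Rightarrow> (nat \<Rightarrow> real) \<Rightarrow> interval list \<Rightarrow> bool" where
  "key_sorted sel T X ys \<longleftrightarrow> sorted_wrt (\<lambda>I J. sort_key sel T X J < sort_key sel T X I \<or>
     sort_key sel T X I = sort_key sel T X J \<and> lex_le I J) ys"

lemma candidates_insert:
  "max_gain \<sigma> X J \<le> \<kappa> \<Longrightarrow> candidates sel \<sigma> X \<kappa> (insert J R) = candidates sel \<sigma> X \<kappa> R"
  by (cases sel) (force simp: candidates_def)+

text \<open>An interval whose gain is not above the threshold is never a candidate and never
  excludes one. The pass drops such an interval at once, whereas the selection method keeps it among
  the remaining ones.\<close>

lemma selects_insert: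
  "selects sel \<sigma> \<pi> X \<kappa> R S \<Longrightarrow> max_gain \<sigma> X J \<le> \<kappa> \<Longrightarrow> selects sel \<sigma> \<pi> X \<kappa> (insert J R) S"
proof (induction rule: selects.induct)
  case (stop R)
  then show ?case by (intro selects.stop) (simp add: candidates_insert)
next
  case (pick R \<eta> S)
  let ?f = "\<lambda>R. {(l, r) \<in> R. \<not> (l < \<eta> \<and> \<eta> \<le> r)}"
  have "?f (insert J R) = insert J (?f R) \<or> ?f (insert J R) = ?f R" by force
  then have "selects sel \<sigma> \<pi> X \<kappa> (?f (insert J R)) S"
    using pick by auto
  then show ?case
    using pick by (intro selects.pick) (simp_all add: candidates_insert)
qed

lemma selects_unique:
  "selects sel \<sigma> \<pi> X \<kappa> R S \<Longrightarrow> selects sel \<sigma> \<pi> X \<kappa> R S' \<Longrightarrow> S = S'"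
proof (induction arbitrary: S' rule: selects.induct)
  case (stop R)
  from stop(2,1) show ?case by (cases rule: selects.cases) auto
next
  case (pick R \<eta> S)
  from pick.prems show ?case
  proof (cases rule: selects.cases)
    case stop
    then show ?thesis using pick.hyps(1) by simp
  next
    case (pick \<eta>' S'')
    then show ?thesis using pick.IH pick.hyps(2) by simp
  qed
qed

text \<open>All candidates agree with \<open>I\<close> in the primary key, so among them the list
  order is the lexicographic one, and \<open>I\<close> is its first element.\<close>

lemma first_candidate:
  assumes sorted: "key_sorted sel T X (I # zs)" and R: "R \<subseteq> set (I # zs)" "I \<in> R"
    and proper: "\<And>I. I \<in> R \<Longrightarrow> fst I + 2 \<le> snd I"
    and gain: "\<kappa> < max_gain Min X I"
  shows "candidates sel Min X \<kappa> R \<noteq> {}" "lex_min (candidates sel Min X \<kappa> R) = I"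
proof -
  have key: "sort_key sel T X J < sort_key sel T X I \<or>
     sort_key sel T X I = sort_key sel T X J \<and> lex_le I J" if "J \<in> R" for J
    using sorted R that by (auto simp: key_sorted_def lex_le_def)
  have I: "I \<in> candidates sel Min X \<kappa> R"
  proof (cases sel)
    case Greedy
    have "max_gain Min X J \<le> max_gain Min X I" if "J \<in> R" for J
    proof -
      have "(max_gain Min X J)\<^sup>2 \<le> (max_gain Min X I)\<^sup>2"
        using key[OF that] Greedy by (auto simp: sort_key_def)
      then show ?thesis by (rule power2_le_imp_le) (rule max_gain_nonneg)
    qed
    then show ?thesis using Greedy R(2) gain by (simp add: candidates_def)
  next
    case Narrowest
    have "snd I - fst I \<le> snd J - fst J" if "J \<in> R" for J
      using key[OF that] proper[of I] proper[of J] R that Narrowest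
      by (auto simp: sort_key_def subset_eq)
    then show ?thesis using Narrowest R(2) gain by (simp add: candidates_def)
  qed
  then show "candidates sel Min X \<kappa> R \<noteq> {}" by blast
  have sub: "candidates sel Min X \<kappa> R \<subseteq> R" by (cases sel) (auto simp: candidates_def)
  show "lex_min (candidates sel Min X \<kappa> R) = I"
  proof (rule lex_min_eqI)
    show "finite (candidates sel Min X \<kappa> R)"
      using sub R(1) by (meson List.finite_set finite_subset)
    fix J assume J: "J \<in> candidates sel Min X \<kappa> R"
    moreover have "fst I + 2 \<le> snd I" "fst J + 2 \<le> snd J" using proper R J sub by auto
    ultimately have "sort_key sel T X I = sort_key sel T X J"
    proof (cases sel)
      case Greedy
      then have "max_gain Min X I = max_gain Min X J"
        using I J by (auto simp: candidates_def intro: antisym)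
      then show ?thesis using Greedy by (simp add: sort_key_def)
    next
      case Narrowest
      then have "snd I - fst I = snd J - fst J"
        using I J by (auto simp: candidates_def intro: antisym)
      then have "real (snd I) - real (fst I) = real (snd J) - real (fst J)"
        using \<open>fst I + 2 \<le> snd I\<close> \<open>fst J + 2 \<le> snd J\<close> by linarith
      then show ?thesis using Narrowest by (simp add: sort_key_def)
    qed
    then show "lex_le I J" using key[of J] J sub by auto
  qed (rule I)
qed

text \<open>Generalised over the earlier picks \<open>ps\<close> for the induction. The head of the
  list is blocked by an earlier split, or below the threshold (\<open>selects_insert\<close>), or
  the next choice (\<open>first_candidate\<close>).\<close>

lemma selects_pass:
  assumes "key_sorted sel T X ys" "\<And>I. I \<in> set ys \<Longrightarrow> fst I + 2 \<le> snd I"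
  shows "\<exists>S. selects sel Min lex_min X \<kappa>
      {I \<in> set ys. \<forall>J\<in>set ps. \<not> (fst I < best_split Min X J \<and> best_split Min X J \<le> snd I)} S \<and>
      best_split Min X ` set (foldl (pick (best_split Min X) (max_gain Min X) \<kappa>) ps ys) =
        best_split Min X ` set ps \<union> S"
  using assms
proof (induction ys arbitrary: ps)
  case Nil
  have "candidates sel Min X \<kappa> {} = {}" by (cases sel) (simp_all add: candidates_def)
  then show ?case by (auto intro: selects.stop)
next
  case (Cons I zs)
  let ?b = "best_split Min X" and ?g = "max_gain Min X"
  let ?R = "\<lambda>ps ys. {I \<in> set ys. \<forall>J\<in>set ps. \<not> (fst I < ?b J \<and> ?b J \<le> snd I)}"
  have IH: "\<exists>S. selects sel Min lex_min X \<kappa> (?R ps zs) S \<and>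
      ?b ` set (foldl (pick ?b ?g \<kappa>) ps zs) = ?b ` set ps \<union> S" for ps
    using Cons by (simp add: key_sorted_def)
  show ?case
  proof (cases "\<forall>J\<in>set ps. \<not> (fst I < ?b J \<and> ?b J \<le> snd I)")
    case False
    then have "?R ps (I # zs) = ?R ps zs" "pick ?b ?g \<kappa> ps I = ps" by (auto simp: pick_def)
    then show ?thesis using IH[of ps] by simp
  next
    case free: True
    then have R: "?R ps (I # zs) = insert I (?R ps zs)" by auto
    show ?thesis
    proof (cases "\<kappa> < ?g I")
      case False
      then have "pick ?b ?g \<kappa> ps I = ps" by (simp add: pick_def)
      then show ?thesis
        using IH[of ps] selects_insert[of sel Min lex_min X \<kappa> "?R ps zs" _ I] False
        unfolding R by auto
    next
      case True
      then have p: "pick ?b ?g \<kappa> ps I = ps @ [I]" using free by (simp add: pick_def)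
      obtain S where S: "selects sel Min lex_min X \<kappa> (?R (ps @ [I]) zs) S"
        "?b ` set (foldl (pick ?b ?g \<kappa>) (ps @ [I]) zs) = ?b ` set (ps @ [I]) \<union> S"
        using IH[of "ps @ [I]"] by blast
      have cand: "candidates sel Min X \<kappa> (?R ps (I # zs)) \<noteq> {}"
        "lex_min (candidates sel Min X \<kappa> (?R ps (I # zs))) = I"
        using first_candidate[OF Cons.prems(1), of "?R ps (I # zs)" \<kappa>] free True Cons.prems(2) by auto
      \<comment> \<open>Since \<open>I\<close> contains its own split, deleting the intervals around
        that split also deletes \<open>I\<close> and leaves only members of
        \<open>zs\<close>.\<close>
      have "?b I \<in> {fst I<..<snd I}" using Cons.prems(2)[of I] by (intro best_split_in) simp
      then have "{(l, r) \<in> ?R ps (I # zs). \<not> (l < ?b I \<and> ?b I \<le> r)} = ?R (ps @ [I]) zs"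
        by auto
      then have "selects sel Min lex_min X \<kappa> (?R ps (I # zs)) (insert (?b I) S)"
        using S(1) cand by (intro selects.pick) simp_all
      then show ?thesis using S(2) p by auto
    qed
  qed
qed

lemma solution_path_eq:
  assumes "key_sorted sel T X ys" "\<And>I. I \<in> set ys \<Longrightarrow> fst I + 2 \<le> snd I"
  shows "solution_path sel Min lex_min X (set ys) =
    (\<lambda>\<kappa>. best_split Min X ` set (picks (best_split Min X) (\<lambda>I. (max_gain Min X I)\<^sup>2) \<kappa> ys)) `
      (\<lambda>I. (max_gain Min X I)\<^sup>2) ` set ys"
proof -
  have 1: "selects sel Min lex_min X \<kappa> (set ys)
      (best_split Min X ` set (picks (best_split Min X) (max_gain Min X) \<kappa> ys))" for \<kappa>
    using selects_pass[OF assms, of \<kappa> "[]"] by auto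
  then have "selects sel Min lex_min X \<kappa> (set ys) S \<longleftrightarrow>
      S = best_split Min X ` set (picks (best_split Min X) (max_gain Min X) \<kappa> ys)" for \<kappa> S
    using selects_unique by blast
  then show ?thesis
    by (auto simp: solution_path_def image_image pick_square[OF max_gain_nonneg])
qed

text \<open>A prefix of the greedy picks is the result for some threshold iff it does not separate two picks
  with the same gain.\<close>

definition valid_prefix :: "(interval \<Rightarrow> real) \<Rightarrow> interval list \<Rightarrow> nat \<Rightarrow> bool" where
  "valid_prefix g ps j \<longleftrightarrow> j \<le> length ps \<and> (j = 0 \<or> j = length ps \<or> g (ps ! j) < g (ps ! (j - 1)))"

text \<open>Comparison with a threshold is strict, so the gain of the first pick outside the prefix
  excludes exactly what it should; the full list belongs to the smallest gain
  \<open>\<kappa>\<close>.\<close>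

definition prefix_threshold :: "(interval \<Rightarrow> real) \<Rightarrow> real \<Rightarrow> interval list \<Rightarrow> nat \<Rightarrow> real" where
  "prefix_threshold g \<kappa> ps j = (if j = length ps then \<kappa> else g (ps ! j))"

lemma filter_eq_take:
  assumes "\<And>i. i < j \<Longrightarrow> P (xs ! i)" "\<And>i. j \<le> i \<Longrightarrow> i < length xs \<Longrightarrow> \<not> P (xs ! i)" "j \<le> length xs"
  shows "filter P xs = take j xs"
proof -
  have "filter P (take j xs) = take j xs"
    using assms(1,3) by (auto simp: filter_id_conv in_set_conv_nth)
  moreover have "filter P (drop j xs) = []"
    using assms(2,3) by (auto simp: filter_empty_conv in_set_conv_nth)
  ultimately show ?thesis by (metis append_Nil2 append_take_drop_id filter_append)
qed

context
  fixes g :: "interval \<Rightarrow> real" and b :: "interval \<Rightarrow> nat" and ys :: "interval list" and \<kappa> :: real and ps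
  assumes sorted: "sorted_wrt (\<lambda>I J. g J \<le> g I) ys"
    and interior: "\<And>I. I \<in> set ys \<Longrightarrow> fst I < b I \<and> b I < snd I"
    and kappa: "\<kappa> \<in> g ` set ys" "\<And>I. I \<in> set ys \<Longrightarrow> \<kappa> \<le> g I"
    and ps: "ps = picks b g \<kappa> ys"
begin

lemma ps_sorted: "i \<le> j \<Longrightarrow> j < length ps \<Longrightarrow> g (ps ! j) \<le> g (ps ! i)"
  using picks_props[of ys b g \<kappa> "\<lambda>I J. g J \<le> g I", OF interior] sorted
  unfolding ps[symmetric] by (cases "i = j") (auto simp: sorted_wrt_iff_nth_less)

lemma ps_in: "i < length ps \<Longrightarrow> ps ! i \<in> set ys \<and> \<kappa> < g (ps ! i)"
  using picks_props[of ys b g \<kappa> "\<lambda>I J. g J \<le> g I", OF interior] nth_mem[of i ps]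
  unfolding ps[symmetric] by blast

lemma picks_prefix_threshold:
  assumes "valid_prefix g ps j"
  shows "picks b g (prefix_threshold g \<kappa> ps j) ys = take j ps" "prefix_threshold g \<kappa> ps j \<in> g ` set ys"
proof -
  let ?t = "prefix_threshold g \<kappa> ps j"
  show t: "?t \<in> g ` set ys"
    using kappa(1) ps_in assms by (auto simp: prefix_threshold_def valid_prefix_def)
  then have "\<kappa> \<le> ?t" using kappa(2) by auto
  then have "picks b g ?t ys = filter (\<lambda>I. ?t < g I) ps"
    using picks_filter[OF sorted] ps by simp
  also have "\<dots> = take j ps"
  proof (rule filter_eq_take)
    show "j \<le> length ps" using assms by (simp add: valid_prefix_def)
    show "?t < g (ps ! i)" if "i < j" for i
    proof (cases "j = length ps")
      case True
      then show ?thesis using that ps_in by (simp add: prefix_threshold_def)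
    next
      case False
      then show ?thesis
        using assms that ps_sorted[of i "j - 1"] by (force simp: prefix_threshold_def valid_prefix_def)
    qed
    show "\<not> ?t < g (ps ! i)" if "j \<le> i" "i < length ps" for i
      using that ps_sorted[of j i] by (auto simp: prefix_threshold_def)
  qed
  finally show "picks b g ?t ys = take j ps" .
qed

text \<open>Gains do not increase along the picks, so those above \<open>\<kappa>'\<close> form an
  initial part, and at its end the gain drops strictly.\<close>

lemma picks_is_prefix:
  assumes "\<kappa>' \<in> g ` set ys"
  shows "\<exists>j. valid_prefix g ps j \<and> picks b g \<kappa>' ys = take j ps"
proof -
  define j where "j = length (takeWhile (\<lambda>I. \<kappa>' < g I) ps)"
  have le: "j \<le> length ps" by (simp add: j_def length_takeWhile_le)
  have small: "g (ps ! i) \<le> \<kappa>'" if "j \<le> i" "i < length ps" for i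
    using ps_sorted[OF that] nth_length_takeWhile[of "\<lambda>I. \<kappa>' < g I" ps] that by (auto simp: j_def)
  have big: "\<kappa>' < g (ps ! i)" if "i < j" for i
    using that by (metis j_def nth_mem set_takeWhileD takeWhile_nth)
  have "picks b g \<kappa>' ys = filter (\<lambda>I. \<kappa>' < g I) ps"
    using picks_filter[OF sorted] kappa(2) assms ps by auto
  also have "\<dots> = take j ps"
    using small big le by (intro filter_eq_take) (auto simp: not_less)
  finally have "picks b g \<kappa>' ys = take j ps" .
  moreover have "valid_prefix g ps j"
    unfolding valid_prefix_def using le small[of j] big[of "j - 1"] by force
  ultimately show ?thesis by blast
qed

end

section \<open>The residual sum of squares\<close>

definition segment_rss :: "(nat \<Rightarrow> real) \<Rightarrow> nat \<Rightarrow> nat \<Rightarrow> real" where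
  "segment_rss X i j = (\<Sum>t\<in>{i<..j}. (X t)\<^sup>2) - (\<Sum>t\<in>{i<..j}. X t)\<^sup>2 / real (j - i)"

lemma segment_rss_eq:
  assumes "i < j"
  shows "(\<Sum>t\<in>{i<..j}. (segment_mean X i j - X t)\<^sup>2) = segment_rss X i j"
proof -
  define m n S where "m = segment_mean X i j" and "n = real (j - i)" and "S = (\<Sum>t\<in>{i<..j}. X t)"
  have n: "n > 0" using assms by (simp add: n_def)
  have m: "m = S / n" by (simp add: m_def segment_mean_def S_def n_def)
  have "(\<Sum>t\<in>{i<..j}. (m - X t)\<^sup>2) = (\<Sum>t\<in>{i<..j}. m\<^sup>2 - 2 * m * X t + (X t)\<^sup>2)"
    by (simp add: power2_diff algebra_simps)
  also have "\<dots> = n * m\<^sup>2 - 2 * m * S + (\<Sum>t\<in>{i<..j}. (X t)\<^sup>2)"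
    by (simp add: sum.distrib sum_subtractf sum_distrib_left n_def S_def)
  also have "n * m\<^sup>2 - 2 * m * S = - (S\<^sup>2 / n)"
    using n by (simp add: m field_simps power2_eq_square)
  finally show ?thesis by (simp add: segment_rss_def m_def n_def S_def)
qed

text \<open>Stated without positions in a sorted list: a linked list knows only neighbours, and a
  deletion changes this relation only locally.\<close>

definition adjacent :: "nat set \<Rightarrow> nat \<Rightarrow> nat \<Rightarrow> nat \<Rightarrow> bool" where
  "adjacent S T p q \<longleftrightarrow> p \<in> insert 0 S \<and> q \<in> insert T S \<and> p < q \<and> (\<forall>u\<in>S. \<not> (p < u \<and> u < q))"

text \<open>The segments are reindexed by their right ends instead of their positions. Adjacency
  determines the predecessor uniquely, so any \<open>prv\<close> with this property may be
  used.\<close>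

lemma info_criterion_eq:
  assumes S: "S \<subseteq> {1..<T}" and T: "0 < T"
    and prv: "\<And>q. q \<in> insert T S \<Longrightarrow> adjacent S T (prv q) q"
  shows "info_criterion PEN T X S = (\<Sum>q\<in>insert T S. segment_rss X (prv q) q) + PEN S"
proof -
  have fin: "finite S" using S by (rule finite_subset) simp
  define zs where "zs = 0 # sorted_list_of_set S @ [T]"
  have len: "length zs = card S + 2" using fin by (simp add: zs_def)
  have strict: "sorted_wrt (<) zs"
    using S T fin by (auto simp: zs_def sorted_wrt_append strict_sorted_list_of_set)
  then have less: "zs ! i < zs ! j" if "i < j" "j < length zs" for i j
    using that by (simp add: sorted_wrt_iff_nth_less)
  have tl: "set (tl zs) = insert T S" using fin by (simp add: zs_def insert_commute)
  have bl: "zs ! i \<in> insert 0 S" if "i < card S + 1" for i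
    using that fin nth_mem[of "i - 1" "sorted_list_of_set S"] by (auto simp: zs_def nth_append nth_Cons split: nat.splits)
  have bij: "bij_betw (\<lambda>i. zs ! (i + 1)) {0..card S} (insert T S)"
  proof (rule bij_betw_imageI)
    show "inj_on (\<lambda>i. zs ! (i + 1)) {0..card S}"
    proof (rule inj_onI)
      fix i j assume "i \<in> {0..card S}" "j \<in> {0..card S}" "zs ! (i + 1) = zs ! (j + 1)"
      then show "i = j"
        using less[of "i + 1" "j + 1"] less[of "j + 1" "i + 1"] len by (cases i j rule: linorder_cases) simp_all
    qed
    have "(\<lambda>i. zs ! (i + 1)) ` {0..card S} = (\<lambda>i. tl zs ! i) ` {0..<length (tl zs)}"
      using len by (intro image_cong) (auto simp: nth_tl)
    also have "\<dots> = set (tl zs)" by (simp add: nth_image del: length_tl)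
    finally have "(\<lambda>i. zs ! (i + 1)) ` {0..card S} = set (tl zs)" .
    then show "(\<lambda>i. zs ! (i + 1)) ` {0..card S} = insert T S" using tl by simp
  qed
  have prev: "prv (zs ! (i + 1)) = zs ! i" if i: "i \<le> card S" for i
  proof -
    let ?q = "zs ! (i + 1)" and ?p = "zs ! i"
    have q: "?q \<in> insert T S" using bij i by (auto simp: bij_betw_def)
    have a: "adjacent S T (prv ?q) ?q" by (rule prv[OF q])
    have "?p < ?q" using less len i by simp
    have between: "\<not> (?p < u \<and> u < ?q)" if "u \<in> S" for u
    proof -
      have "u \<in> set zs" using that fin by (simp add: zs_def)
      then obtain k where k: "k < length zs" "u = zs ! k" by (auto simp: in_set_conv_nth)
      consider "k < i" | "k = i" | "k = i + 1" | "i + 1 < k" by linarith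
      then show ?thesis using less[of k i] less[of "i + 1" k] k i len by cases auto
    qed
    have "?p \<in> insert 0 S" using bl i by simp
    show ?thesis
    proof (rule linorder_cases[of "prv ?q" ?p])
      assume "prv ?q < ?p"
      then show ?thesis using a \<open>?p \<in> insert 0 S\<close> \<open>?p < ?q\<close> by (auto simp: adjacent_def)
    next
      assume "?p < prv ?q"
      then show ?thesis using a between by (auto simp: adjacent_def)
    qed simp
  qed
  have "info_criterion PEN T X S =
      (\<Sum>i = 0..card S. \<Sum>t\<in>{zs ! i<..zs ! (i + 1)}. (segment_mean X (zs ! i) (zs ! (i + 1)) - X t)\<^sup>2) + PEN S"
    by (simp add: info_criterion_def Let_def zs_def)
  also have "(\<Sum>i = 0..card S. \<Sum>t\<in>{zs ! i<..zs ! (i + 1)}. (segment_mean X (zs ! i) (zs ! (i + 1)) - X t)\<^sup>2) =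
      (\<Sum>i = 0..card S. segment_rss X (prv (zs ! (i + 1))) (zs ! (i + 1)))"
    using len less by (intro sum.cong refl) (simp add: segment_rss_eq prev[unfolded Suc_eq_plus1[symmetric]])
  also have "\<dots> = (\<Sum>q\<in>insert T S. segment_rss X (prv q) q)"
    using sum.reindex_bij_betw[OF bij, of "\<lambda>q. segment_rss X (prv q) q"] by simp
  finally show ?thesis .
qed

section \<open>Selection and scoring on the machine\<close>

definition sq_gain :: "(nat \<Rightarrow> real) \<Rightarrow> interval \<Rightarrow> real" where
  "sq_gain X I = (max_gain Min X I)\<^sup>2"

abbreviation sq_picks :: "(nat \<Rightarrow> real) \<Rightarrow> real \<Rightarrow> interval list \<Rightarrow> interval list" where
  "sq_picks X \<equiv> picks (best_split Min X) (sq_gain X)"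

abbreviation splits :: "(nat \<Rightarrow> real) \<Rightarrow> interval list \<Rightarrow> nat set" where
  "splits X ps \<equiv> best_split Min X ` set ps"

text \<open>The part of the state that is computed once and only read by the search;
  \<open>prepared_unchanged\<close> carries it through all later code.\<close>

definition prepared :: "(nat \<Rightarrow> real) \<Rightarrow> nat \<Rightarrow> interval list \<Rightarrow> nat list \<Rightarrow> state \<Rightarrow> bool" where
  "prepared X T xs os s \<longleftrightarrow> ints s ''T'' 0 = int T \<and> has_sums X T s \<and> has_intervals xs s \<and> has_gains X xs s \<and>
     (\<forall>j<length xs. ints s ''ord'' j = int (os ! j))"

lemma prepared_unchanged:
  assumes "prepared X T xs os s" "unchanged p s s'"
    "int_vars p \<inter> {''T'', ''n'', ''L'', ''R'', ''B'', ''ord''} = {}" "real_vars p \<inter> {''P'', ''Q'', ''G''} = {}"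
  shows "prepared X T xs os s'"
proof -
  have "ints s' x = ints s x" if "x \<in> {''T'', ''n'', ''L'', ''R'', ''B'', ''ord''}" for x
    using assms(2,3) that by (auto simp: unchanged_def)
  moreover have "reals s' x = reals s x" if "x \<in> {''P'', ''Q'', ''G''}" for x
    using assms(2,4) that by (auto simp: unchanged_def)
  ultimately show ?thesis
    using assms(1) by (simp add: prepared_def has_sums_def has_intervals_def has_gains_def)
qed

definition has_marks :: "nat set \<Rightarrow> nat \<Rightarrow> state \<Rightarrow> bool" where
  "has_marks S T s \<longleftrightarrow> (\<forall>t\<in>{1..T}. ints s ''mk'' t = (if t \<in> S then 1 else 0))"

text \<open>The penalties of all prefixes are kept, because no update is available for the removal
  of a split point.\<close>

definition selected :: "(nat \<Rightarrow> real) \<Rightarrow> (nat set \<Rightarrow> real) \<Rightarrow> nat \<Rightarrow> interval list \<Rightarrow> state \<Rightarrow> bool" where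
  "selected X PEN T ps s \<longleftrightarrow> ints s ''m'' 0 = int (length ps) \<and>
     (\<forall>j<length ps. ints s ''cp'' j = int (best_split Min X (ps ! j)) \<and> reals s ''gp'' (Suc j) = sq_gain X (ps ! j)) \<and>
     (\<forall>j\<le>length ps. reals s ''pen'' j = PEN (splits X (take j ps))) \<and> has_marks (splits X ps) T s"

text \<open>\<open>gp\<close> is shifted by one, which leaves \<open>gp[0]\<close> for a sentinel above all gains; thresholds (\<open>kap\<close>)
  are squared like the gains.\<close>

definition hit_loop :: com where
  "hit_loop = While (ILe (IV ''pos'') (IV ''r''))
     (Cond (ILe (Num 1) (ICell ''mk'' (IV ''pos''))) (ISet ''hit'' (Num 1)) Skip ;;
      ISet ''pos'' (IAdd (IV ''pos'') (Num 1)))"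

definition clear_marks :: com where
  "clear_marks = ISet ''t'' (Num 0) ;;
     While (ILt (IV ''t'') (IV ''T'')) (ISet ''t'' (IAdd (IV ''t'') (Num 1)) ;; IAssign ''mk'' (IV ''t'') (Num 0))"

definition accept :: com where
  "accept = PenUpd ''pen'' (IAdd (IV ''m'') (Num 1)) ''cp'' (IV ''m'') (RCell ''pen'' (IV ''m'')) (ICell ''B'' (IV ''x'')) ;;
     IAssign ''cp'' (IV ''m'') (ICell ''B'' (IV ''x'')) ;;
     ISet ''m'' (IAdd (IV ''m'') (Num 1)) ;;
     RAssign ''gp'' (IV ''m'') (RCell ''G'' (IV ''x'')) ;;
     IAssign ''mk'' (ICell ''B'' (IV ''x'')) (Num 1)"

definition forward_body :: com where
  "forward_body =
     (ISet ''x'' (ICell ''ord'' (IV ''j'')) ;; ISet ''pos'' (IAdd (ICell ''L'' (IV ''x'')) (Num 1)) ;;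
      ISet ''r'' (ICell ''R'' (IV ''x'')) ;; ISet ''hit'' (Num 0)) ;;
     hit_loop ;;
     (Cond (Conj (ILe (IV ''hit'') (Num 0)) (RLt (RV ''kap'') (RCell ''G'' (IV ''x'')))) accept Skip ;;
      ISet ''j'' (IAdd (IV ''j'') (Num 1)))"

definition forward :: com where
  "forward = clear_marks ;; (ISet ''m'' (Num 0) ;; ISet ''j'' (Num 0)) ;;
     While (ILt (IV ''j'') (IV ''n'')) forward_body"

lemmas forward_defs = forward_def forward_body_def accept_def hit_loop_def clear_marks_def

lemma hit_loop_run:
  assumes s: "ints s ''pos'' 0 = int l + 1" "ints s ''r'' 0 = int r" "ints s ''hit'' 0 = 0"
    and marks: "has_marks S T s" and lr: "l \<le> r" "r \<le> T" and W: "int T + 2 < W"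
  shows "run W upd c hit_loop s (r - l) (\<lambda>s'. ints s' ''hit'' 0 = (if \<exists>u\<in>S. l < u \<and> u \<le> r then 1 else 0))"
  unfolding hit_loop_def
proof (rule run_conseq[OF run_for[where n = "r - l" and f = "\<lambda>_. 0" and
      I = "\<lambda>i s1. ints s1 ''pos'' 0 = int (l + 1 + i) \<and>
        ints s1 ''hit'' 0 = (if \<exists>u\<in>S. l < u \<and> u \<le> l + i then 1 else 0)"]], goal_cases)
  case 1
  then show ?case using s by auto
next
  case (2 i s1)
  have s1: "ints s1 ''r'' 0 = int r" "ints s1 ''mk'' = ints s ''mk''"
    using 2(3) s by (simp_all add: unchanged_ints)
  have i: "Suc (l + i) \<le> r" using 2(1) by simp
  then have mk: "ints s ''mk'' (Suc (l + i)) = (if Suc (l + i) \<in> S then 1 else 0)"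
    using marks lr by (simp add: has_marks_def)
  have eq: "(\<exists>u\<in>S. l < u \<and> u \<le> Suc (l + i)) \<longleftrightarrow> Suc (l + i) \<in> S \<or> (\<exists>u\<in>S. l < u \<and> u \<le> l + i)"
    by (auto simp: le_Suc_eq intro: bexI[of _ "Suc (l + i)"])
  have nat: "nat (1 + (int l + int i)) = Suc (l + i)" by simp
  show ?case
    using 2(2) s1 i mk lr W by (intro conjI run_wp) (auto simp: state_simps eq nat)
next
  case (3 s1)
  then have "ints s1 ''r'' 0 = int r" using s by (simp add: unchanged_ints)
  then show ?case using 3 lr W by simp
next
  case (5 s1)
  then show ?case using lr by simp
qed auto

lemma clear_marks_run:
  assumes "ints s ''T'' 0 = int T" and W: "int T < W"
  shows "run W upd c clear_marks s T (has_marks {} T)"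
  unfolding clear_marks_def
proof (rule run_init[where Q = "\<lambda>s'. ints s' ''t'' 0 = 0"], goal_cases)
  case 1
  then show ?case using W by (simp add: state_simps)
next
  case (2 s0)
  show ?case
  proof (rule run_conseq[OF run_for[where n = T and f = "\<lambda>_. 0" and
      I = "\<lambda>i s1. ints s1 ''t'' 0 = int i \<and> has_marks {} i s1"]], goal_cases)
    case 1
    then show ?case using 2(2) by (simp add: has_marks_def)
  next
    case (2 i s1)
    have "ints s1 ''T'' 0 = int T"
      using 2(3) \<open>unchanged _ s s0\<close> assms by (simp add: unchanged_ints)
    then show ?case
      using 2(1,2) W by (intro conjI run_wp) (auto simp: state_simps has_marks_def nat_offset le_Suc_eq)
  next
    case (3 s1)
    have "ints s1 ''T'' 0 = int T"
      using 3(2) \<open>unchanged _ s s0\<close> assms by (simp add: unchanged_ints)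
    then show ?case using 3 W by simp
  qed auto
qed

lemma proper_splits:
  assumes "proper_intervals T xs" "set ys \<subseteq> set xs"
  shows "splits X ys \<subseteq> {1..<T}"
proof
  fix u assume "u \<in> splits X ys"
  then obtain I where I: "I \<in> set xs" "u = best_split Min X I" using assms(2) by auto
  then have "fst I + 2 \<le> snd I \<and> snd I \<le> T" using assms(1) by (auto simp: proper_intervals_def)
  with best_split_in[of I X] I show "u \<in> {1..<T}" by auto
qed

lemma nth_splits: "(\<lambda>j. best_split Min X (ps ! j)) ` {..<length ps} = splits X ps"
  by (auto simp: set_conv_nth)

text \<open>The penalty is updated before the split is appended to \<open>cp\<close>, so the call
  sees the old set. The new split lies in its interval, which contains no earlier split; hence it is
  new, as \<open>pen_update\<close> demands.\<close>

lemma accept_wp: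
  assumes s: "selected X PEN T ps s" "has_gains X xs s" "ints s ''x'' 0 = int x" "x < length xs"
    and pen: "pen_update T PEN upd" and ps: "set ps \<subseteq> set xs" "length ps < length xs"
    and new: "\<forall>J\<in>set ps. \<not> (fst (xs ! x) < best_split Min X J \<and> best_split Min X J \<le> snd (xs ! x))"
    and xs: "proper_intervals T xs" and W: "int T + 2 < W" "2 * int (length xs) < W"
  shows "wp W upd accept (selected X PEN T (ps @ [xs ! x])) s"
proof -
  let ?b = "best_split Min X (xs ! x)"
  have b: "?b \<in> {fst (xs ! x)<..<snd (xs ! x)}" "snd (xs ! x) \<le> T"
    using best_split_in[of "xs ! x" X] proper_nth[OF xs s(4)] by auto
  then have nb: "?b \<notin> splits X ps" using new by force
  have upd: "upd (splits X ps) (PEN (splits X ps)) ?b = PEN (insert ?b (splits X ps))"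
    using pen b nb proper_splits[OF xs ps(1)] by (auto simp: pen_update_def)
  have cp: "(\<lambda>j. nat (ints s ''cp'' j)) ` {..<length ps} = splits X ps"
  proof -
    have "(\<lambda>j. nat (ints s ''cp'' j)) ` {..<length ps} = (\<lambda>j. best_split Min X (ps ! j)) ` {..<length ps}"
      using s(1) by (intro image_cong) (auto simp: selected_def)
    also have "\<dots> = splits X ps" by (rule nth_splits)
    finally show ?thesis .
  qed
  have m: "ints s ''m'' 0 = int (length ps)" "reals s ''pen'' (length ps) = PEN (splits X ps)"
    "ints s ''B'' x = int ?b" "reals s ''G'' x = sq_gain X (xs ! x)"
    using s by (auto simp: selected_def has_gains_def sq_gain_def)
  have nat: "nat (int (length ps) + 1) = Suc (length ps)" "nat (1 + int (length ps)) = Suc (length ps)" by simp_all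
  show ?thesis
    using s m nat W b ps(2)
    by (auto simp: accept_def state_simps cp nth_splits upd selected_def nth_append less_Suc_eq le_Suc_eq has_marks_def)
qed

lemma forward_run:
  assumes s: "prepared X T xs os s" "reals s ''kap'' 0 = \<kappa>" "reals s ''pen'' 0 = PEN {}"
    and os: "distinct os" "set os = {..<length xs}"
    and pen: "pen_update T PEN upd"
    and xs: "proper_intervals T xs" and W: "int T + 2 < W" "2 * int (length xs) < W"
  shows "run W upd c forward s (T + scan_cost xs)
     (selected X PEN T (sq_picks X \<kappa> (map ((!) xs) os)))"
proof -
  define ys where "ys = map ((!) xs) os"
  have len: "length os = length xs" using os by (metis card_lessThan distinct_card)
  have ys: "length ys = length xs" "\<And>j. j < length xs \<Longrightarrow> ys ! j = xs ! (os ! j)"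
    unfolding ys_def using len by simp_all
  have ys_sub: "set ys \<subseteq> set xs"
    unfolding ys_def set_map os(2) by (rule image_subsetI) simp
  have os_less: "os ! j < length xs" if "j < length xs" for j
    using nth_mem[of j os] that unfolding len os(2) by simp
  \<comment> \<open>The pass visits the intervals in the order \<open>os\<close>, a permutation of
    the indices, so the total number of scanned positions does not depend on the order.\<close>
  have cost: "scan_cost xs = (\<Sum>j<length xs. Suc (snd (ys ! j) - fst (ys ! j)))"
  proof -
    have "bij_betw ((!) os) {..<length xs} {..<length xs}"
      by (rule bij_betw_nth[OF os(1)]) (simp_all only: len os(2))
    from sum.reindex_bij_betw[OF this, of "\<lambda>i. Suc (snd (xs ! i) - fst (xs ! i))"]
    show ?thesis unfolding scan_cost_def by (simp add: ys(2) cong: sum.cong_simp)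
  qed
  have T0: "ints s ''T'' 0 = int T" using s(1) by (simp add: prepared_def)
  have "run W upd c forward s (T + scan_cost xs) (selected X PEN T (sq_picks X \<kappa> ys))"
    unfolding forward_def
  proof (rule run_Seq[OF clear_marks_run[OF T0]], goal_cases)
    case 1
    then show ?case using W by simp
  next
    case (2 s1)
    have s1: "prepared X T xs os s1" "reals s1 ''kap'' 0 = \<kappa>" "reals s1 ''pen'' 0 = PEN {}"
      using prepared_unchanged[OF s(1) 2(1)] 2(1) s by (simp_all add: clear_marks_def unchanged_reals)
    show ?case
    proof (rule run_init[where Q = "\<lambda>s'. ints s' ''m'' 0 = 0 \<and> ints s' ''j'' 0 = 0"], goal_cases)
      case 1
      then show ?case using W by (simp add: state_simps)
    next
      case (2 s2)
      have s2: "prepared X T xs os s2" "reals s2 ''kap'' 0 = \<kappa>" "reals s2 ''pen'' 0 = PEN {}" "has_marks {} T s2"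
        using prepared_unchanged[OF s1(1) 2(1)] 2(1) s1 \<open>has_marks {} T s1\<close>
        by (simp_all add: unchanged_reals unchanged_ints has_marks_def)
      show ?case
        unfolding cost
      proof (rule run_conseq[OF run_for[where n = "length xs" and f = "\<lambda>j. snd (ys ! j) - fst (ys ! j)" and
          I = "\<lambda>j s3. ints s3 ''j'' 0 = int j \<and> selected X PEN T (sq_picks X \<kappa> (take j ys)) s3"]], goal_cases)
        case 1
        then show ?case using 2(2) s2 by (simp add: selected_def)
      next
        case (2 j s3)
        have s3: "prepared X T xs os s3" "reals s3 ''kap'' 0 = \<kappa>"
          using prepared_unchanged[OF s2(1) 2(3)] 2(3) s2 by (simp_all add: forward_defs unchanged_reals)
        define x where "x = os ! j"
        define ps where "ps = sq_picks X \<kappa> (take j ys)"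
        have x: "x < length xs" "xs ! x = ys ! j" "ints s3 ''ord'' j = int x"
          using ys os_less 2(1) s3(1) by (simp_all add: x_def prepared_def)
        have jj: "ints s3 ''j'' 0 = int j" "ints s3 ''n'' 0 = int (length xs)"
          "ints s3 ''L'' x = int (fst (xs ! x))" "ints s3 ''R'' x = int (snd (xs ! x))"
          using 2(2) s3(1) x by (auto simp: prepared_def has_intervals_def)
        note pr = proper_nth[OF xs x(1)]
        have int: "fst I < best_split Min X I \<and> best_split Min X I < snd I" if "I \<in> set (take j ys)" for I
          using best_split_in[of I X] xs that ys_sub by (auto simp: proper_intervals_def dest: in_set_takeD)
        have ps: "set ps \<subseteq> set xs" "length ps < length xs"
          using picks_props[of "take j ys" "best_split Min X" "sq_gain X" \<kappa> "\<lambda>_ _. True", OF int] 2(1) ys(1) ys_sub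
          by (auto simp: ps_def dest!: set_mp[OF set_take_subset])
        have snoc: "sq_picks X \<kappa> (take (Suc j) ys) =
          (if \<kappa> < sq_gain X (xs ! x) \<and> (\<forall>J\<in>set ps. \<not> (fst (xs ! x) < best_split Min X J \<and> best_split Min X J \<le> snd (xs ! x)))
           then ps @ [xs ! x] else ps)"
          using 2(1) ys(1) x(2) by (simp add: take_Suc_conv_app_nth picks_snoc ps_def del: foldl_append)
        have "run W upd c forward_body s3 (snd (ys ! j) - fst (ys ! j) + 0)
          (\<lambda>s4. ints s4 ''j'' 0 = int (Suc j) \<and> selected X PEN T (sq_picks X \<kappa> (take (Suc j) ys)) s4)"
          unfolding forward_body_def
        proof (rule run_init[where Q = "\<lambda>s'. ints s' ''x'' 0 = int x \<and> ints s' ''pos'' 0 = int (fst (xs ! x)) + 1 \<and>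
            ints s' ''r'' 0 = int (snd (xs ! x)) \<and> ints s' ''hit'' 0 = 0"], goal_cases)
          case 1
          then show ?case using jj x pr W \<open>j < length xs\<close> by (simp add: state_simps)
        next
          case (2 s4)
          have s4: "has_marks (splits X ps) T s4"
            using 2(1) \<open>ints s3 ''j'' 0 = int j \<and> _\<close> by (simp add: unchanged_ints has_marks_def selected_def ps_def)
          show ?case
            unfolding x(2)[symmetric]
          proof (rule run_Seq[OF hit_loop_run[OF _ _ _ s4]], goal_cases)
            case (7 s5)
            have s5: "prepared X T xs os s5" "reals s5 ''kap'' 0 = \<kappa>" "ints s5 ''j'' 0 = int j" "ints s5 ''x'' 0 = int x"
              "selected X PEN T ps s5"
              using prepared_unchanged[OF prepared_unchanged[OF s3(1) 2(1)] 7(1)] 7(1) 2 s3 jj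
                \<open>ints s3 ''j'' 0 = int j \<and> _\<close>
              by (simp_all add: hit_loop_def unchanged_reals unchanged_ints selected_def ps_def has_marks_def)
            have g: "reals s5 ''G'' x = sq_gain X (xs ! x)" "has_gains X xs s5"
              using s5(1) x(1) by (auto simp: prepared_def has_gains_def sq_gain_def)
            let ?free = "\<forall>J\<in>set ps. \<not> (fst (xs ! x) < best_split Min X J \<and> best_split Min X J \<le> snd (xs ! x))"
            have hit: "ints s5 ''hit'' 0 = (if ?free then 0 else 1)"
              using 7(2) by auto
            show ?case
            proof (rule run_init[where Q = "\<lambda>s'. selected X PEN T (sq_picks X \<kappa> (take (Suc j) ys)) s'"], goal_cases)
              case 1
              show ?case
              proof (cases "?free \<and> \<kappa> < sq_gain X (xs ! x)")
                case True
                then have "wp W upd accept (selected X PEN T (ps @ [xs ! x])) s5"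
                  by (intro accept_wp[OF s5(5) g(2) s5(4) x(1) pen ps _ xs W]) simp
                then show ?thesis
                  using True s5 hit g W x(1) by (auto simp: snoc)
              next
                case False
                then show ?thesis
                  using s5 hit g W x(1) by (auto simp: snoc)
              qed
            next
              case (2 s6)
              have "ints s6 ''j'' 0 = int j" using 2(1) s5(3) by (simp add: unchanged_ints accept_def)
              then show ?case
                using 2(2) \<open>j < length xs\<close> W by (intro run_wp) (auto simp: state_simps selected_def has_marks_def)
            qed
          qed (use 2(2) pr W in auto)
        qed
        then show ?case using jj W 2(1) by simp
      next
        case (3 s3)
        have "ints s3 ''n'' 0 = int (length xs)"
          using 3(2) s2(1) by (simp add: forward_defs unchanged_ints prepared_def has_intervals_def)
        then show ?case using 3 W by simp
      qed (use ys(1) in auto)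
    qed
  qed
  then show ?thesis by (simp add: ys_def)
qed

section \<open>Residual sum of squares on a linked list of split points\<close>

lemma has_sums_segment:
  assumes "has_sums X T s" "i < j" "j \<le> T"
  shows "reals s ''Q'' j - reals s ''Q'' i - (reals s ''P'' j - reals s ''P'' i) * (reals s ''P'' j - reals s ''P'' i) / real (j - i)
    = segment_rss X i j"
  using has_sums_between[OF assms(1) less_imp_le[OF assms(2)] assms(3)]
  by (simp add: segment_rss_def power2_eq_square)

definition seg_exp :: "vname \<Rightarrow> vname \<Rightarrow> rexp" where
  "seg_exp p q = RSub (RSub (RCell ''Q'' (IV q)) (RCell ''Q'' (IV p)))
     (RDiv (RMul (RSub (RCell ''P'' (IV q)) (RCell ''P'' (IV p))) (RSub (RCell ''P'' (IV q)) (RCell ''P'' (IV p))))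
       (OfInt (ISub (IV q) (IV p))))"

lemma seg_exp:
  assumes "has_sums X T s" "ints s p 0 = int i" "ints s q 0 = int j" "i < j" "j \<le> T" "int T < W"
  shows "rval s (seg_exp p q) = segment_rss X i j" "rsafe W s (seg_exp p q)"
  using assms has_sums_segment[OF assms(1,4,5)] by (simp_all add: seg_exp_def of_nat_diff)

definition link_mark :: com where
  "link_mark = Cond (ILe (Num 1) (ICell ''mk'' (IV ''t'')))
          (RSet ''rss'' (RAdd (RV ''rss'') (seg_exp ''last'' ''t'')) ;;
           IAssign ''prv'' (IV ''t'') (IV ''last'') ;;
           IAssign ''nxt'' (IV ''last'') (IV ''t'') ;;
           ISet ''last'' (IV ''t''))
          Skip"

text \<open>The end \<open>T\<close> is marked too, so that the last segment is closed by the same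
  code as the others; the next pass clears all marks.\<close>

definition scan :: com where
  "scan = (IAssign ''mk'' (IV ''T'') (Num 1) ;; ISet ''t'' (Num 0) ;; ISet ''last'' (Num 0) ;; RSet ''rss'' (OfInt (Num 0))) ;;
     While (ILt (IV ''t'') (IV ''T''))
       (ISet ''t'' (IAdd (IV ''t'') (Num 1)) ;;
        link_mark)"

definition linked :: "nat set \<Rightarrow> nat \<Rightarrow> state \<Rightarrow> bool" where
  "linked S T s \<longleftrightarrow>
     (\<forall>q\<in>insert T S. 0 \<le> ints s ''prv'' q \<and> adjacent S T (nat (ints s ''prv'' q)) q) \<and>
     (\<forall>p\<in>insert 0 S. 0 \<le> ints s ''nxt'' p \<and> adjacent S T p (nat (ints s ''nxt'' p)))"

definition has_rss :: "(nat \<Rightarrow> real) \<Rightarrow> nat set \<Rightarrow> nat \<Rightarrow> state \<Rightarrow> bool" where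
  "has_rss X S T s \<longleftrightarrow> reals s ''rss'' 0 = (\<Sum>q\<in>insert T S. segment_rss X (nat (ints s ''prv'' q)) q)"

lemma has_rss_info:
  assumes "linked S T s" "has_rss X S T s" "S \<subseteq> {1..<T}" "0 < T"
  shows "reals s ''rss'' 0 + PEN S = info_criterion PEN T X S"
proof -
  have "adjacent S T (nat (ints s ''prv'' q)) q" if "q \<in> insert T S" for q
    using assms(1) that unfolding linked_def by blast
  then show ?thesis
    using info_criterion_eq[OF assms(3,4), of "\<lambda>q. nat (ints s ''prv'' q)" PEN X] assms(2)
    by (simp only: has_rss_def)
qed

lemma scan_run:
  assumes s: "ints s ''T'' 0 = int T" "has_sums X T s" "has_marks S T s"
    and S: "S \<subseteq> {1..<T}" and T: "0 < T" and W: "int T + 2 < W"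
  shows "run W upd c scan s T (\<lambda>s'. linked S T s' \<and> has_rss X S T s')"
  unfolding scan_def
proof (rule run_init[where Q = "\<lambda>s'. ints s' ''t'' 0 = 0 \<and> ints s' ''last'' 0 = 0 \<and> reals s' ''rss'' 0 = 0 \<and>
    has_marks (insert T S) T s'"], goal_cases)
  case 1
  show ?case using s(1,3) W by (auto simp: state_simps has_marks_def)
next
  case (2 s0)
  have s0: "ints s0 ''T'' 0 = int T" "has_sums X T s0"
    using 2(1) s by (simp_all add: unchanged_ints unchanged_reals has_sums_def)
  let ?M = "insert T S"
  have fin: "finite S" using S by (rule finite_subset) simp
  \<comment> \<open>Here \<open>l\<close> is the last mark up to \<open>i\<close>, or 0 if there is
    none. Its successor is unknown until the next mark is met, so \<open>nxt\<close> is claimed only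
    for \<open>p < l\<close>.\<close>
  define I where "I i s1 \<longleftrightarrow> ints s1 ''t'' 0 = int i \<and>
     (\<exists>l. ints s1 ''last'' 0 = int l \<and> l \<in> insert 0 ?M \<and> l \<le> i \<and> (\<forall>u\<in>?M. u \<le> i \<longrightarrow> u \<le> l) \<and>
       reals s1 ''rss'' 0 = (\<Sum>q\<in>?M \<inter> {..i}. segment_rss X (nat (ints s1 ''prv'' q)) q) \<and>
       (\<forall>q\<in>?M \<inter> {..i}. 0 \<le> ints s1 ''prv'' q \<and> adjacent S T (nat (ints s1 ''prv'' q)) q) \<and>
       (\<forall>p\<in>insert 0 S. p < l \<longrightarrow> 0 \<le> ints s1 ''nxt'' p \<and> adjacent S T p (nat (ints s1 ''nxt'' p))))" for i and s1 :: state
  show ?case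
  proof (rule run_conseq[OF run_for[where n = T and f = "\<lambda>_. 0" and I = I]], goal_cases)
    case 1
    have "?M \<inter> {..0} = {}" using S T by auto
    then show ?case using 2(2) by (auto simp: I_def)
  next
    case (2 i s1)
    have s1: "ints s1 ''T'' 0 = int T" "has_sums X T s1" "has_marks ?M T s1"
      using 2(3) s0 \<open>_ \<and> _ \<and> _ \<and> has_marks ?M T s0\<close>
      by (simp_all add: unchanged_ints unchanged_reals has_sums_def has_marks_def link_mark_def)
    obtain l where l: "ints s1 ''last'' 0 = int l" "l \<in> insert 0 ?M" "l \<le> i" "\<And>u. u \<in> ?M \<Longrightarrow> u \<le> i \<Longrightarrow> u \<le> l"
      "reals s1 ''rss'' 0 = (\<Sum>q\<in>?M \<inter> {..i}. segment_rss X (nat (ints s1 ''prv'' q)) q)"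
      "\<And>q. q \<in> ?M \<Longrightarrow> q \<le> i \<Longrightarrow> 0 \<le> ints s1 ''prv'' q \<and> adjacent S T (nat (ints s1 ''prv'' q)) q"
      "\<And>p. p \<in> insert 0 S \<Longrightarrow> p < l \<Longrightarrow> 0 \<le> ints s1 ''nxt'' p \<and> adjacent S T p (nat (ints s1 ''nxt'' p))"
    proof -
      obtain l where "ints s1 ''last'' 0 = int l \<and> l \<in> insert 0 ?M \<and> l \<le> i \<and> (\<forall>u\<in>?M. u \<le> i \<longrightarrow> u \<le> l) \<and>
       reals s1 ''rss'' 0 = (\<Sum>q\<in>?M \<inter> {..i}. segment_rss X (nat (ints s1 ''prv'' q)) q) \<and>
       (\<forall>q\<in>?M \<inter> {..i}. 0 \<le> ints s1 ''prv'' q \<and> adjacent S T (nat (ints s1 ''prv'' q)) q) \<and>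
       (\<forall>p\<in>insert 0 S. p < l \<longrightarrow> 0 \<le> ints s1 ''nxt'' p \<and> adjacent S T p (nat (ints s1 ''nxt'' p)))"
        using 2(2) unfolding I_def by blast
      then show thesis by (intro that[of l]) auto
    qed
    have t: "ints s1 ''t'' 0 = int i" using 2(2) by (simp add: I_def)
    have mk: "ints s1 ''mk'' (Suc i) = (if Suc i \<in> ?M then 1 else 0)"
      using s1(3) 2(1) by (simp add: has_marks_def)
    define s2 where "s2 = set_int ''t'' 0 (1 + int i) s1"
    have s2: "has_sums X T s2" "ints s2 ''last'' 0 = int l" "ints s2 ''t'' 0 = int (Suc i)"
      "ints s2 ''mk'' (Suc i) = (if Suc i \<in> ?M then 1 else 0)" "reals s2 ''rss'' 0 = reals s1 ''rss'' 0"
      using s1(2) l(1) mk by (simp_all add: s2_def has_sums_def state_simps)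
    have nat: "nat (1 + int i) = Suc i" by simp
    have wp: "wp W upd link_mark (I (Suc i)) s2"
    proof (cases "Suc i \<in> ?M")
      case True
      have eqM: "?M \<inter> {..Suc i} = insert (Suc i) (?M \<inter> {..i})" using True by (auto simp: le_Suc_eq)
      have adj: "adjacent S T l (Suc i)"
        using l(2,3,4) True 2(1) by (force simp: adjacent_def)
      have seg: "rval s2 (seg_exp ''last'' ''t'') = segment_rss X l (Suc i)" "rsafe W s2 (seg_exp ''last'' ''t'')"
        using seg_exp[OF s2(1,2,3), of W] l(3) 2(1) W by simp_all
      have "I (Suc i) (set_int ''last'' 0 (1 + int i) (set_int ''nxt'' l (1 + int i) (set_int ''prv'' (Suc i) (int l)
          (set_real ''rss'' 0 (reals s1 ''rss'' 0 + segment_rss X l (Suc i)) s2))))"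
        unfolding I_def
      proof (intro conjI exI[of _ "Suc i"], goal_cases)
        case 6
        have "(\<Sum>q\<in>?M \<inter> {..i}. segment_rss X (nat (((ints s1 ''prv'')(Suc i := int l)) q)) q) =
            (\<Sum>q\<in>?M \<inter> {..i}. segment_rss X (nat (ints s1 ''prv'' q)) q)"
          by (intro sum.cong) auto
        then show ?case using fin l(5) by (simp add: state_simps s2_def eqM)
      next
        case 7
        show ?case using l(6) adj unfolding eqM by (auto simp: state_simps s2_def)
      next
        case 8
        show ?case
        proof (intro ballI impI)
          fix p assume p: "p \<in> insert 0 S" "p < Suc i"
          let ?s = "set_int ''last'' 0 (1 + int i) (set_int ''nxt'' l (1 + int i) (set_int ''prv'' (Suc i) (int l)
            (set_real ''rss'' 0 (reals s1 ''rss'' 0 + segment_rss X l (Suc i)) s2)))"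
          have nxt: "ints ?s ''nxt'' p = (if p = l then 1 + int i else ints s1 ''nxt'' p)"
            by (simp add: state_simps s2_def)
          show "0 \<le> ints ?s ''nxt'' p \<and> adjacent S T p (nat (ints ?s ''nxt'' p))"
          proof (cases "p = l")
            case True
            then show ?thesis unfolding nxt using adj nat by simp
          next
            case False
            then have "p < l" using l(4)[of p] p l(2) by auto
            then show ?thesis unfolding nxt using l(7)[OF p(1)] False by simp
          qed
        qed
      qed (use True in \<open>auto simp: state_simps s2_def\<close>)
      then show ?thesis
        using True s2(2-) l(3) nat W 2(1) seg by (simp add: link_mark_def state_simps)
    next
      case False
      have eqM: "?M \<inter> {..Suc i} = ?M \<inter> {..i}" using False by (auto simp: le_Suc_eq)
      have "I (Suc i) s2"
        unfolding I_def eqM s2_def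
        using l False by (auto simp: state_simps le_Suc_eq intro!: exI[of _ l])
      then show ?thesis
        using False s2(2-) nat W 2(1) by (simp add: link_mark_def)
    qed
    show ?case
      using s1(1) t W 2(1)
      by (auto simp: s2_def add.commute intro!: run_init[where Q = "\<lambda>s'. s' = s2"] run_wp[OF wp])
  next
    case (3 s1)
    have "ints s1 ''T'' 0 = int T" using 3(2) s0 by (simp add: unchanged_ints link_mark_def)
    then show ?case using 3 W by (simp add: I_def)
  next
    case (5 s1)
    then obtain l where l: "l \<le> T" "\<forall>u\<in>?M. u \<le> T \<longrightarrow> u \<le> l"
      "reals s1 ''rss'' 0 = (\<Sum>q\<in>?M \<inter> {..T}. segment_rss X (nat (ints s1 ''prv'' q)) q)"
      "\<forall>q\<in>?M \<inter> {..T}. 0 \<le> ints s1 ''prv'' q \<and> adjacent S T (nat (ints s1 ''prv'' q)) q"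
      "\<forall>p\<in>insert 0 S. p < l \<longrightarrow> 0 \<le> ints s1 ''nxt'' p \<and> adjacent S T p (nat (ints s1 ''nxt'' p))"
      by (auto simp: I_def)
    have "l = T" using l(1,2) by auto
    moreover have "?M \<inter> {..T} = ?M" using S by auto
    moreover have "p < T" if "p \<in> insert 0 S" for p using S T that by auto
    ultimately show ?case using l(3,4,5) by (auto simp: linked_def has_rss_def)
  qed auto
qed

lemma adjacent_unique:
  assumes "S \<subseteq> {1..<T}"
  shows "adjacent S T p q \<Longrightarrow> adjacent S T p' q \<Longrightarrow> p = p'"
    "adjacent S T p q \<Longrightarrow> adjacent S T p q' \<Longrightarrow> q = q'"
proof -
  assume a: "adjacent S T p q" "adjacent S T p' q"
  show "p = p'"
    using a by (cases p p' rule: linorder_cases) (auto simp: adjacent_def)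
next
  assume a: "adjacent S T p q" "adjacent S T p q'"
  have "q \<le> T" "q' \<le> T" using a assms by (auto simp: adjacent_def)
  then show "q = q'"
    using a by (cases q q' rule: linorder_cases) (auto simp: adjacent_def)
qed

text \<open>Removing \<open>h\<close> merges two segments into the one from \<open>p\<close> to
  \<open>q\<close>. Only the predecessor of \<open>q\<close> and the successor of \<open>p\<close>
  change, which makes the update of the sum a constant-time operation.\<close>

lemma remove_split:
  assumes S: "S \<subseteq> {1..<T}" "h \<in> S"
    and prv: "\<And>q. q \<in> insert T S \<Longrightarrow> adjacent S T (prv q) q"
    and succ: "\<And>p. p \<in> insert 0 S \<Longrightarrow> adjacent S T p (succ p)"
    and p: "p = prv h" and q: "q = succ h"
  shows "adjacent S T p h" "adjacent S T h q"
    "\<And>v. v \<in> insert T (S - {h}) \<Longrightarrow> adjacent (S - {h}) T ((prv(q := p)) v) v"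
    "\<And>u. u \<in> insert 0 (S - {h}) \<Longrightarrow> adjacent (S - {h}) T u ((succ(p := q)) u)"
    "(\<Sum>v\<in>insert T (S - {h}). segment_rss X ((prv(q := p)) v) v) =
      (\<Sum>v\<in>insert T S. segment_rss X (prv v) v) + segment_rss X p q - segment_rss X p h - segment_rss X h q"
proof -
  show ph: "adjacent S T p h" and hq: "adjacent S T h q"
    using prv[of h] succ[of h] S(2) p q by auto
  have hT: "h < T" "0 < h" using S by auto
  have "\<not> (p < u \<and> u < q)" if "u \<in> S" "u \<noteq> h" for u
    using ph hq that by (cases u h rule: linorder_cases) (auto simp: adjacent_def)
  then have pq: "adjacent (S - {h}) T p q"
    using ph hq by (auto simp: adjacent_def)
  show "adjacent (S - {h}) T ((prv(q := p)) v) v" if "v \<in> insert T (S - {h})" for v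
  proof (cases "v = q")
    case False
    have a: "adjacent S T (prv v) v" using prv that by auto
    then have "prv v \<noteq> h" using adjacent_unique(2)[OF S(1) hq] False by auto
    then show ?thesis using a False that by (auto simp: adjacent_def)
  qed (use pq in simp)
  show "adjacent (S - {h}) T u ((succ(p := q)) u)" if "u \<in> insert 0 (S - {h})" for u
  proof (cases "u = p")
    case False
    have a: "adjacent S T u (succ u)" using succ that by auto
    then have "succ u \<noteq> h" using adjacent_unique(1)[OF S(1) ph] False by auto
    then show ?thesis using a False that by (auto simp: adjacent_def)
  qed (use pq in simp)
  have fin: "finite S" using S(1) by (rule finite_subset) simp
  \<comment> \<open>The right ends whose segments are untouched by the removal.\<close>
  define R where "R = insert T S - {h, q}"
  have qh: "q \<in> insert T S" "h < q" using hq by (auto simp: adjacent_def)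
  have 1: "insert T S = insert h (insert q R)" "h \<notin> insert q R" "q \<notin> R" "finite R"
    using qh S(2) fin by (auto simp: R_def)
  have 2: "insert T (S - {h}) = insert q R"
    using qh hT by (auto simp: R_def)
  have "(\<Sum>v\<in>R. segment_rss X ((prv(q := p)) v) v) = (\<Sum>v\<in>R. segment_rss X (prv v) v)"
    using 1(3) by (intro sum.cong) auto
  moreover have "prv q = h"
    using adjacent_unique(1)[OF S(1) prv[OF qh(1)] hq] .
  ultimately show "(\<Sum>v\<in>insert T (S - {h}). segment_rss X ((prv(q := p)) v) v) =
      (\<Sum>v\<in>insert T S. segment_rss X (prv v) v) + segment_rss X p q - segment_rss X p h - segment_rss X h q"
    unfolding 2 1(1) using 1(2,3,4) p by simp
qed

text \<open>The drop from \<open>gp[j]\<close> to \<open>gp[j+1]\<close> is the test for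
  \<open>valid_prefix\<close>, and \<open>gp[j+1]\<close>, the gain of the first pick outside the
  prefix, is its threshold.\<close>

definition improve_prefix :: com where
  "improve_prefix =
     Cond (Conj (RLt (RCell ''gp'' (IAdd (IV ''j'') (Num 1))) (RCell ''gp'' (IV ''j'')))
            (RLt (RAdd (RV ''rss'') (RCell ''pen'' (IV ''j''))) (RV ''best'')))
       (RSet ''best'' (RAdd (RV ''rss'') (RCell ''pen'' (IV ''j''))) ;;
        RSet ''bk'' (RCell ''gp'' (IAdd (IV ''j'') (Num 1))))
       Skip"

section \<open>Searching the solution path\<close>

definition backward_body :: com where
  "backward_body =
     (ISet ''j'' (ISub (IV ''j'') (Num 1)) ;; ISet ''h'' (ICell ''cp'' (IV ''j'')) ;;
      ISet ''p'' (ICell ''prv'' (IV ''h'')) ;; ISet ''q'' (ICell ''nxt'' (IV ''h''))) ;;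
     (RSet ''rss'' (RSub (RSub (RAdd (RV ''rss'') (seg_exp ''p'' ''q'')) (seg_exp ''p'' ''h'')) (seg_exp ''h'' ''q'')) ;;
      IAssign ''nxt'' (IV ''p'') (IV ''q'') ;; IAssign ''prv'' (IV ''q'') (IV ''p'')) ;;
     improve_prefix"

text \<open>The sentinel \<open>gp[0] = gp[1] + 1\<close> makes the empty prefix pass the test for a
  strict drop. Without picks \<open>gp[1]\<close> is arbitrary, but then the loop body is never
  entered.\<close>

definition backward :: com where
  "backward =
     (RSet ''best'' (RAdd (RV ''rss'') (RCell ''pen'' (IV ''m''))) ;; RSet ''bk'' (RV ''kap'') ;;
      RAssign ''gp'' (Num 0) (RAdd (RCell ''gp'' (Num 1)) (OfInt (Num 1))) ;; ISet ''j'' (IV ''m'')) ;;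
     While (ILe (Num 1) (IV ''j'')) backward_body"

lemma splits_take_Suc:
  assumes "distinct (map (best_split Min X) ps)" "j < length ps"
  shows "splits X (take j ps) = splits X (take (Suc j) ps) - {best_split Min X (ps ! j)}"
    "best_split Min X (ps ! j) \<in> splits X (take (Suc j) ps)"
proof -
  have t: "take (Suc j) ps = take j ps @ [ps ! j]" by (rule take_Suc_conv_app_nth[OF assms(2)])
  have "distinct (map (best_split Min X) (take (Suc j) ps))"
    using assms(1) by (metis distinct_take take_map)
  then show "splits X (take j ps) = splits X (take (Suc j) ps) - {best_split Min X (ps ! j)}"
    unfolding t by auto
  show "best_split Min X (ps ! j) \<in> splits X (take (Suc j) ps)" unfolding t by simp
qed

lemma linked_remove:
  assumes S: "S \<subseteq> {1..<T}" "h \<in> S" and link: "linked S T s" "has_rss X S T s"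
    and p: "ints s ''prv'' h = int p" and q: "ints s ''nxt'' h = int q"
    and s': "ints s' ''prv'' = (ints s ''prv'')(q := int p)" "ints s' ''nxt'' = (ints s ''nxt'')(p := int q)"
      "reals s' ''rss'' 0 = reals s ''rss'' 0 + segment_rss X p q - segment_rss X p h - segment_rss X h q"
  shows "linked (S - {h}) T s'" "has_rss X (S - {h}) T s'"
proof -
  let ?prv = "\<lambda>q. nat (ints s ''prv'' q)" and ?nxt = "\<lambda>q. nat (ints s ''nxt'' q)"
  have 1: "adjacent S T (?prv v) v" "0 \<le> ints s ''prv'' v" if "v \<in> insert T S" for v
    using link(1) that unfolding linked_def by blast+
  have 2: "adjacent S T u (?nxt u)" "0 \<le> ints s ''nxt'' u" if "u \<in> insert 0 S" for u
    using link(1) that unfolding linked_def by blast+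
  have pq: "p = ?prv h" "q = ?nxt h" using p q by simp_all
  note r = remove_split[OF S 1(1) 2(1) pq]
  have prv': "(\<lambda>v. nat (ints s' ''prv'' v)) = ?prv(q := p)" and nxt': "(\<lambda>v. nat (ints s' ''nxt'' v)) = ?nxt(p := q)"
    by (auto simp: s')
  show "linked (S - {h}) T s'"
    unfolding linked_def
  proof (intro conjI ballI)
    fix v assume v: "v \<in> insert T (S - {h})"
    show "0 \<le> ints s' ''prv'' v" using 1(2)[of v] v by (auto simp: s'(1))
    show "adjacent (S - {h}) T (nat (ints s' ''prv'' v)) v"
      using r(3)[OF _ _ v] 1 2 fun_cong[OF prv', of v] by simp
  next
    fix v assume v: "v \<in> insert 0 (S - {h})"
    show "0 \<le> ints s' ''nxt'' v" using 2(2)[of v] v by (auto simp: s'(2))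
    show "adjacent (S - {h}) T v (nat (ints s' ''nxt'' v))"
      using r(4)[OF _ _ v] 1 2 fun_cong[OF nxt', of v] by simp
  qed
  show "has_rss X (S - {h}) T s'"
    unfolding has_rss_def s'(3) fun_cong[OF prv', simplified] link(2)[unfolded has_rss_def]
    using r(5)[of X] 1 2 by simp
qed

definition evaluated :: "(nat \<Rightarrow> real) \<Rightarrow> (nat set \<Rightarrow> real) \<Rightarrow> nat \<Rightarrow> real \<Rightarrow> interval list \<Rightarrow> state \<Rightarrow> bool" where
  "evaluated X PEN T \<kappa> ps s \<longleftrightarrow> ints s ''m'' 0 = int (length ps) \<and>
     (\<forall>j<length ps. ints s ''cp'' j = int (best_split Min X (ps ! j)) \<and> reals s ''gp'' (Suc j) = sq_gain X (ps ! j)) \<and>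
     (\<forall>j\<le>length ps. reals s ''pen'' j = PEN (splits X (take j ps))) \<and>
     linked (splits X ps) T s \<and> has_rss X (splits X ps) T s \<and> reals s ''kap'' 0 = \<kappa>"

lemma evaluated_info:
  assumes "evaluated X PEN T \<kappa> ps s" "splits X ps \<subseteq> {1..<T}" "0 < T"
  shows "reals s ''rss'' 0 + reals s ''pen'' (length ps) = info_criterion PEN T X (splits X ps)"
  using has_rss_info[of "splits X ps" T s X PEN] assms by (simp add: evaluated_def)

text \<open>The invariant is optimality among the valid prefixes of at least the current length; it
  starts with the full list, which is always valid.\<close>

lemma backward_run:
  assumes s: "has_sums X T s" and ev: "evaluated X PEN T \<kappa> ps s"
    and ps: "distinct (map (best_split Min X) ps)" "splits X ps \<subseteq> {1..<T}" "2 * int (length ps) < W"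
    and T: "0 < T" and W: "int T + 2 < W"
  shows "run W upd c backward s (length ps) (\<lambda>s'. \<exists>j. valid_prefix (sq_gain X) ps j \<and>
     reals s' ''bk'' 0 = prefix_threshold (sq_gain X) \<kappa> ps j \<and>
     (\<forall>i. valid_prefix (sq_gain X) ps i \<longrightarrow>
        info_criterion PEN T X (splits X (take j ps)) \<le> info_criterion PEN T X (splits X (take i ps))))"
  unfolding backward_def
proof (rule run_init[where Q = "\<lambda>s'. ints s' ''j'' 0 = int (length ps) \<and>
    reals s' ''best'' 0 = info_criterion PEN T X (splits X ps) \<and> reals s' ''bk'' 0 = \<kappa> \<and>
    reals s' ''gp'' = (reals s ''gp'')(0 := reals s ''gp'' 1 + 1)"], goal_cases)
  case 1
  have "reals s ''rss'' 0 + PEN (splits X ps) = info_criterion PEN T X (splits X ps)"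
    using evaluated_info[OF ev ps(2) T] ev[unfolded evaluated_def] by simp
  then show ?case using ev[unfolded evaluated_def] W ps(3) by (simp add: state_simps)
next
  case (2 s0)
  let ?F = "\<lambda>j. info_criterion PEN T X (splits X (take j ps))"
  let ?valid = "valid_prefix (sq_gain X) ps" and ?thr = "prefix_threshold (sq_gain X) \<kappa> ps"
  let ?m = "length ps"
  have s0: "has_sums X T s0" "linked (splits X ps) T s0" "has_rss X (splits X ps) T s0" "ints s0 ''cp'' = ints s ''cp''"
    "reals s0 ''pen'' = reals s ''pen''"
    using 2(1) s ev[unfolded evaluated_def] by (simp_all add: unchanged_ints unchanged_reals has_sums_def linked_def has_rss_def)
  have gp: "reals s0 ''gp'' (Suc j) = sq_gain X (ps ! j)" if "j < ?m" for j
    using 2(2) ev[unfolded evaluated_def] that by auto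
  define I where "I k s1 \<longleftrightarrow> ints s1 ''j'' 0 = int (?m - k) \<and> linked (splits X (take (?m - k) ps)) T s1 \<and>
     has_rss X (splits X (take (?m - k) ps)) T s1 \<and>
     (\<exists>j. ?m - k \<le> j \<and> ?valid j \<and> reals s1 ''bk'' 0 = ?thr j \<and> reals s1 ''best'' 0 = ?F j \<and>
       (\<forall>i. ?m - k \<le> i \<and> ?valid i \<longrightarrow> ?F j \<le> ?F i))" for k and s1 :: state
  show ?case
  proof (rule run_conseq[OF run_for[where n = ?m and f = "\<lambda>_. 0" and I = I]], goal_cases)
    case 1
    have "?valid ?m" "?thr ?m = \<kappa>" by (simp_all add: valid_prefix_def prefix_threshold_def)
    moreover have "i = ?m" if "?m \<le> i" "?valid i" for i using that by (simp add: valid_prefix_def)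
    ultimately show ?case using 2(2) s0 by (auto simp: I_def intro!: exI[of _ ?m])
  next
    case (2 k s1)
    define j where "j = ?m - Suc k"
    have j: "?m - k = Suc j" "j < ?m" using 2(1) by (auto simp: j_def)
    have s1: "has_sums X T s1" "ints s1 ''cp'' j = int (best_split Min X (ps ! j))"
      "reals s1 ''pen'' j = PEN (splits X (take j ps))" "reals s1 ''gp'' = reals s0 ''gp''"
      using 2(3) s0 ev[unfolded evaluated_def] j by (simp_all add: unchanged_ints unchanged_reals has_sums_def backward_body_def improve_prefix_def)
    define S h where "S = splits X (take (Suc j) ps)" and "h = best_split Min X (ps ! j)"
    have Sh: "S \<subseteq> {1..<T}" "h \<in> S" "splits X (take j ps) = S - {h}"
    proof -
      have "S \<subseteq> splits X ps" unfolding S_def by (intro image_mono set_take_subset)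
      then show "S \<subseteq> {1..<T}" using ps(2) by blast
    qed (use splits_take_Suc[OF ps(1) j(2)] in \<open>simp_all add: S_def h_def\<close>)
    have I: "ints s1 ''j'' 0 = int (Suc j)" "linked S T s1" "has_rss X S T s1"
      using 2(2) by (simp_all add: I_def j S_def)
    obtain jb where jb: "Suc j \<le> jb" "?valid jb" "reals s1 ''bk'' 0 = ?thr jb" "reals s1 ''best'' 0 = ?F jb"
       "\<And>i. Suc j \<le> i \<Longrightarrow> ?valid i \<Longrightarrow> ?F jb \<le> ?F i"
      using 2(2) unfolding I_def j by blast
    define p where "p = nat (ints s1 ''prv'' h)"
    define q where "q = nat (ints s1 ''nxt'' h)"
    have pq: "ints s1 ''prv'' h = int p" "ints s1 ''nxt'' h = int q" "adjacent S T p h" "adjacent S T h q"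
      using I(2) Sh(2) by (auto simp: linked_def p_def q_def)
    have lt: "p < h" "h < q" "q \<le> T"
      using pq(3,4) Sh(1) by (auto simp: adjacent_def)
    have "run W upd c backward_body s1 0 (I (Suc k))"
      unfolding backward_body_def
    proof (rule run_init[where Q = "\<lambda>s'. ints s' ''j'' 0 = int j \<and> ints s' ''h'' 0 = int h \<and>
        ints s' ''p'' 0 = int p \<and> ints s' ''q'' 0 = int q"], goal_cases)
      case 1
      then show ?case using I(1) s1(2) pq lt W ps(3) j(2) by (simp add: state_simps nat_offset h_def[symmetric])
    next
      case (2 s2)
      have s2: "has_sums X T s2" "linked S T s2" "has_rss X S T s2" "ints s2 ''prv'' = ints s1 ''prv''"
        "ints s2 ''nxt'' = ints s1 ''nxt''" "reals s2 = reals s1"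
        using 2(1) s1 I by (auto simp: unchanged_ints unchanged_reals has_sums_def linked_def has_rss_def)
      note seg = seg_exp[OF s2(1), of "''p''" p "''q''" q W] seg_exp[OF s2(1), of "''p''" p "''h''" h W]
        seg_exp[OF s2(1), of "''h''" h "''q''" q W]
      show ?case
      proof (rule run_init[where Q = "\<lambda>s'. ints s' ''prv'' = (ints s2 ''prv'')(q := int p) \<and>
          ints s' ''nxt'' = (ints s2 ''nxt'')(p := int q) \<and>
          reals s' ''rss'' 0 = reals s2 ''rss'' 0 + segment_rss X p q - segment_rss X p h - segment_rss X h q"], goal_cases)
        case 1
        then show ?case using 2(2) seg lt W by (simp add: state_simps)
      next
        case (2 s3)
        have link: "linked (splits X (take j ps)) T s3" "has_rss X (splits X (take j ps)) T s3"
          unfolding Sh(3) using 2(2) pq(1,2) s2(4,5)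
          by (intro linked_remove[OF Sh(1,2) s2(2,3), of p q]; simp)+
        have s3: "ints s3 ''j'' 0 = int j" "reals s3 ''pen'' j = PEN (splits X (take j ps))" "reals s3 ''gp'' = reals s0 ''gp''"
          "reals s3 ''bk'' 0 = ?thr jb" "reals s3 ''best'' 0 = ?F jb"
          using 2(1) \<open>ints s2 ''j'' 0 = int j \<and> _\<close> s1 s2(6) jb
          by (simp_all add: unchanged_ints unchanged_reals)
        have val: "reals s3 ''rss'' 0 + PEN (splits X (take j ps)) = ?F j"
          using has_rss_info[OF link _ T] Sh(1,3) by auto
        have valid: "reals s0 ''gp'' (Suc j) < reals s0 ''gp'' j \<longleftrightarrow> ?valid j"
        proof (cases j)
          case 0
          then show ?thesis
            using \<open>_ \<and> _ \<and> _ \<and> reals s0 ''gp'' = _\<close> by (simp add: valid_prefix_def)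
        next
          case (Suc i)
          then show ?thesis using gp[of j] gp[of i] j(2) by (simp add: valid_prefix_def)
        qed
        have thr: "?thr j = reals s0 ''gp'' (Suc j)"
          using gp[OF j(2)] j(2) by (simp add: prefix_threshold_def)
        have ex: "\<exists>j'. j \<le> j' \<and> ?valid j' \<and> b = ?thr j' \<and> v = ?F j' \<and> (\<forall>i. j \<le> i \<and> ?valid i \<longrightarrow> ?F j' \<le> ?F i)"
          if "if ?valid j \<and> ?F j < ?F jb then b = ?thr j \<and> v = ?F j else b = ?thr jb \<and> v = ?F jb" for b v
        proof -
          have le: "i = j \<or> Suc j \<le> i" if "j \<le> i" for i using that by auto
          show ?thesis
          proof (cases "?valid j \<and> ?F j < ?F jb")
            case True
            then have "?F j \<le> ?F i" if "j \<le> i" "?valid i" for i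
              using le[OF that(1)] jb(5)[OF _ that(2)] by fastforce
            then show ?thesis using True that by (intro exI[of _ j]) simp
          next
            case False
            then have "?F jb \<le> ?F i" if "j \<le> i" "?valid i" for i
              using le[OF that(1)] jb(5)[OF _ that(2)] that(2) by fastforce
            then show ?thesis using False that jb(1,2) by (intro exI[of _ jb]) auto
          qed
        qed
        have fin: "I (Suc k) s4" if "ints s4 = ints s3" "reals s4 ''rss'' = reals s3 ''rss''"
          "if ?valid j \<and> ?F j < ?F jb then reals s4 ''bk'' 0 = ?thr j \<and> reals s4 ''best'' 0 = ?F j
           else reals s4 ''bk'' 0 = ?thr jb \<and> reals s4 ''best'' 0 = ?F jb" for s4
          unfolding I_def j_def[symmetric]
          using that(1,2) link s3(1) ex[OF that(3)] by (simp add: linked_def has_rss_def)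
        show ?case
        proof (rule run_wp, cases "?valid j \<and> ?F j < ?F jb")
          case True
          then have "I (Suc k) (set_real ''bk'' 0 (?thr j) (set_real ''best'' 0 (?F j) s3))"
            by (intro fin) (simp_all add: state_simps)
          then show "wp W upd improve_prefix (I (Suc k)) s3"
            using True s3 val valid thr W ps(3) j(2) by (simp add: improve_prefix_def state_simps nat_offset)
        next
          case False
          then have "I (Suc k) s3"
            using s3 by (intro fin) simp_all
          then show "wp W upd improve_prefix (I (Suc k)) s3"
            using False s3 val valid thr W ps(3) j(2) by (auto simp: improve_prefix_def state_simps nat_offset not_le)
        qed
      qed
    qed
    then show ?case using I(1) W ps(3) j(2) by simp
  next
    case (3 s1)
    then show ?case using W by (simp add: I_def)
  next
    case (5 s1)
    then show ?case unfolding I_def by fastforce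
  qed auto
qed

section \<open>Evaluating the criterion for one threshold\<close>

definition evaluate :: "rexp \<Rightarrow> com" where
  "evaluate e = RSet ''kap'' e ;; forward ;; scan"

lemma evaluate_run:
  assumes s: "prepared X T xs os s" "rsafe W s e" "rval s e = \<kappa>" "reals s ''pen'' 0 = PEN {}"
    and os: "distinct os" "set os = {..<length xs}"
    and pen: "pen_update T PEN upd" and T: "0 < T"
    and xs: "proper_intervals T xs" and W: "int T + 2 < W" "2 * int (length xs) < W"
  shows "run W upd c (evaluate e) s (2 * T + scan_cost xs) (\<lambda>s'. prepared X T xs os s' \<and>
     evaluated X PEN T \<kappa> (sq_picks X \<kappa> (map ((!) xs) os)) s')"
proof -
  define ps where "ps = sq_picks X \<kappa> (map ((!) xs) os)"
  have "set ps \<subseteq> set xs"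
  proof -
    have sub: "set (picks b g \<kappa> zs) \<subseteq> set zs" for b g zs
      by (induction zs rule: rev_induct) (auto simp: picks_snoc simp del: foldl_append)
    have "set ps \<subseteq> (!) xs ` {..<length xs}"
      using sub[of "best_split Min X" "sq_gain X" "map ((!) xs) os"] unfolding ps_def set_map os(2) .
    then show ?thesis by auto
  qed
  then have S: "splits X ps \<subseteq> {1..<T}" by (rule proper_splits[OF xs])
  have "run W upd c (evaluate e) s ((T + scan_cost xs) + T)
     (\<lambda>s'. prepared X T xs os s' \<and> evaluated X PEN T \<kappa> ps s')"
    unfolding evaluate_def
  proof (rule run_init[where Q = "\<lambda>s'. reals s' ''kap'' 0 = \<kappa>"], goal_cases)
    case 1
    then show ?case using s W by (simp add: state_simps)
  next
    case (2 s1)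
    have s1: "prepared X T xs os s1" "reals s1 ''pen'' 0 = PEN {}"
      using prepared_unchanged[OF s(1) 2(1)] 2(1) s by (simp_all add: unchanged_reals)
    show ?case
    proof (rule run_Seq[OF forward_run[OF s1(1) 2(2) s1(2) os pen xs W]], goal_cases)
      case (1 s2)
      have s2: "prepared X T xs os s2" "selected X PEN T ps s2" "reals s2 ''kap'' 0 = \<kappa>"
        using prepared_unchanged[OF s1(1) 1(1)] 1 2(2) by (simp_all add: unchanged_reals forward_defs ps_def)
      show ?case
      proof (rule run_conseq[OF scan_run[of s2 T X "splits X ps"]], goal_cases)
        case (8 s3)
        then show ?case
          using prepared_unchanged[OF s2(1) 8(1)] s2 8(1)
          by (simp add: scan_def link_mark_def unchanged_reals unchanged_ints selected_def evaluated_def)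
      qed (use s2 S T W in \<open>auto simp: prepared_def selected_def\<close>)
    qed
  qed
  then show ?thesis
    unfolding ps_def by (rule run_conseq) auto
qed


lemma picks_subset: "set (picks b g \<kappa> zs) \<subseteq> set zs"
  by (induction zs rule: rev_induct) (auto simp: picks_snoc simp del: foldl_append)

text \<open>Optimality is formulated for thresholds: a threshold is one number that encodes a whole
  segmentation, and by \<open>solution_path_eq\<close> the path is the image of the attained squared
  gains.\<close>

definition best_threshold :: "(nat set \<Rightarrow> real) \<Rightarrow> nat \<Rightarrow> (nat \<Rightarrow> real) \<Rightarrow> interval list \<Rightarrow> real \<Rightarrow> bool" where
  "best_threshold PEN T X ys \<kappa> \<longleftrightarrow> \<kappa> \<in> sq_gain X ` set ys \<and>
     (\<forall>\<kappa>'\<in>sq_gain X ` set ys. info_criterion PEN T X (splits X (sq_picks X \<kappa> ys))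
        \<le> info_criterion PEN T X (splits X (sq_picks X \<kappa>' ys)))"

text \<open>The last interval in the sorted order has the smallest gain; as a threshold it yields
  the longest list of picks, of which all others are prefixes.\<close>

definition greedy_search :: com where
  "greedy_search = evaluate (RCell ''G'' (ICell ''ord'' (ISub (IV ''n'') (Num 1)))) ;; backward"

definition improve_threshold :: com where
  "improve_threshold =
     Cond (RLt (RAdd (RV ''rss'') (RCell ''pen'' (IV ''m''))) (RV ''best''))
        (RSet ''best'' (RAdd (RV ''rss'') (RCell ''pen'' (IV ''m''))) ;; RSet ''bk'' (RV ''kap'')) Skip ;;
      ISet ''i'' (IAdd (IV ''i'') (Num 1))"

definition narrowest_body :: com where
  "narrowest_body = evaluate (RCell ''G'' (IV ''i'')) ;;
     improve_threshold"

text \<open>The threshold \<open>G[0]\<close> is evaluated twice, first to provide an initial best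
  value and again in the loop; hence \<open>Suc (length xs)\<close> in the cost.\<close>

definition narrowest_search :: com where
  "narrowest_search = evaluate (RCell ''G'' (Num 0)) ;;
     (RSet ''best'' (RAdd (RV ''rss'') (RCell ''pen'' (IV ''m''))) ;; RSet ''bk'' (RV ''kap'') ;; ISet ''i'' (Num 0)) ;;
     While (ILt (IV ''i'') (IV ''n'')) narrowest_body"

definition output_step :: com where
  "output_step =
     ISet ''t'' (IAdd (IV ''t'') (Num 1)) ;;
        Cond (ILe (Num 1) (ICell ''mk'' (IV ''t'')))
          (IAssign ''out'' (IV ''m'') (IV ''t'') ;; ISet ''m'' (IAdd (IV ''m'') (Num 1))) Skip"

text \<open>The segmentation is recomputed from the best threshold. Reading its marks from left to
  right lists the split points in increasing order without another sort.\<close>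

definition finish :: com where
  "finish = RSet ''kap'' (RV ''bk'') ;; forward ;; (ISet ''t'' (Num 0) ;; ISet ''m'' (Num 0)) ;;
     While (ILt (IAdd (IV ''t'') (Num 1)) (IV ''T''))
       output_step"

lemma order_facts:
  assumes "distinct os" "set os = {..<length xs}"
  shows "length os = length xs" "set (map ((!) xs) os) = set xs"
proof -
  show "length os = length xs" using assms by (metis card_lessThan distinct_card)
  show "set (map ((!) xs) os) = set xs"
    unfolding set_map assms(2) by (auto simp: set_conv_nth)
qed

lemma greedy_search_run:
  assumes s: "prepared X T xs os s" "reals s ''pen'' 0 = PEN {}"
    and os: "distinct os" "set os = {..<length xs}"
    and sorted: "sorted_wrt (\<lambda>I J. sq_gain X J \<le> sq_gain X I) (map ((!) xs) os)"
    and pen: "pen_update T PEN upd" and T: "0 < T"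
    and xs: "proper_intervals T xs" "xs \<noteq> []" and W: "int T + 2 < W" "2 * int (length xs) < W"
  shows "run W upd c greedy_search s (2 * T + scan_cost xs + length xs) (\<lambda>s'. prepared X T xs os s' \<and>
     reals s' ''pen'' 0 = PEN {} \<and> best_threshold PEN T X (map ((!) xs) os) (reals s' ''bk'' 0))"
proof -
  define ys where "ys = map ((!) xs) os"
  define \<kappa> where "\<kappa> = sq_gain X (last ys)"
  define ps where "ps = sq_picks X \<kappa> ys"
  have len: "length os = length xs" and set_ys: "set ys = set xs"
    unfolding ys_def by (fact order_facts[OF os])+
  have N: "0 < length xs" using xs(2) by simp
  have len_ys: "length ys = length xs" unfolding ys_def using len by simp
  have "ys \<noteq> []" using len_ys N by auto
  then have ne: "ys \<noteq> []" "last ys = xs ! (os ! (length xs - 1))"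
    using last_conv_nth[of ys] len_ys len N by (simp_all add: ys_def)
  have o: "os ! (length xs - 1) < length xs"
    using nth_mem[of "length xs - 1" os] N unfolding len os(2) by simp
  have interior: "fst I < best_split Min X I \<and> best_split Min X I < snd I" if "I \<in> set ys" for I
    using best_split_in[of I X] xs(1) that set_ys by (auto simp: proper_intervals_def)
  have kappa: "\<kappa> \<in> sq_gain X ` set ys" "\<And>I. I \<in> set ys \<Longrightarrow> \<kappa> \<le> sq_gain X I"
  proof -
    show "\<kappa> \<in> sq_gain X ` set ys" using ne(1) by (simp add: \<kappa>_def)
    fix I assume "I \<in> set ys"
    then obtain i where i: "i < length ys" "I = ys ! i" by (auto simp: in_set_conv_nth)
    have sorted': "sorted_wrt (\<lambda>I J. sq_gain X J \<le> sq_gain X I) ys" using sorted by (simp add: ys_def)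
    show "\<kappa> \<le> sq_gain X I"
    proof (cases "i = length ys - 1")
      case True
      then show ?thesis using i ne(1) by (simp add: \<kappa>_def last_conv_nth)
    next
      case False
      then have "i < length ys - 1" "length ys - 1 < length ys" using i by auto
      then show ?thesis
        using sorted_wrt_nth_less[OF sorted'] i(2) ne(1) by (simp add: \<kappa>_def last_conv_nth)
    qed
  qed
  have props: "distinct (map (best_split Min X) ps)" "length ps \<le> length ys" "set ps \<subseteq> set xs"
    using picks_props[of ys "best_split Min X" "sq_gain X" \<kappa> "\<lambda>_ _. True", OF interior]
      picks_subset[of "best_split Min X" "sq_gain X" \<kappa> ys] set_ys
    unfolding ps_def[symmetric] by auto
  have S: "splits X ps \<subseteq> {1..<T}" by (rule proper_splits[OF xs(1) props(3)])
  have W': "2 * int (length ps) < W" using props(2) len_ys W(2) by linarith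
  have "run W upd c greedy_search s ((2 * T + scan_cost xs) + length ps) (\<lambda>s'. prepared X T xs os s' \<and>
     reals s' ''pen'' 0 = PEN {} \<and> best_threshold PEN T X ys (reals s' ''bk'' 0))"
    unfolding greedy_search_def
  proof (rule run_Seq[OF evaluate_run[OF s(1) _ _ s(2) os pen T xs(1) W, of _ \<kappa>]], goal_cases)
    case 1
    have "ints s ''n'' 0 = int (length xs)" "ints s ''ord'' (length xs - 1) = int (os ! (length xs - 1))"
      using s(1) N by (simp_all add: prepared_def has_intervals_def)
    then show ?case using W o N by (simp add: nat_offset)
  next
    case 2
    have "ints s ''n'' 0 = int (length xs)" "ints s ''ord'' (length xs - 1) = int (os ! (length xs - 1))"
      "reals s ''G'' (os ! (length xs - 1)) = \<kappa>"
      using s(1) N o by (simp_all add: prepared_def has_intervals_def has_gains_def \<kappa>_def ne(2) sq_gain_def)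
    then show ?case using W o N by (simp add: nat_offset)
  next
    case (3 s1)
    have s1: "prepared X T xs os s1" "evaluated X PEN T \<kappa> ps s1" using 3(2) by (simp_all add: ps_def ys_def)
    have "has_sums X T s1" using s1(1) by (simp add: prepared_def)
    show ?case
    proof (rule run_conseq[OF backward_run[OF \<open>has_sums X T s1\<close> s1(2) props(1) S W' T W(1)]], goal_cases)
      case 1
      then show ?case by simp
    next
      case (2 s2)
      have "reals s1 ''pen'' 0 = PEN {}" using s1(2) by (auto simp: evaluated_def dest!: spec[of _ 0])
      then have s2: "prepared X T xs os s2" "reals s2 ''pen'' 0 = PEN {}"
        using prepared_unchanged[OF s1(1) 2(1)] 2(1)
        by (simp_all add: unchanged_reals backward_def backward_body_def improve_prefix_def)
      obtain j where j: "valid_prefix (sq_gain X) ps j" "reals s2 ''bk'' 0 = prefix_threshold (sq_gain X) \<kappa> ps j"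
        "\<And>i. valid_prefix (sq_gain X) ps i \<Longrightarrow>
          info_criterion PEN T X (splits X (take j ps)) \<le> info_criterion PEN T X (splits X (take i ps))"
        using 2(2) by blast
      note sorted' = sorted[folded ys_def]
      have lem: "\<And>j. valid_prefix (sq_gain X) ps j \<Longrightarrow> sq_picks X (prefix_threshold (sq_gain X) \<kappa> ps j) ys = take j ps"
        "\<And>j. valid_prefix (sq_gain X) ps j \<Longrightarrow> prefix_threshold (sq_gain X) \<kappa> ps j \<in> sq_gain X ` set ys"
        "\<And>\<kappa>'. \<kappa>' \<in> sq_gain X ` set ys \<Longrightarrow> \<exists>j. valid_prefix (sq_gain X) ps j \<and> sq_picks X \<kappa>' ys = take j ps"
        using picks_prefix_threshold[OF sorted' _ kappa(1) _ ps_def] picks_is_prefix[OF sorted' _ kappa(1) _ ps_def]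
          interior kappa(2) by blast+
      have "best_threshold PEN T X ys (reals s2 ''bk'' 0)"
        unfolding best_threshold_def j(2) lem(1)[OF j(1)]
      proof (intro conjI ballI)
        show "prefix_threshold (sq_gain X) \<kappa> ps j \<in> sq_gain X ` set ys" by (rule lem(2)[OF j(1)])
        fix \<kappa>' assume "\<kappa>' \<in> sq_gain X ` set ys"
        from lem(3)[OF this] obtain i where "valid_prefix (sq_gain X) ps i" "sq_picks X \<kappa>' ys = take i ps"
          by blast
        then show "info_criterion PEN T X (splits X (take j ps)) \<le> info_criterion PEN T X (splits X (sq_picks X \<kappa>' ys))"
          using j(3) by simp
      qed
      then show ?case using s2 by simp
    qed
  qed
  then show ?thesis
    unfolding ys_def by (rule run_conseq) (use props(2) len_ys in auto)
qed

lemma narrowest_search_run: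
  assumes s: "prepared X T xs os s" "reals s ''pen'' 0 = PEN {}"
    and os: "distinct os" "set os = {..<length xs}"
    and pen: "pen_update T PEN upd" and T: "0 < T"
    and xs: "proper_intervals T xs" "xs \<noteq> []" and W: "int T + 2 < W" "2 * int (length xs) < W"
  shows "run W upd c narrowest_search s (Suc (length xs) * Suc (2 * T + scan_cost xs)) (\<lambda>s'. prepared X T xs os s' \<and>
     reals s' ''pen'' 0 = PEN {} \<and> best_threshold PEN T X (map ((!) xs) os) (reals s' ''bk'' 0))"
proof -
  define ys where "ys = map ((!) xs) os"
  let ?F = "\<lambda>\<kappa>. info_criterion PEN T X (splits X (sq_picks X \<kappa> ys))"
  have set_ys: "set ys = set xs" unfolding ys_def by (fact order_facts[OF os])
  have N: "0 < length xs" using xs(2) by simp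
  have interior: "fst I < best_split Min X I \<and> best_split Min X I < snd I" if "I \<in> set ys" for I
    using best_split_in[of I X] xs(1) that set_ys by (auto simp: proper_intervals_def)
  have len: "length (sq_picks X \<kappa> ys) \<le> length xs" for \<kappa>
    using picks_props[of ys "best_split Min X" "sq_gain X" \<kappa> "\<lambda>_ _. True", OF interior] order_facts(1)[OF os]
    by (simp add: ys_def)
  have S: "splits X (sq_picks X \<kappa> ys) \<subseteq> {1..<T}" for \<kappa>
    using picks_subset[of "best_split Min X" "sq_gain X" \<kappa> ys] set_ys by (intro proper_splits[OF xs(1)]) simp
  have ev: "ints s' ''m'' 0 = int (length (sq_picks X \<kappa> ys)) \<and> reals s' ''rss'' 0 + reals s' ''pen'' (length (sq_picks X \<kappa> ys)) = ?F \<kappa> \<and>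
      reals s' ''kap'' 0 = \<kappa> \<and> reals s' ''pen'' 0 = PEN {}" if "evaluated X PEN T \<kappa> (sq_picks X \<kappa> ys) s'" for \<kappa> s'
    using evaluated_info[OF that S T] that by (auto simp: evaluated_def dest!: spec[of _ 0])
  note eval = evaluate_run[OF _ _ _ _ os pen T xs(1) W, folded ys_def]
  define I where "I k s1 \<longleftrightarrow> ints s1 ''i'' 0 = int k \<and> prepared X T xs os s1 \<and> reals s1 ''pen'' 0 = PEN {} \<and>
     reals s1 ''bk'' 0 \<in> sq_gain X ` set ys \<and> reals s1 ''best'' 0 = ?F (reals s1 ''bk'' 0) \<and>
     (\<forall>u<k. reals s1 ''best'' 0 \<le> ?F (sq_gain X (xs ! u)))" for k and s1 :: state
  have G: "reals s1 ''G'' i = sq_gain X (xs ! i)" "ints s1 ''n'' 0 = int (length xs)"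
    if "prepared X T xs os s1" "i < length xs" for s1 i
    using that by (simp_all add: prepared_def has_intervals_def has_gains_def sq_gain_def)
  have "run W upd c narrowest_search s ((2 * T + scan_cost xs) + (\<Sum>i<length xs. Suc (2 * T + scan_cost xs)))
    (\<lambda>s'. prepared X T xs os s' \<and> reals s' ''pen'' 0 = PEN {} \<and> best_threshold PEN T X ys (reals s' ''bk'' 0))"
    unfolding narrowest_search_def
  proof (rule run_Seq[OF eval[OF s(1) _ _ s(2), where \<kappa> = "sq_gain X (xs ! 0)"]], goal_cases)
    case 1
    then show ?case using W by simp
  next
    case 2
    then show ?case using G[OF s(1) N] by simp
  next
    case (3 s1)
    note ev1 = ev[OF conjunct2[OF 3(2)]]
    show ?case
    proof (rule run_init[where Q = "I 0"], goal_cases)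
      case 1
      have "prepared X T xs os (set_int ''i'' 0 0 (set_real ''bk'' 0 b (set_real ''best'' 0 v s1)))" for b v
        using 3(2) by (simp add: prepared_def has_sums_def has_intervals_def has_gains_def state_simps)
      then show ?case
        using ev1 W len[of "sq_gain X (xs ! 0)"] N by (simp add: state_simps I_def set_ys)
    next
      case (2 s2)
      show ?case
      proof (rule run_conseq[OF run_for[where n = "length xs" and f = "\<lambda>_. 2 * T + scan_cost xs" and I = I]], goal_cases)
        case 1
        then show ?case using 2(2) .
      next
        case (2 i s3)
        have s3: "prepared X T xs os s3" "reals s3 ''pen'' 0 = PEN {}" "ints s3 ''i'' 0 = int i"
          using 2(2) by (simp_all add: I_def)
        have "run W upd c narrowest_body s3 ((2 * T + scan_cost xs) + 0) (I (Suc i))"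
          unfolding narrowest_body_def
        proof (rule run_Seq[OF eval[OF s3(1) _ _ s3(2), where \<kappa> = "sq_gain X (xs ! i)"]], goal_cases)
          case 1
          then show ?case using W s3 \<open>i < length xs\<close> by simp
        next
          case 2
          then show ?case using W s3 \<open>i < length xs\<close> G[OF s3(1)] by simp
        next
          case (3 s4)
          note ev4 = ev[OF conjunct2[OF 3(2)]]
          have s4: "ints s4 ''i'' 0 = int i" "reals s4 ''bk'' 0 = reals s3 ''bk'' 0" "reals s4 ''best'' 0 = reals s3 ''best'' 0"
            using 3(1) s3(3)
            by (simp_all add: unchanged_ints unchanged_reals evaluate_def forward_defs scan_def link_mark_def)
          have pr: "prepared X T xs os (set_int ''i'' 0 z s4)"
             "prepared X T xs os (set_int ''i'' 0 z (set_real ''bk'' 0 b (set_real ''best'' 0 v s4)))" for b v z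
            using 3(2) by (simp_all add: prepared_def has_sums_def has_intervals_def has_gains_def state_simps)
          have old: "reals s3 ''bk'' 0 \<in> sq_gain X ` set ys" "reals s3 ''best'' 0 = ?F (reals s3 ''bk'' 0)"
            "\<And>u. u < i \<Longrightarrow> reals s3 ''best'' 0 \<le> ?F (sq_gain X (xs ! u))"
            using \<open>I i s3\<close> unfolding I_def by blast+
          have mem: "sq_gain X (xs ! i) \<in> sq_gain X ` set ys" using \<open>i < length xs\<close> by (simp add: set_ys)
          show ?case
          proof (rule run_wp, cases "?F (sq_gain X (xs ! i)) < reals s3 ''best'' 0")
            case True
            then have "I (Suc i) (set_int ''i'' 0 (int i + 1) (set_real ''bk'' 0 (sq_gain X (xs ! i)) (set_real ''best'' 0 (?F (sq_gain X (xs ! i))) s4)))"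
              using pr s4 ev4 old(3) mem by (force simp: I_def state_simps less_Suc_eq)
            then show "wp W upd improve_threshold (I (Suc i)) s4"
              using True s4 ev4 W len[of "sq_gain X (xs ! i)"] \<open>i < length xs\<close> by (simp add: improve_threshold_def state_simps)
          next
            case False
            then have "I (Suc i) (set_int ''i'' 0 (int i + 1) s4)"
              using pr s4 ev4 old by (auto simp: I_def state_simps less_Suc_eq)
            then show "wp W upd improve_threshold (I (Suc i)) s4"
              using False s4 ev4 W len[of "sq_gain X (xs ! i)"] \<open>i < length xs\<close> by (simp add: improve_threshold_def state_simps)
          qed
        qed
        then show ?case using s3 G[OF s3(1) 2(1)] W 2(1) by simp
      next
        case (3 s3)
        then show ?case using G[of s3 0] N W by (simp add: I_def)
      next
        case (5 s3)
        then have "reals s3 ''best'' 0 = ?F (reals s3 ''bk'' 0)"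
          "\<forall>u<length xs. reals s3 ''best'' 0 \<le> ?F (sq_gain X (xs ! u))"
          unfolding I_def by blast+
        then have "\<forall>u<length xs. ?F (reals s3 ''bk'' 0) \<le> ?F (sq_gain X (xs ! u))" by simp
        then have "?F (reals s3 ''bk'' 0) \<le> ?F (sq_gain X I)" if "I \<in> set xs" for I
          using that unfolding in_set_conv_nth by blast
        moreover have "reals s3 ''bk'' 0 \<in> sq_gain X ` set ys"
          using 5(2) unfolding I_def by blast
        ultimately have "best_threshold PEN T X ys (reals s3 ''bk'' 0)"
          unfolding best_threshold_def set_ys by blast
        then show ?case using 5(2) by (simp add: I_def)
      qed simp
    qed
  qed
  then show ?thesis
    unfolding ys_def by (rule run_conseq) auto
qed

section \<open>Output of the split points\<close>

lemma sorted_list_snoc: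
  fixes x :: nat
  assumes "finite A" "\<And>y. y \<in> A \<Longrightarrow> y < x"
  shows "sorted_list_of_set (insert x A) = sorted_list_of_set A @ [x]"
proof (rule sorted_distinct_set_unique)
  show "set (sorted_list_of_set (insert x A)) = set (sorted_list_of_set A @ [x])"
    using assms(1) by (subst set_sorted_list_of_set) auto
qed (use assms in \<open>auto simp: sorted_append less_imp_le simp del: sorted_list_of_set_insert_remove\<close>)

lemma finish_run:
  assumes s: "prepared X T xs os s" "reals s ''pen'' 0 = PEN {}" "reals s ''bk'' 0 = \<kappa>"
    and os: "distinct os" "set os = {..<length xs}"
    and pen: "pen_update T PEN upd" and T: "0 < T"
    and xs: "proper_intervals T xs" and W: "int T + 2 < W" "2 * int (length xs) < W"
  shows "run W upd c finish s (2 * T + scan_cost xs) (\<lambda>s'. outputs s' (splits X (sq_picks X \<kappa> (map ((!) xs) os))))"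
proof -
  define S where "S = splits X (sq_picks X \<kappa> (map ((!) xs) os))"
  have S: "S \<subseteq> {1..<T}"
    unfolding S_def using picks_subset order_facts(2)[OF os] by (intro proper_splits[OF xs(1)]) blast
  have fin: "finite S" using S by (rule finite_subset) simp
  have "run W upd c finish s ((T + scan_cost xs) + (T - 1)) (\<lambda>s'. outputs s' S)"
    unfolding finish_def
  proof (rule run_init[where Q = "\<lambda>s'. reals s' ''kap'' 0 = \<kappa>"], goal_cases)
    case 1
    then show ?case using s W by (simp add: state_simps)
  next
    case (2 s1)
    have s1: "prepared X T xs os s1" "reals s1 ''pen'' 0 = PEN {}"
      using prepared_unchanged[OF s(1) 2(1)] 2(1) s by (simp_all add: unchanged_reals)
    show ?case
    proof (rule run_Seq[OF forward_run[OF s1(1) 2(2) s1(2) os pen xs W]], goal_cases)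
      case (1 s2)
      have s2: "ints s2 ''T'' 0 = int T" "has_marks S T s2"
        using prepared_unchanged[OF s1(1) 1(1)] 1(2)
        by (simp_all add: forward_defs prepared_def selected_def S_def)
      show ?case
      proof (rule run_init[where Q = "\<lambda>s'. ints s' ''t'' 0 = 0 \<and> ints s' ''m'' 0 = 0"], goal_cases)
        case 1
        then show ?case using W by (simp add: state_simps)
      next
        case (2 s3)
        have s3: "ints s3 ''T'' 0 = int T" "has_marks S T s3"
          using 2(1) s2 by (simp_all add: unchanged_ints has_marks_def)
        let ?L = "\<lambda>i. sorted_list_of_set (S \<inter> {..i})"
        define I where "I i s4 \<longleftrightarrow> ints s4 ''t'' 0 = int i \<and> ints s4 ''m'' 0 = int (length (?L i)) \<and>
           (\<forall>k<length (?L i). ints s4 ''out'' k = int (?L i ! k))" for i and s4 :: state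
        show ?case
        proof (rule run_conseq[OF run_for[where n = "T - 1" and f = "\<lambda>_. 0" and I = I]], goal_cases)
          case 1
          have "S \<inter> {..0} = {}" using S by auto
          then show ?case using 2(2) by (simp add: I_def)
        next
          case (2 i s4)
          have s4: "ints s4 ''T'' 0 = int T" "ints s4 ''mk'' = ints s3 ''mk''"
            using 2(3) s3 by (simp_all add: unchanged_ints output_step_def)
          have mk: "ints s3 ''mk'' (Suc i) = (if Suc i \<in> S then 1 else 0)"
            using s3(2) 2(1) by (simp add: has_marks_def)
          have len: "length (?L i) \<le> T"
          proof -
            have "card (S \<inter> {..i}) \<le> card {1..<T}" using S by (intro card_mono) auto
            then show ?thesis by simp
          qed
          have L: "?L (Suc i) = (if Suc i \<in> S then ?L i @ [Suc i] else ?L i)"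
          proof (cases "Suc i \<in> S")
            case True
            then have "S \<inter> {..Suc i} = insert (Suc i) (S \<inter> {..i})" by (auto simp: le_Suc_eq)
            then show ?thesis using True fin sorted_list_snoc[of "S \<inter> {..i}" "Suc i"] by simp
          next
            case False
            then have "S \<inter> {..Suc i} = S \<inter> {..i}" by (auto simp: le_Suc_eq)
            then show ?thesis using False by simp
          qed
          have nat: "nat (1 + int i) = Suc i" "nat (int i + 1) = Suc i" by simp_all
          have iT: "i + 1 < T" using 2(1) by simp
          note I = \<open>I i s4\<close>[unfolded I_def]
          have wp: "wp W upd output_step (I (Suc i)) s4"
            using I s4 mk nat iT W len
            by (auto simp: output_step_def state_simps I_def L nth_append less_Suc_eq simp del: length_sorted_list_of_set)
          show ?case using run_wp[OF wp] I s4 iT W by simp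
        next
          case (3 s4)
          have "ints s4 ''T'' 0 = int T" using 3(2) s3 by (simp add: unchanged_ints output_step_def)
          then show ?case using 3 T W by (simp add: I_def of_nat_diff)
        next
          case (5 s4)
          have "S \<inter> {..T - 1} = S" using S by fastforce
          then show ?case using 5(2) by (simp add: I_def outputs_def)
        qed simp
      qed
    qed
  qed
  then show ?thesis unfolding S_def by (rule run_conseq) auto
qed

section \<open>Generating the seeded intervals\<close>

definition num_layers :: "real \<Rightarrow> nat \<Rightarrow> nat" where
  "num_layers a T = nat \<lceil>log (1 / a) (real T)\<rceil>"

text \<open>Here \<open>i\<close> counts from 0, whereas it counts from 1 in
  \<open>seed_layer\<close>.\<close>

definition seed_interval :: "real \<Rightarrow> nat \<Rightarrow> nat \<Rightarrow> nat \<Rightarrow> interval" where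
  "seed_interval a T k i =
     (nat \<lfloor>real i * seed_shift a T k\<rfloor>, nat \<lceil>real i * seed_shift a T k + seed_len a T k\<rceil>)"

definition layer_part :: "real \<Rightarrow> nat \<Rightarrow> nat \<Rightarrow> nat \<Rightarrow> nat \<Rightarrow> interval list" where
  "layer_part a m0 T k i = filter (\<lambda>I. m0 \<le> snd I - fst I) (map (seed_interval a T k) [0..<i])"

definition layers_upto :: "real \<Rightarrow> nat \<Rightarrow> nat \<Rightarrow> nat \<Rightarrow> interval list" where
  "layers_upto a m0 T k = concat (map (\<lambda>j. layer_part a m0 T j (seed_num a j)) [1..<Suc k])"

definition seeded_list :: "real \<Rightarrow> nat \<Rightarrow> nat \<Rightarrow> interval list" where
  "seeded_list a m0 T = layers_upto a m0 T (num_layers a T)"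

lemma set_seeded_list: "set (seeded_list a m0 T) = seeded_intervals a m0 T"
proof -
  have "seed_interval a T k ` {0..<seed_num a k} = seed_layer a T k" for k
  proof -
    have "seed_layer a T k = (\<lambda>i. seed_interval a T k (i - 1)) ` {1..seed_num a k}"
      unfolding seed_layer_def seed_interval_def by (intro image_cong) auto
    also have "\<dots> = seed_interval a T k ` ((\<lambda>i. i - 1) ` {1..seed_num a k})"
      by (simp add: image_image)
    also have "(\<lambda>i. i - 1) ` {1..seed_num a k} = {0..<seed_num a k}"
    proof -
      have "i \<in> (\<lambda>i. i - 1) ` {1..seed_num a k}" if "i < seed_num a k" for i
        using that by (intro image_eqI[of _ _ "Suc i"]) auto
      then show ?thesis by auto
    qed
    finally show ?thesis by simp
  qed
  moreover have "{1..<Suc K} = {1..K}" for K by auto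
  ultimately show ?thesis
    by (auto simp: seeded_list_def layers_upto_def layer_part_def seeded_intervals_def num_layers_def
        simp del: upt_Suc) 
qed

section \<open>Number and total length of the seeded intervals\<close>

context
  fixes a :: real and T :: nat
  assumes a: "1 / 2 \<le> a" "a < 1" and T: "2 \<le> T"
begin

text \<open>Replaces the logarithm by a test the machine can perform: the loop over the layers
  continues while \<open>p = (1/a)^k\<close> is below \<open>T\<close>.\<close>

lemma less_layers: "k < num_layers a T \<longleftrightarrow> (1 / a) ^ k < real T"
proof -
  have "k < num_layers a T \<longleftrightarrow> real k < log (1 / a) (real T)"
    unfolding num_layers_def by linarith
  also have "\<dots> \<longleftrightarrow> (1 / a) powr real k < real T"
    using a T by (simp add: less_log_iff)
  also have "(1 / a) powr real k = (1 / a) ^ k"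
    using a by (simp add: powr_realpow)
  finally show ?thesis .
qed

lemma layer_pos: "1 \<le> num_layers a T"
  using less_layers[of 0] T by simp

context
  fixes k :: nat
  assumes k: "k < num_layers a T"
begin

lemma scale_ge_1: "1 \<le> (1 / a) ^ k"
  using a by (intro one_le_power) (simp add: field_simps)

lemma scale_less: "(1 / a) ^ k < real T"
  using k less_layers by simp

lemma ceil_scale: "1 \<le> nat \<lceil>(1 / a) ^ k\<rceil>" "nat \<lceil>(1 / a) ^ k\<rceil> \<le> T" "real (nat \<lceil>(1 / a) ^ k\<rceil>) < (1 / a) ^ k + 1"
  using scale_ge_1 scale_less by linarith+

text \<open>With \<open>x = (1/a)^k \<ge> 1\<close> the number of intervals is less than
  \<open>2 * (x + 1) - 1 = 2 * x + 1\<close>, which is at most \<open>3 * x\<close>.\<close>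

lemma seed_num_bounds:
  "1 \<le> seed_num a (Suc k)" "seed_num a (Suc k) \<le> 2 * T" "real (seed_num a (Suc k)) \<le> 3 * (1 / a) ^ k"
  using ceil_scale scale_ge_1 by (auto simp: seed_num_def of_nat_diff)

text \<open>Only the first layer consists of a single interval. So the program can recognise the
  exceptional shift 0, where the division would be by zero, from \<open>nk\<close> alone.\<close>

lemma seed_num_eq_1: "seed_num a (Suc k) = 1 \<longleftrightarrow> k = 0"
proof (cases k)
  case (Suc j)
  have "1 < (1 / a) ^ k" using a Suc by (intro one_less_power) (auto simp: field_simps)
  then have "2 \<le> nat \<lceil>(1 / a) ^ k\<rceil>" by linarith
  then show ?thesis using Suc by (simp add: seed_num_def)
qed (simp add: seed_num_def)

lemma scale_len: "(1 / a) ^ k * seed_len a T (Suc k) = real T"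
  using a by (simp add: seed_len_def power_one_over)

lemma seed_len_bounds: "1 < seed_len a T (Suc k)" "seed_len a T (Suc k) \<le> real T"
proof -
  have x: "(1 / a) ^ k > 0" using scale_ge_1 by linarith
  have "seed_len a T (Suc k) = real T / (1 / a) ^ k"
    by (simp add: seed_len_def power_one_over)
  then show "1 < seed_len a T (Suc k)"
    using scale_less x by simp
  have "a ^ k \<le> 1" using a by (intro power_le_one) auto
  then show "seed_len a T (Suc k) \<le> real T"
    using a by (simp add: seed_len_def mult_left_le)
qed

lemma seed_shift_nonneg: "0 \<le> seed_shift a T (Suc k)"
  using seed_len_bounds seed_num_bounds(1) by (auto simp: seed_shift_def)

lemma seed_end: 
  assumes "i < seed_num a (Suc k)"
  shows "real i * seed_shift a T (Suc k) + seed_len a T (Suc k) \<le> real T"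
proof (cases "k = 0")
  case True
  then show ?thesis using assms seed_num_eq_1 seed_len_bounds by (simp add: seed_shift_def)
next
  case False
  then have n: "1 < seed_num a (Suc k)" using seed_num_eq_1 seed_num_bounds(1) by linarith
  have "real i * seed_shift a T (Suc k) \<le> (real (seed_num a (Suc k)) - 1) * seed_shift a T (Suc k)"
    using assms seed_shift_nonneg by (intro mult_right_mono) linarith+
  also have "\<dots> = real T - seed_len a T (Suc k)"
    using n False by (simp add: seed_shift_def)
  finally show ?thesis by simp
qed

lemma seed_interval_bounds:
  assumes "i < seed_num a (Suc k)"
  shows "snd (seed_interval a T (Suc k) i) \<le> T"
    "real (Suc (snd (seed_interval a T (Suc k) i) - fst (seed_interval a T (Suc k) i))) \<le> 4 * seed_len a T (Suc k)"
proof -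
  define x l where "x = real i * seed_shift a T (Suc k)" and "l = seed_len a T (Suc k)"
  have x: "0 \<le> x" "x + l \<le> real T" "1 < l"
    using seed_shift_nonneg seed_end[OF assms] seed_len_bounds by (simp_all add: x_def l_def)
  show "snd (seed_interval a T (Suc k) i) \<le> T"
    using x by (simp add: seed_interval_def x_def[symmetric] l_def[symmetric])
  \<comment> \<open>Rounding both ends outward adds less than 2 to the length \<open>l\<close>, and
    \<open>Suc\<close> adds 1; then \<open>l + 3 \<le> 4 * l\<close> because
    \<open>l > 1\<close>.\<close>
  have "real (Suc (nat \<lceil>x + l\<rceil> - nat \<lfloor>x\<rfloor>)) \<le> l + 3" using x by linarith
  then show "real (Suc (snd (seed_interval a T (Suc k) i) - fst (seed_interval a T (Suc k) i))) \<le> 4 * seed_len a T (Suc k)"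
    using x by (simp add: seed_interval_def x_def[symmetric] l_def[symmetric])
qed

end

lemma proper_layers:
  assumes "2 \<le> m0" "k \<le> num_layers a T"
  shows "proper_intervals T (layers_upto a m0 T k)"
  unfolding proper_intervals_def
proof
  fix I assume "I \<in> set (layers_upto a m0 T k)"
  then obtain j where j: "1 \<le> j" "j \<le> k" "I \<in> set (layer_part a m0 T j (seed_num a j))"
    by (auto simp: layers_upto_def simp del: upt_Suc)
  then obtain i where i: "i < seed_num a j" "I = seed_interval a T j i" "m0 \<le> snd I - fst I"
    by (auto simp: layer_part_def)
  have "snd I \<le> T"
    using seed_interval_bounds(1)[of "j - 1" i] j i assms by simp
  then show "fst I + 2 \<le> snd I \<and> snd I \<le> T" using i(3) assms(1) by simp
qed

lemma layers_Suc: "layers_upto a m0 T (Suc k) = layers_upto a m0 T k @ layer_part a m0 T (Suc k) (seed_num a (Suc k))"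
  by (simp add: layers_upto_def)

lemma length_layer_part: "length (layer_part a m0 T j i) \<le> i"
  unfolding layer_part_def by (rule order_trans[OF length_filter_le]) simp

text \<open>The count before intervals shorter than \<open>m0\<close> are dropped; it bounds the
  list for every \<open>m0\<close>.\<close>

definition raw_count :: "nat \<Rightarrow> nat" where
  "raw_count k = (\<Sum>j<k. seed_num a (Suc j))"

lemma length_layers: "length (layers_upto a m0 T k) \<le> raw_count k"
proof (induction k)
  case (Suc k)
  then show ?case using length_layer_part[of m0 "Suc k" "seed_num a (Suc k)"]
    by (simp add: layers_Suc raw_count_def)
qed (simp add: layers_upto_def)

text \<open>A geometric sum dominated by its last term: with \<open>x = 1 / a\<close> and
  \<open>K\<close> layers, \<open>x^(K-1) < T\<close> gives \<open>x^K \<le> T * x\<close>, and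
  \<open>x / (x - 1) = 1 / (1 - a)\<close>.\<close>

lemma raw_count_bound: "real (raw_count (num_layers a T)) \<le> 3 / (1 - a) * real T"
proof -
  let ?K = "num_layers a T" and ?x = "1 / a"
  have x: "1 < ?x" using a by (simp add: field_simps)
  have "?x ^ ?K = ?x ^ (?K - 1) * ?x"
    using layer_pos by (metis One_nat_def Suc_le_eq Suc_pred mult.commute power_Suc)
  also have "\<dots> \<le> real T * ?x"
    using less_layers[of "?K - 1"] layer_pos a by (intro mult_right_mono) auto
  finally have top: "?x ^ ?K \<le> real T * ?x" .
  have "real (raw_count ?K) \<le> (\<Sum>j<?K. 3 * ?x ^ j)"
    unfolding raw_count_def of_nat_sum by (intro sum_mono) (use seed_num_bounds in auto)
  also have "\<dots> = 3 * ((?x ^ ?K - 1) / (?x - 1))"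
    using x unfolding sum_distrib_left[symmetric] by (subst geometric_sum) auto
  also have "\<dots> \<le> 3 * (real T * ?x / (?x - 1))"
    using top x by (intro mult_left_mono divide_right_mono) auto
  also have "\<dots> = 3 / (1 - a) * real T"
    using a by (simp add: field_simps)
  finally show ?thesis .
qed

lemma scan_cost_append: "scan_cost (xs @ ys) = scan_cost xs + scan_cost ys"
proof -
  have "scan_cost zs = (\<Sum>I\<leftarrow>zs. Suc (snd I - fst I))" for zs
    by (simp add: scan_cost_def sum_list_sum_nth atLeast0LessThan)
  then show ?thesis by simp
qed

text \<open>A layer has at most \<open>3 * (1/a)^k\<close> intervals of cost at most four times
  \<open>seed_len\<close>; by \<open>scale_len\<close> the product is \<open>12 * T\<close>,
  whatever the layer.\<close>

lemma scan_cost_layers: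
  assumes "k \<le> num_layers a T"
  shows "scan_cost (layers_upto a m0 T k) \<le> k * (12 * T)"
  using assms
proof (induction k)
  case 0
  then show ?case by (simp add: layers_upto_def scan_cost_def)
next
  case (Suc k)
  let ?ys = "layer_part a m0 T (Suc k) (seed_num a (Suc k))" and ?l = "seed_len a T (Suc k)"
  have k: "k < num_layers a T" using Suc by simp
  have "real (Suc (snd (?ys ! i) - fst (?ys ! i))) \<le> 4 * ?l" if "i < length ?ys" for i
    using nth_mem[OF that] seed_interval_bounds(2)[OF k] by (auto simp: layer_part_def)
  then have "real (scan_cost ?ys) \<le> real (length ?ys) * (4 * ?l)"
    unfolding scan_cost_def of_nat_sum using sum_bounded_above[of "{..<length ?ys}" _ "4 * ?l"] by simp
  also have "\<dots> \<le> (3 * (1 / a) ^ k) * (4 * ?l)"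
  proof (rule mult_right_mono)
    show "real (length ?ys) \<le> 3 * (1 / a) ^ k"
      using length_layer_part[of m0 "Suc k" "seed_num a (Suc k)"] seed_num_bounds(3)[OF k] by linarith
    show "0 \<le> 4 * ?l" using seed_len_bounds[OF k] by linarith
  qed
  also have "\<dots> = 12 * real T" using scale_len[of k] k by simp
  finally have "scan_cost ?ys \<le> 12 * T" by linarith
  then show ?case using Suc by (simp add: layers_Suc scan_cost_append)
qed

text \<open>The ceiling costs an additive 1, which is at most \<open>2 * ln T\<close> because
  \<open>T \<ge> 2\<close>.\<close>

lemma num_layers_log: "real (num_layers a T) \<le> (1 / ln (1 / a) + 2) * ln (real T)"
proof -
  have "ln 2 \<le> ln (real T)" using T by simp
  then have lnT: "1 / 2 \<le> ln (real T)" using ln2_ge_two_thirds by linarith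
  have "0 \<le> log (1 / a) (real T)" using a T by (simp add: zero_le_log_cancel_iff)
  then have "real (num_layers a T) \<le> log (1 / a) (real T) + 1"
    unfolding num_layers_def by linarith
  then show ?thesis using lnT by (simp add: log_def algebra_simps)
qed

end

section \<open>Machine code for the seeded intervals\<close>

definition ceil_loop :: com where
  "ceil_loop = While (RLt (OfInt (IV ''cl'')) (RV ''p'')) (ISet ''cl'' (IAdd (IV ''cl'') (Num 1)))"

text \<open>The machine cannot round; since the end points of a layer increase, their roundings \<open>fl\<close> and \<open>ce\<close>
  are found by counting up, with at most \<open>2T\<close> increments per layer.\<close>

definition emit_body :: com where
  "emit_body =
     Cond (RLe (OfInt (IAdd (IV ''fl'') (Num 1))) (RMul (OfInt (IV ''i'')) (RV ''sh'')))
       (ISet ''fl'' (IAdd (IV ''fl'') (Num 1)))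
       (Cond (RLt (OfInt (IV ''ce'')) (RAdd (RMul (OfInt (IV ''i'')) (RV ''sh'')) (RV ''q'')))
         (ISet ''ce'' (IAdd (IV ''ce'') (Num 1)))
         (Cond (ILe (IV ''m0'') (ISub (IV ''ce'') (IV ''fl'')))
            (IAssign ''L'' (IV ''n'') (IV ''fl'') ;; IAssign ''R'' (IV ''n'') (IV ''ce'') ;;
             ISet ''n'' (IAdd (IV ''n'') (Num 1)))
            Skip ;;
          ISet ''i'' (IAdd (IV ''i'') (Num 1))))"

definition generate_layer :: com where
  "generate_layer =
     ISet ''cl'' (Num 0) ;; ceil_loop ;;
     (ISet ''nk'' (ISub (IMul (Num 2) (IV ''cl'')) (Num 1)) ;;
      Cond (ILe (IV ''nk'') (Num 1)) (RSet ''sh'' (OfInt (Num 0)))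
        (RSet ''sh'' (RDiv (RSub (OfInt (IV ''T'')) (RV ''q'')) (OfInt (ISub (IV ''nk'') (Num 1))))) ;;
      ISet ''i'' (Num 0) ;; ISet ''fl'' (Num 0) ;; ISet ''ce'' (Num 0)) ;;
     While (ILt (IV ''i'') (IV ''nk'')) emit_body ;;
     (RSet ''p'' (RDiv (RV ''p'') (RV ''a'')) ;; RSet ''q'' (RMul (RV ''q'') (RV ''a'')))"

definition generate :: com where
  "generate =
     (RSet ''p'' (OfInt (Num 1)) ;; RSet ''q'' (OfInt (IV ''T'')) ;; ISet ''n'' (Num 0)) ;;
     While (RLt (RV ''p'') (OfInt (IV ''T''))) generate_layer"

lemma ceil_loop_run:
  assumes "ints s ''cl'' 0 = 0" "reals s ''p'' 0 = x" and x: "0 < x" and W: "int (nat \<lceil>x\<rceil>) < W"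
  shows "run W upd c ceil_loop s (nat \<lceil>x\<rceil>) (\<lambda>s'. ints s' ''cl'' 0 = int (nat \<lceil>x\<rceil>))"
proof -
  define C where "C = nat \<lceil>x\<rceil>"
  have C: "int C < W" "z < C \<longleftrightarrow> real z < x" for z
    using W x by (simp_all add: C_def) linarith+
  have "run W upd c ceil_loop s C (\<lambda>s'. ints s' ''cl'' 0 = int C)"
    unfolding ceil_loop_def
  proof (rule run_conseq[OF run_While[where \<Phi> = "\<lambda>z. C - z" and f = "\<lambda>_. 0" and g = 0 and
        I = "\<lambda>z s1. ints s1 ''cl'' 0 = int z \<and> z \<le> C" and Q = "\<lambda>s'. ints s' ''cl'' 0 = int C"]], goal_cases)
    case 1
    then show ?case using assms by simp
  next
    case (2 z s1)
    then show ?case using C(1) by simp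
  next
    case (3 z s1)
    have "reals s1 ''p'' 0 = x" using 3(2) assms by (simp add: unchanged_reals)
    then have z: "z < C" using 3 C(2) by simp
    show ?case
      using 3(1) C(1) z by (intro run_wp) (auto simp: state_simps intro!: exI[of _ "Suc z"])
  next
    case (4 z s1)
    have "reals s1 ''p'' 0 = x" using 4(2) assms by (simp add: unchanged_reals)
    then have "\<not> z < C" using 4 C(2) by simp
    then show ?case using 4 by simp
  qed auto
  then show ?thesis by (simp only: C_def)
qed

text \<open>Every iteration increments exactly one of \<open>i\<close>, \<open>fl\<close>,
  \<open>ce\<close>, bounded by \<open>2 * T\<close>, \<open>T\<close> and \<open>T\<close>; this
  gives \<open>4 * T\<close>. The invariant says that neither rounding overshoots, so both are exact
  when both tests fail; it survives the step to the next \<open>i\<close> because the shift is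
  nonnegative.\<close>

lemma emit_run:
  assumes a: "1 / 2 \<le> a" "a < 1" and T: "2 \<le> T" and k: "k < num_layers a T"
    and s: "ints s ''i'' 0 = 0" "ints s ''fl'' 0 = 0" "ints s ''ce'' 0 = 0" "ints s ''nk'' 0 = int (seed_num a (Suc k))"
      "ints s ''m0'' 0 = int m0" "reals s ''sh'' 0 = seed_shift a T (Suc k)" "reals s ''q'' 0 = seed_len a T (Suc k)"
      "has_intervals xs s"
    and W: "int T + 2 < W" "int (length xs + seed_num a (Suc k)) < W" "int m0 \<le> W"
  shows "run W upd c (While (ILt (IV ''i'') (IV ''nk'')) emit_body) s (4 * T)
     (has_intervals (xs @ layer_part a m0 T (Suc k) (seed_num a (Suc k))))"
proof -
  let ?n = "seed_num a (Suc k)" and ?l = "seed_len a T (Suc k)" and ?s = "seed_shift a T (Suc k)"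
  note bnd = seed_num_bounds[OF a T k] seed_len_bounds[OF a T k] seed_shift_nonneg[OF a T k]
  define I where "I = (\<lambda>(i, f, e) s1. ints s1 ''i'' 0 = int i \<and> ints s1 ''fl'' 0 = int f \<and> ints s1 ''ce'' 0 = int e \<and>
     i \<le> ?n \<and> f \<le> T \<and> e \<le> T \<and> real f \<le> real i * ?s \<and> real e < real i * ?s + ?l + 1 \<and>
     has_intervals (xs @ layer_part a m0 T (Suc k) i) s1)"
  show ?thesis
  proof (rule run_conseq[OF run_While[where \<Phi> = "\<lambda>(i, f, e). (?n - i) + (T - f) + (T - e)" and f = "\<lambda>_. 0" and
        g = "(0, 0, 0)" and I = I and
        Q = "has_intervals (xs @ layer_part a m0 T (Suc k) ?n)"]], goal_cases)
    case 1
    then show ?case using s bnd by (simp add: I_def layer_part_def)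
  next
    case (2 g s1)
    then show ?case using s W by (auto simp: I_def unchanged_ints emit_body_def split: prod.splits)
  next
    case (3 g s1)
    obtain i f e where g: "g = (i, f, e)" by (cases g)
    have s1: "ints s1 ''nk'' 0 = int ?n" "ints s1 ''m0'' 0 = int m0" "reals s1 ''sh'' 0 = ?s" "reals s1 ''q'' 0 = ?l"
      using 3(2) s by (simp_all add: unchanged_ints unchanged_reals emit_body_def)
    have I: "ints s1 ''i'' 0 = int i" "ints s1 ''fl'' 0 = int f" "ints s1 ''ce'' 0 = int e" "f \<le> T" "e \<le> T"
      "real f \<le> real i * ?s" "real e < real i * ?s + ?l + 1"
      "has_intervals (xs @ layer_part a m0 T (Suc k) i) s1"
      using 3(1) by (simp_all add: I_def g)
    have i: "i < ?n" using 3(3) I(1) s1(1) by simp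
    note se = seed_end[OF a T k i]
    let ?acc = "xs @ layer_part a m0 T (Suc k) i"
    have n: "ints s1 ''n'' 0 = int (length ?acc)" "length ?acc \<le> length xs + i"
      using I(8) length_layer_part[OF a T, of m0 "Suc k" i] by (simp_all add: has_intervals_def)
    define Post where "Post = (\<lambda>s'. \<exists>g'. I g' s' \<and> (case g' of (i, f, e) \<Rightarrow> (?n - i) + (T - f) + (T - e)) + 0 + 1
        \<le> (case g of (i, f, e) \<Rightarrow> (?n - i) + (T - f) + (T - e)))"
    have PostI: "Post s'" if "I (i', f', e') s'" "(?n - i') + (T - f') + (T - e') < (?n - i) + (T - f) + (T - e)" for i' f' e' s'
      unfolding Post_def g using that by (intro exI[of _ "(i', f', e')"]) simp
    have iW: "int i < W" using i W by linarith
    have "wp W upd emit_body Post s1"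
    proof (cases "real (f + 1) \<le> real i * ?s")
      case True
      then have f: "f + 1 \<le> T" using se bnd by linarith
      have "I (i, Suc f, e) (set_int ''fl'' 0 (int f + 1) s1)"
        using I True f i by (simp add: I_def has_intervals_def state_simps)
      then have "Post (set_int ''fl'' 0 (int f + 1) s1)" by (rule PostI) (use f in linarith)
      then show ?thesis
        using True I(1-5) s1 W f iW unfolding emit_body_def by simp
    next
      case f: False
      show ?thesis
      proof (cases "real e < real i * ?s + ?l")
        case True
        then have e: "e + 1 \<le> T" using se by linarith
        have "I (i, f, Suc e) (set_int ''ce'' 0 (int e + 1) s1)"
          using I True e i by (simp add: I_def has_intervals_def state_simps)
        then have "Post (set_int ''ce'' 0 (int e + 1) s1)" by (rule PostI) (use e in linarith)
        then show ?thesis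
          using True f I(1-5) s1 W e iW unfolding emit_body_def by simp
      next
        case False
        have "\<lfloor>real i * ?s\<rfloor> = int f" using f I(6) by (intro floor_unique) auto
        moreover have "\<lceil>real i * ?s + ?l\<rceil> = int e" using False I(7) by (intro ceiling_unique) auto
        ultimately have fe: "seed_interval a T (Suc k) i = (f, e)" by (simp add: seed_interval_def)
        then have part: "layer_part a m0 T (Suc k) (Suc i) =
            layer_part a m0 T (Suc k) i @ (if m0 \<le> e - f then [(f, e)] else [])"
          by (simp add: layer_part_def)
        have "f \<le> e" using f I(6) False bnd by linarith
        have fi: "real f \<le> real (Suc i) * ?s" "real e < real (Suc i) * ?s + ?l + 1"
          using I(6,7) bnd(6) by (simp_all add: algebra_simps)
        show ?thesis
        proof (cases "m0 \<le> e - f")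
          case True
          have "I (Suc i, f, e) (set_int ''i'' 0 (int i + 1) (set_int ''n'' 0 (int (length ?acc) + 1)
              (set_int ''R'' (length ?acc) (int e) (set_int ''L'' (length ?acc) (int f) s1))))"
            using I fi i True unfolding I_def has_intervals_def
            by (auto simp: part state_simps nth_append less_Suc_eq simp del: append_assoc simp flip: append_assoc)
          then have "Post (set_int ''i'' 0 (int i + 1) (set_int ''n'' 0 (int (length ?acc) + 1)
              (set_int ''R'' (length ?acc) (int e) (set_int ''L'' (length ?acc) (int f) s1))))"
            by (rule PostI) (use i in linarith)
          moreover have "int m0 \<le> int e - int f" using True \<open>f \<le> e\<close> by linarith
          ultimately show ?thesis
            using False f I(1-5) s1 W i iW n \<open>f \<le> e\<close> unfolding emit_body_def
            by (simp add: state_simps nat_offset)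
        next
          case m: False
          have "I (Suc i, f, e) (set_int ''i'' 0 (int i + 1) s1)"
            using I fi i m by (simp add: I_def part has_intervals_def state_simps)
          then have "Post (set_int ''i'' 0 (int i + 1) s1)" by (rule PostI) (use i in linarith)
          moreover have "\<not> int m0 \<le> int e - int f" using m \<open>f \<le> e\<close> by linarith
          ultimately show ?thesis
            using False f I(1-5) s1 W i iW n \<open>f \<le> e\<close> unfolding emit_body_def
            by (simp add: state_simps)
        qed
      qed
    qed
    then show ?case unfolding Post_def by (rule run_wp)
  next
    case (4 g s1)
    obtain i f e where g: "g = (i, f, e)" by (cases g)
    have "ints s1 ''nk'' 0 = int ?n" using 4(2) s by (simp add: unchanged_ints emit_body_def)
    then have "i = ?n" using 4(1,3) by (auto simp: I_def g)
    then show ?case using 4(1) by (simp add: I_def g)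
  next
    case 5
    then show ?case using bnd by simp
  qed auto
qed

lemma generate_run:
  assumes a: "1 / 2 \<le> a" "a < 1" and T: "2 \<le> T"
    and s: "ints s ''T'' 0 = int T" "ints s ''m0'' 0 = int m0" "reals s ''a'' 0 = a"
    and W: "2 * int T + 2 < W" "int (raw_count a (num_layers a T)) < W" "int m0 \<le> W"
  shows "run W upd c generate s (num_layers a T * Suc (5 * T)) (has_intervals (seeded_list a m0 T))"
  unfolding generate_def
proof (rule run_init[where Q = "\<lambda>s'. reals s' ''p'' 0 = 1 \<and> reals s' ''q'' 0 = real T \<and> ints s' ''n'' 0 = 0"], goal_cases)
  case 1
  then show ?case using s W by (simp add: state_simps)
next
  case (2 s0)
  have s0: "ints s0 ''T'' 0 = int T" "ints s0 ''m0'' 0 = int m0" "reals s0 ''a'' 0 = a"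
    using 2(1) s by (simp_all add: unchanged_ints unchanged_reals)
  let ?K = "num_layers a T"
  show ?case
  proof (rule run_conseq[OF run_for[where n = ?K and f = "\<lambda>_. 5 * T" and
      I = "\<lambda>k s1. reals s1 ''p'' 0 = (1 / a) ^ k \<and> reals s1 ''q'' 0 = real T * a ^ k \<and>
        has_intervals (layers_upto a m0 T k) s1"]], goal_cases)
    case 1
    then show ?case using 2(2) by (simp add: has_intervals_def layers_upto_def)
  next
    case (2 k s1)
    note k = 2(1)
    have s1: "ints s1 ''T'' 0 = int T" "ints s1 ''m0'' 0 = int m0" "reals s1 ''a'' 0 = a"
      using 2(3) s0 by (simp_all add: unchanged_ints unchanged_reals generate_layer_def ceil_loop_def emit_body_def)
    note cs = ceil_scale[OF a T k] seed_num_bounds[OF a T k]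
    have x0: "0 < (1 / a) ^ k" using a by simp
    have cnt: "length (layers_upto a m0 T k) + seed_num a (Suc k) \<le> raw_count a ?K"
    proof -
      have "raw_count a k + seed_num a (Suc k) = raw_count a (Suc k)"
        by (simp add: raw_count_def[OF a T])
      also have "\<dots> \<le> raw_count a ?K"
        unfolding raw_count_def[OF a T] using k by (intro sum_mono2) auto
      finally show ?thesis using length_layers[OF a T, of m0 k] by linarith
    qed
    have sn: "int (seed_num a (Suc k)) = 2 * int (nat \<lceil>(1 / a) ^ k\<rceil>) - 1"
      using cs(1) by (simp add: seed_num_def of_nat_diff)
    \<comment> \<open>At most \<open>T\<close> increments for the ceiling of \<open>(1/a)^k\<close>
      and \<open>4 * T\<close> for emitting the intervals make up the \<open>5 * T\<close> per
      layer.\<close>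
    have "run W upd c generate_layer s1 (nat \<lceil>(1 / a) ^ k\<rceil> + (4 * T + 0))
       (\<lambda>s1. reals s1 ''p'' 0 = (1 / a) ^ Suc k \<and> reals s1 ''q'' 0 = real T * a ^ Suc k \<and>
        has_intervals (layers_upto a m0 T (Suc k)) s1)"
      unfolding generate_layer_def
    proof (rule run_init[where Q = "\<lambda>s'. ints s' ''cl'' 0 = 0"], goal_cases)
      case 1
      then show ?case using W by (simp add: state_simps)
    next
      case (2 s2)
      have p: "reals s2 ''p'' 0 = (1 / a) ^ k"
        using 2(1) \<open>reals s1 ''p'' 0 = _ \<and> _\<close> by (simp add: unchanged_reals)
      show ?case
      proof (rule run_Seq[OF ceil_loop_run[OF 2(2) p x0]], goal_cases)
        case 1
        then show ?case using cs(2) W by linarith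
      next
        case (2 s3)
        have s3: "ints s3 ''T'' 0 = int T" "ints s3 ''m0'' 0 = int m0" "reals s3 ''a'' 0 = a"
          "reals s3 ''q'' 0 = real T * a ^ k" "reals s3 ''p'' 0 = (1 / a) ^ k" "has_intervals (layers_upto a m0 T k) s3"
          using 2(1) \<open>unchanged _ s1 s2\<close> s1 \<open>reals s1 ''p'' 0 = _ \<and> _\<close>
          by (simp_all add: unchanged_ints unchanged_reals ceil_loop_def has_intervals_def)
        show ?case
        proof (rule run_init[where Q = "\<lambda>s'. ints s' ''nk'' 0 = int (seed_num a (Suc k)) \<and>
            reals s' ''sh'' 0 = seed_shift a T (Suc k) \<and> ints s' ''i'' 0 = 0 \<and> ints s' ''fl'' 0 = 0 \<and> ints s' ''ce'' 0 = 0"],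
            goal_cases)
          case 1
          have nk: "2 * int (nat \<lceil>(1 / a) ^ k\<rceil>) - 1 \<le> 1 \<longleftrightarrow> k = 0"
            using sn seed_num_eq_1[OF a T k] cs(4) by linarith
          have r: "real_of_int (2 * int (nat \<lceil>(1 / a) ^ k\<rceil>) - 1 - 1) = real (seed_num a (Suc k)) - 1"
            using sn by linarith
          have sh: "k \<noteq> 0 \<Longrightarrow> seed_shift a T (Suc k) =
             (real T - real T * a ^ k) / real_of_int (2 * int (nat \<lceil>(1 / a) ^ k\<rceil>) - 1 - 1)"
            unfolding r by (simp add: seed_shift_def seed_len_def)
          have b: "int (nat \<lceil>(1 / a) ^ k\<rceil>) \<le> int T" "1 \<le> int (nat \<lceil>(1 / a) ^ k\<rceil>)" using cs by auto
          show ?case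
          proof (cases "k = 0")
            case True
            then show ?thesis
              using s3 2(2) W sn b nk by (simp add: state_simps seed_shift_def)
          next
            case False
            define z where "z = int (nat \<lceil>(1 / a) ^ k\<rceil>)"
            have z: "ints s3 ''cl'' 0 = z" "\<not> 2 * z - 1 \<le> 1" "z \<le> int T" "1 \<le> z"
              "seed_shift a T (Suc k) = (real T - real T * a ^ k) / real_of_int (2 * z - 1 - 1)"
              "int (seed_num a (Suc k)) = 2 * z - 1"
              using 2(2) False nk b sh sn by (simp_all add: z_def)
            show ?thesis
              using s3 z W by (auto simp: state_simps)
          qed
        next
          case (2 s4)
          have s4: "ints s4 ''m0'' 0 = int m0" "reals s4 ''a'' 0 = a" "reals s4 ''p'' 0 = (1 / a) ^ k"
            "reals s4 ''q'' 0 = real T * a ^ k" "has_intervals (layers_upto a m0 T k) s4"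
            using 2(1) s3 by (simp_all add: unchanged_ints unchanged_reals has_intervals_def)
          show ?case
          proof (rule run_Seq[OF emit_run[OF a T k _ _ _ _ s4(1) _ _ s4(5)]], goal_cases)
            case (10 s5)
            have "reals s5 ''a'' 0 = a" "reals s5 ''p'' 0 = (1 / a) ^ k" "reals s5 ''q'' 0 = real T * a ^ k"
              using 10(1) s4 by (simp_all add: unchanged_reals emit_body_def)
            then show ?case
              using 10(2) W a by (intro run_wp) (simp add: state_simps has_intervals_def layers_Suc[OF a T])
          qed (use 2(2) s4 W cnt in \<open>simp_all add: seed_len_def\<close>)
        qed
      qed
    qed
    then have "run W upd c generate_layer s1 (5 * T)
       (\<lambda>s1. reals s1 ''p'' 0 = (1 / a) ^ Suc k \<and> reals s1 ''q'' 0 = real T * a ^ Suc k \<and>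
        has_intervals (layers_upto a m0 T (Suc k)) s1)"
      by (rule run_conseq) (use cs(2) in auto)
    then show ?case
      using 2(2) s1 less_layers[OF a T, of k] k W by simp
  next
    case (3 s1)
    have "ints s1 ''T'' 0 = int T"
      using 3(2) s0 by (simp add: unchanged_ints generate_layer_def ceil_loop_def emit_body_def)
    then show ?case using 3(1) less_layers[OF a T, of ?K] W by simp
  qed (simp_all add: seeded_list_def)
qed

section \<open>The whole procedure\<close>

fun key_exp :: "selection \<Rightarrow> rexp" where
  "key_exp Greedy = RCell ''G'' (IV ''v'')"
| "key_exp Narrowest = OfInt (ISub (IV ''T'') (ISub (ICell ''R'' (IV ''v'')) (ICell ''L'' (IV ''v''))))"

fun search :: "selection \<Rightarrow> com" where
  "search Greedy = greedy_search"
| "search Narrowest = narrowest_search"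

fun search_cost :: "selection \<Rightarrow> nat \<Rightarrow> interval list \<Rightarrow> nat" where
  "search_cost Greedy T xs = 2 * T + scan_cost xs + length xs"
| "search_cost Narrowest T xs = Suc (length xs) * Suc (2 * T + scan_cost xs)"

definition procedure :: "selection \<Rightarrow> com" where
  "procedure sel = generate ;; prefix_sums ;; best_splits ;; sort_intervals (key_exp sel) ;; search sel ;; finish"

definition iterations :: "selection \<Rightarrow> real \<Rightarrow> nat \<Rightarrow> nat \<Rightarrow> nat" where
  "iterations sel a m0 T = (let xs = seeded_list a m0 T in
     num_layers a T * Suc (5 * T) + (T + (scan_cost xs + (length xs * (3 + floorlog 2 (length xs)) +
       (search_cost sel T xs + (2 * T + scan_cost xs))))))"

lemma search_run:
  assumes s: "prepared X T xs os s" "reals s ''pen'' 0 = PEN {}"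
    and os: "distinct os" "set os = {..<length xs}"
    and sorted: "key_sorted sel T X (map ((!) xs) os)"
    and pen: "pen_update T PEN upd" and T: "0 < T"
    and xs: "proper_intervals T xs" "xs \<noteq> []" and W: "int T + 2 < W" "2 * int (length xs) < W"
  shows "run W upd c (search sel) s (search_cost sel T xs) (\<lambda>s'. prepared X T xs os s' \<and>
     reals s' ''pen'' 0 = PEN {} \<and> best_threshold PEN T X (map ((!) xs) os) (reals s' ''bk'' 0))"
proof (cases sel)
  case Greedy
  have "sorted_wrt (\<lambda>I J. sq_gain X J \<le> sq_gain X I) (map ((!) xs) os)"
    by (rule sorted_wrt_mono_rel[OF _ sorted[unfolded key_sorted_def]])
      (auto simp: Greedy sort_key_def sq_gain_def)
  from greedy_search_run[OF s os this pen T xs W] show ?thesis by (simp add: Greedy)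
next
  case Narrowest
  from narrowest_search_run[OF s os pen T xs W] show ?thesis by (simp add: Narrowest)
qed

text \<open>Guarantees at least one interval, hence at least one threshold to start the search
  from.\<close>

lemma whole_interval_in_seeded_list:
  assumes "1 / 2 \<le> a" "a < 1" "2 \<le> T" "m0 \<le> T"
  shows "(0, T) \<in> set (seeded_list a m0 T)"
proof -
  have "(0, T) \<in> set (layer_part a m0 T 1 (seed_num a 1))"
    using assms(4) by (simp add: layer_part_def seed_num_def seed_interval_def seed_len_def)
  moreover have "1 \<in> set [1..<Suc (num_layers a T)]"
    using layer_pos[OF assms(1-3)] by auto
  ultimately show ?thesis
    unfolding seeded_list_def layers_upto_def set_concat set_map by blast
qed

lemma procedure_run:
  assumes a: "1 / 2 \<le> a" "a < 1" and m0: "2 \<le> m0" "m0 \<le> T" and pen: "pen_update T PEN upd"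
    and W: "2 * int T + 2 < W" "2 * int (raw_count a (num_layers a T)) < W"
  shows "run W upd c (procedure sel) (input_state a m0 T X (PEN {})) (iterations sel a m0 T)
     (\<lambda>s'. \<exists>S. sbs_output sel Min lex_min a m0 PEN T X S \<and> outputs s' S)"
proof -
  have T: "2 \<le> T" "0 < T" using m0 by auto
  define xs where "xs = seeded_list a m0 T"
  have xs: "proper_intervals T xs"
    unfolding xs_def seeded_list_def using proper_layers[OF a T(1) m0(1)] by simp
  have len: "length xs \<le> raw_count a (num_layers a T)"
    unfolding xs_def seeded_list_def by (rule length_layers[OF a T(1)])
  have ne: "xs \<noteq> []"
    using whole_interval_in_seeded_list[OF a T(1) m0(2)] by (auto simp: xs_def)
  have W': "int T < W" "int T + 2 < W" "int (length xs) < W" "2 * int (length xs) < W"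
    "int (raw_count a (num_layers a T)) < W" "int m0 \<le> W"
    using W len m0 by linarith+
  let ?s = "input_state a m0 T X (PEN {})"
  define key where "key i = sort_key sel T X (xs ! i)" for i
  show ?thesis
    unfolding procedure_def iterations_def Let_def xs_def[symmetric]
  proof (rule run_Seq[OF generate_run[OF a T(1) _ _ _ W(1) W'(5,6), of ?s]], goal_cases)
    case (4 s1)
    have s1: "ints s1 ''T'' 0 = int T" "reals s1 ''pen'' 0 = PEN {}" "\<And>t. t \<in> {1..T} \<Longrightarrow> reals s1 ''X'' t = X t"
      using 4(1) by (simp_all add: unchanged_ints unchanged_reals generate_def generate_layer_def ceil_loop_def
          emit_body_def input_state_def)
    have i1: "has_intervals xs s1" using 4(2) by (simp add: xs_def)
    show ?case
    proof (rule run_Seq[OF prefix_sums_run[OF s1(1,3) W'(1)]], goal_cases)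
      case (2 s2)
      have s2: "ints s2 ''T'' 0 = int T" "reals s2 ''pen'' 0 = PEN {}" "has_intervals xs s2"
        using 2(1) s1 i1 by (simp_all add: unchanged_ints unchanged_reals prefix_sums_def has_intervals_def)
      show ?case
      proof (rule run_Seq[OF best_splits_run[OF 2(2) s2(3) xs W'(1,3)]], goal_cases)
        case (1 s3)
        have s3: "ints s3 ''T'' 0 = int T" "reals s3 ''pen'' 0 = PEN {}" "has_intervals xs s3" "has_sums X T s3"
          using 1(1) s2 2(2)
          by (simp_all add: unchanged_ints unchanged_reals best_splits_def best_split_step_def try_split_def has_intervals_def has_sums_def)
        have key: "rsafe W s (key_exp sel) \<and> rval s (key_exp sel) = key i"
          if "i < length xs" "ints s ''v'' 0 = int i" "\<forall>x. x \<noteq> ''v'' \<and> x \<noteq> ''w'' \<longrightarrow> ints s x = ints s3 x"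
            "\<forall>x. x \<noteq> ''K'' \<longrightarrow> reals s x = reals s3 x" for i s
        proof -
          have e: "ints s ''T'' = ints s3 ''T''" "ints s ''L'' = ints s3 ''L''" "ints s ''R'' = ints s3 ''R''"
            "reals s ''G'' = reals s3 ''G''"
            using that(3,4) by simp_all
          show ?thesis
            using that(1,2) e s3 1(2) W' proper_nth[OF xs that(1)]
            by (cases sel) (auto simp: key_def sort_key_def has_gains_def has_intervals_def)
        qed
        \<comment> \<open>The sort marks extracted intervals by \<open>-1\<close>, so keys must be
          nonnegative: squares for greedy, and for the other method no interval is longer than
          \<open>T\<close>.\<close>
        have pos: "\<forall>i<length xs. 0 \<le> key i"
          using proper_nth[OF xs] by (cases sel) (fastforce simp: key_def sort_key_def)+
        show ?case
        proof (rule run_Seq[OF sort_intervals_run[OF s3(3) key pos xs ne W'(1,4)]], assumption+, goal_cases)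
          case (1 s4)
          then obtain os where os: "has_order key xs os s4" by blast
          have s4: "prepared X T xs os s4" "reals s4 ''pen'' 0 = PEN {}"
            using 1(1) s3 \<open>has_gains X xs s3\<close> os
            by (simp_all add: unchanged_ints unchanged_reals sort_intervals_def sort_init_def sort_build_def
                sort_extract_def extract_step_def replay_def play_def prepared_def has_intervals_def has_sums_def has_gains_def has_order_def)
          have o: "distinct os" "set os = {..<length xs}" using os by (simp_all add: has_order_def)
          have sorted: "key_sorted sel T X (map ((!) xs) os)"
            using os by (simp add: has_order_def key_sorted_def sorted_wrt_map before_def[abs_def] key_def)
          show ?case
          proof (rule run_Seq[OF search_run[OF s4 o sorted pen T(2) xs ne W'(2,4)]], goal_cases)
            case (1 s5)
            let ?ys = "map ((!) xs) os" and ?\<kappa> = "reals s5 ''bk'' 0"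
            define S where "S = splits X (sq_picks X ?\<kappa> ?ys)"
            have set_ys: "set ?ys = seeded_intervals a m0 T"
              using order_facts(2)[OF o] set_seeded_list by (simp add: xs_def)
            have sq: "(\<lambda>I. (max_gain Min X I)\<^sup>2) = sq_gain X" by (simp add: sq_gain_def fun_eq_iff)
            have "fst I + 2 \<le> snd I" if "I \<in> set ?ys" for I
              using xs that order_facts(2)[OF o] by (simp add: proper_intervals_def)
            from solution_path_eq[OF sorted this]
            have path: "solution_path sel Min lex_min X (seeded_intervals a m0 T) =
                (\<lambda>\<kappa>. splits X (sq_picks X \<kappa> ?ys)) ` sq_gain X ` set ?ys"
              unfolding set_ys[symmetric] sq .
            have "sbs_output sel Min lex_min a m0 PEN T X S"
              unfolding sbs_output_def Let_def path S_def
              using 1(2) unfolding best_threshold_def by blast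
            then show ?case
              using 1(2) unfolding S_def
              by (intro run_conseq[OF finish_run[OF _ _ refl o pen T(2) xs W'(2,4)]]) auto
          qed
        qed
      qed
    qed simp
  qed (simp_all add: input_state_def)
qed

section \<open>Complexity bounds\<close>

definition rate :: "selection \<Rightarrow> nat \<Rightarrow> real" where
  "rate sel T = (case sel of Greedy \<Rightarrow> real T * ln (real T) | Narrowest \<Rightarrow> (real T)\<^sup>2 * ln (real T))"

text \<open>Lets additive constants be absorbed into multiples of \<open>ln T\<close>.\<close>

lemma ln_ge_half: "2 \<le> T \<Longrightarrow> 1 \<le> 2 * ln (real T)"
proof -
  assume "2 \<le> T"
  then have "ln 2 \<le> ln (real T)" by simp
  then show ?thesis using ln2_ge_two_thirds by linarith
qed

text \<open>From \<open>ln 2 \<ge> 1/2\<close> the left side is at most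
  \<open>2 * ln A + 2 * ln T + 1\<close>; multiplying the constant terms by
  \<open>2 * ln T \<ge> 1\<close> gives the stated factor.\<close>

lemma floorlog_bound:
  assumes "1 \<le> N" "real N \<le> A * real T" "1 \<le> A" "2 \<le> T"
  shows "real (floorlog 2 N) \<le> (4 * ln A + 4) * ln (real T)"
proof -
  have N: "0 < real N" "0 \<le> ln (real N)" using assms(1) by auto
  have "real (floorlog 2 N) \<le> log 2 (real N) + 1"
    using assms(1) by (simp add: floorlog_def)
  also have "log 2 (real N) = ln (real N) / ln 2" by (simp add: log_def)
  also have "\<dots> \<le> ln (real N) / (1 / 2)"
    using N ln2_ge_two_thirds by (intro divide_left_mono) auto
  also have "ln (real N) \<le> ln (A * real T)" using N assms by simp
  also have "ln (A * real T) = ln A + ln (real T)" using assms by (simp add: ln_mult)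
  finally have "real (floorlog 2 N) \<le> 2 * ln A * 1 + 2 * ln (real T) + 1" by simp
  moreover have "2 * ln A * 1 \<le> 2 * ln A * (2 * ln (real T))"
    using assms(3) ln_ge_half[OF assms(4)] by (intro mult_left_mono) auto
  ultimately have "real (floorlog 2 N) \<le> 2 * ln A * (2 * ln (real T)) + 2 * ln (real T) + 2 * ln (real T)"
    using ln_ge_half[OF assms(4)] by linarith
  then show ?thesis by (simp add: algebra_simps)
qed

lemma iterations_bound:
  assumes a: "1 / 2 \<le> a" "a < 1" and m0: "2 \<le> m0"
  shows "\<exists>C\<ge>0. \<forall>T\<ge>m0. real (iterations sel a m0 T) \<le> C * rate sel T"
proof -
  define A B where "A = 3 / (1 - a)" and "B = 1 / ln (1 / a) + 2"
  define F where "F = 4 * ln A + 4"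
  have A: "1 \<le> A" using a by (simp add: A_def field_simps)
  have "0 < ln (1 / a)" using a by (intro ln_gt_zero) (simp add: field_simps)
  then have B: "0 \<le> B" by (simp add: B_def)
  have F: "0 \<le> F" using A by (simp add: F_def)
  \<comment> \<open>Everything except the search, in multiples of \<open>T * ln T\<close>:
    generation, prefix sums, best splits, sorting, and the final pass with its output, in this
    order.\<close>
  define C0 where "C0 = 6 * B + 2 + 12 * B + A * (6 + F) + 4 + 12 * B"
  have C0: "0 \<le> C0" using A B F by (simp add: C0_def)
  \<comment> \<open>For greedy the summands stem from \<open>2 * T\<close>, the scan and the number
    of picks. For narrowest over threshold, \<open>A + 1\<close> bounds the number of evaluations
    over \<open>T\<close>, and \<open>6 + 12 * B\<close> the cost of each over
    \<open>T * ln T\<close>.\<close>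
  define C where "C = C0 + (case sel of Greedy \<Rightarrow> 4 + 12 * B + 2 * A | Narrowest \<Rightarrow> (A + 1) * (6 + 12 * B))"
  have "real (iterations sel a m0 T) \<le> C * rate sel T" if "m0 \<le> T" for T
  proof -
    have T: "2 \<le> T" using that m0 by simp
    define xs where "xs = seeded_list a m0 T"
    define K where "K = real (num_layers a T)"
    define l where "l = ln (real T)"
    define u where "u = real T * l"
    have l: "1 \<le> 2 * l" using ln_ge_half[OF T] by (simp add: l_def)
    have T': "2 \<le> real T" using T by simp
    have Tu: "real T \<le> 2 * u" using mult_left_mono[OF l, of "real T"] by (simp add: u_def)
    have K: "0 \<le> K" "K \<le> B * l" using num_layers_log[OF a T] by (simp_all add: K_def B_def l_def)
    have KT: "K * real T \<le> B * u" using mult_right_mono[OF K(2), of "real T"] by (simp add: u_def ac_simps)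
    have N: "real (length xs) \<le> A * real T"
      using raw_count_bound[OF a T] length_layers[OF a T, of m0 "num_layers a T"]
      by (simp add: xs_def seeded_list_def A_def)
    have NT: "real (length xs) \<le> 2 * A * u"
      using N mult_left_mono[OF Tu, of A] A by linarith
    have "scan_cost xs \<le> num_layers a T * (12 * T)"
      using scan_cost_layers[OF a T, of "num_layers a T" m0] by (simp add: xs_def seeded_list_def)
    then have "real (scan_cost xs) \<le> K * (12 * real T)"
      unfolding K_def by (metis of_nat_le_iff of_nat_mult of_nat_numeral)
    then have sc: "real (scan_cost xs) \<le> 12 * B * u" using KT by linarith
    have gen: "real (num_layers a T * Suc (5 * T)) \<le> 6 * B * u"
    proof -
      have "real (num_layers a T * Suc (5 * T)) \<le> K * (6 * real T)"
        unfolding of_nat_mult K_def using T by (intro mult_left_mono) auto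
      then show ?thesis using KT by linarith
    qed
    have sort: "real (length xs * (3 + floorlog 2 (length xs))) \<le> A * (6 + F) * u"
    proof (cases "length xs = 0")
      case True
      then show ?thesis using A F Tu T' by simp
    next
      case False
      then have "1 \<le> length xs" by linarith
      then have "real (floorlog 2 (length xs)) \<le> F * l"
        unfolding F_def l_def by (rule floorlog_bound[OF _ N A T])
      then have "3 + real (floorlog 2 (length xs)) \<le> (6 + F) * l"
        using l by (simp add: algebra_simps)
      then have "real (length xs) * (3 + real (floorlog 2 (length xs))) \<le> (A * real T) * ((6 + F) * l)"
        using N A by (intro mult_mono) auto
      then show ?thesis by (simp add: u_def algebra_simps)
    qed
    have uT: "u \<le> real T * u" using T' Tu mult_right_mono[of 1 "real T" u] by simp
    have search: "real (search_cost sel T xs) + C0 * u \<le> C * rate sel T"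
    proof (cases sel)
      case Greedy
      then have "real (search_cost sel T xs) \<le> (4 + 12 * B + 2 * A) * u"
        using Tu sc NT by (simp add: algebra_simps)
      then show ?thesis
        using Greedy by (simp add: C_def rate_def u_def l_def algebra_simps)
    next
      case Narrowest
      have "real (Suc (length xs)) \<le> (A + 1) * real T" using N T' by (simp add: algebra_simps)
      moreover have "real (Suc (2 * T + scan_cost xs)) \<le> (6 + 12 * B) * u"
        using Tu T' sc by (simp add: algebra_simps)
      ultimately have "real (Suc (length xs)) * real (Suc (2 * T + scan_cost xs)) \<le>
          ((A + 1) * real T) * ((6 + 12 * B) * u)"
        using A by (intro mult_mono) auto
      then have "real (search_cost sel T xs) \<le> (A + 1) * (6 + 12 * B) * (real T * u)"
        using Narrowest by (simp add: algebra_simps)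
      moreover have "C0 * u \<le> C0 * (real T * u)" using uT C0 by (rule mult_left_mono)
      ultimately have "real (search_cost sel T xs) + C0 * u \<le> (C0 + (A + 1) * (6 + 12 * B)) * (real T * u)"
        by (simp add: algebra_simps)
      also have "\<dots> = C * rate sel T"
        using Narrowest by (simp add: C_def rate_def u_def l_def power2_eq_square)
      finally show ?thesis .
    qed
    have "real (iterations sel a m0 T) = real (num_layers a T * Suc (5 * T)) + real T + real (scan_cost xs) +
        real (length xs * (3 + floorlog 2 (length xs))) + real (search_cost sel T xs) + (2 * real T + real (scan_cost xs))"
      unfolding iterations_def Let_def xs_def[symmetric] by simp
    also have "\<dots> \<le> 6 * B * u + 2 * u + 12 * B * u + A * (6 + F) * u + real (search_cost sel T xs) + (4 * u + 12 * B * u)"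
      using gen Tu sc sort by linarith
    also have "\<dots> = real (search_cost sel T xs) + C0 * u"
      by (simp add: C0_def algebra_simps)
    finally show ?thesis using search by linarith
  qed
  moreover have "0 \<le> C"
    using C0 A B by (cases sel) (simp_all add: C_def)
  ultimately show ?thesis by blast
qed

theorem theorem2:
  fixes a :: real and m0 :: nat and c :: nat and sel :: selection
  assumes "1 / 2 \<le> a" and "a < 1" and "2 \<le> m0"
  shows "\<exists>(\<sigma> :: nat set \<Rightarrow> nat) (\<pi> :: interval set \<Rightarrow> interval) (prog :: com)
           (tbound :: nat \<Rightarrow> real) (mbound :: nat \<Rightarrow> real) (W :: nat \<Rightarrow> int) (d :: nat).
     tie_rule \<sigma> \<and> tie_rule \<pi> \<and>
     tbound \<in> O(\<lambda>T. case sel of Greedy \<Rightarrow> real T * ln (real T)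
                             | Narrowest \<Rightarrow> (real T)\<^sup>2 * ln (real T)) \<and>
     mbound \<in> O(\<lambda>T. real T) \<and>
     (\<lambda>T. real_of_int (W T)) \<in> O(\<lambda>T. real T ^ d) \<and>
     (\<forall>T\<ge>m0. \<forall>(M :: 'w measure) f N eps PEN upd \<omega>.
        change_point_model M T f N eps \<longrightarrow> pen_update T PEN upd \<longrightarrow> \<omega> \<in> space M \<longrightarrow>
        (let X = (\<lambda>t. f t + eps t \<omega>) in
          \<exists>s t A S.
            exec (W T) upd c prog (input_state a m0 T X (PEN {})) s t A \<and>
            sbs_output sel \<sigma> \<pi> a m0 PEN T X S \<and> outputs s S \<and>
            real t \<le> tbound T \<and> real (card A) \<le> mbound T))"
proof -
  note a = assms(1,2)
  obtain C where C: "0 \<le> C" "\<And>T. m0 \<le> T \<Longrightarrow> real (iterations sel a m0 T) \<le> C * rate sel T"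
    using iterations_bound[OF assms] by blast
  define D where "D = real (step_cost c (procedure sel))"
  \<comment> \<open>The summand 2 absorbs the 1 in \<open>1 + n\<close>, since
    \<open>1 \<le> 2 * rate sel T\<close> for \<open>T \<ge> 2\<close>.\<close>
  define tb where "tb T = D * (2 + C) * rate sel T" for T
  define B where "B = nat \<lceil>3 / (1 - a)\<rceil>"
  \<comment> \<open>\<open>W T\<close> has to exceed \<open>2 * T + 2\<close> and twice the number
    of generated intervals, which is at most \<open>B * T\<close>. Being linear in \<open>T\<close>,
    it also yields the memory bound and the exponent 1.\<close>
  define W where "W T = int ((2 * B + 4) * T + 4)" for T
  \<comment> \<open>Each name stands for one integer and one real array, hence the factor 2; each
    array contributes at most \<open>W T + 1\<close> addresses.\<close>
  define m where "m = real (2 * card (names (procedure sel)))"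
  define mb where "mb T = m * real_of_int (W T + 1)" for T
  have W_le: "real_of_int (W T + 1) \<le> real (2 * B + 9) * real T" if "1 \<le> T" for T
    using that by (simp add: W_def algebra_simps)
  have W_pos: "0 \<le> real_of_int (W T)" for T by (simp add: W_def)
  have m: "0 \<le> m" by (simp add: m_def)
  have tb: "tb \<in> O(\<lambda>T. case sel of Greedy \<Rightarrow> real T * ln (real T) | Narrowest \<Rightarrow> (real T)\<^sup>2 * ln (real T))"
    by (rule bigoI[of _ "\<bar>D * (2 + C)\<bar>"]) (simp add: tb_def rate_def abs_mult)
  have mb: "mb \<in> O(\<lambda>T. real T)"
  proof (rule bigoI[of _ "m * real (2 * B + 9)"])
    show "\<forall>\<^sub>F T in at_top. norm (mb T) \<le> m * real (2 * B + 9) * norm (real T)"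
      using eventually_ge_at_top[of 1]
    proof eventually_elim
      case (elim T)
      have "m * real_of_int (W T + 1) \<le> m * (real (2 * B + 9) * real T)"
        using W_le[OF elim] m by (rule mult_left_mono)
      moreover have "0 \<le> mb T" using m W_pos[of T] by (simp add: mb_def)
      ultimately show ?case by (simp add: mb_def mult.assoc)
    qed
  qed
  have WO: "(\<lambda>T. real_of_int (W T)) \<in> O(\<lambda>T. real T ^ 1)"
  proof (rule bigoI[of _ "real (2 * B + 9)"])
    show "\<forall>\<^sub>F T in at_top. norm (real_of_int (W T)) \<le> real (2 * B + 9) * norm (real T ^ 1)"
      using eventually_ge_at_top[of 1]
    proof eventually_elim
      case (elim T)
      show ?case using W_le[OF elim] W_pos[of T] by simp
    qed
  qed
  have main: "\<exists>s t A S. exec (W T) upd c (procedure sel) (input_state a m0 T X (PEN {})) s t A \<and>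
      sbs_output sel Min lex_min a m0 PEN T X S \<and> outputs s S \<and> real t \<le> tb T \<and> real (card A) \<le> mb T"
    if T: "m0 \<le> T" and pen: "pen_update T PEN upd" for T PEN upd X
  proof -
    have T2: "2 \<le> T" using T assms(3) by simp
    have "real (raw_count a (num_layers a T)) \<le> 3 / (1 - a) * real T"
      by (rule raw_count_bound[OF a T2])
    also have "\<dots> \<le> real B * real T"
      by (intro mult_right_mono) (simp_all add: B_def real_nat_ceiling_ge)
    finally have "real (raw_count a (num_layers a T)) \<le> real (B * T)" by simp
    then have "raw_count a (num_layers a T) \<le> B * T" by linarith
    then have W: "2 * int T + 2 < W T" "2 * int (raw_count a (num_layers a T)) < W T"
      by (simp_all add: W_def algebra_simps flip: of_nat_mult)
    obtain s t A S where run: "exec (W T) upd c (procedure sel) (input_state a m0 T X (PEN {})) s t A"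
      "t \<le> step_cost c (procedure sel) * (1 + iterations sel a m0 T)"
      "sbs_output sel Min lex_min a m0 PEN T X S" "outputs s S"
      using procedure_run[OF a assms(3) T pen W, of c sel X] unfolding run_def by blast
    have "1 \<le> 2 * rate sel T"
    proof -
      have "1 \<le> 2 * ln (real T)" by (rule ln_ge_half[OF T2])
      moreover have "1 * ln (real T) \<le> real T * ln (real T)" "1 * ln (real T) \<le> (real T)\<^sup>2 * ln (real T)"
        using T2 by (intro mult_right_mono; simp)+
      ultimately show ?thesis
        unfolding rate_def by (cases sel; simp only: selection.case)
    qed
    have "real t \<le> D * (1 + real (iterations sel a m0 T))"
      using run(2) unfolding D_def by (metis of_nat_1 of_nat_add of_nat_le_iff of_nat_mult)
    also have "\<dots> \<le> D * (2 * rate sel T + C * rate sel T)"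
      using C(2)[OF T] \<open>1 \<le> 2 * rate sel T\<close> by (intro mult_left_mono) (auto simp: D_def)
    also have "\<dots> = tb T" by (simp add: tb_def algebra_simps)
    finally have "real t \<le> tb T" .
    moreover have "real (card A) \<le> mb T"
    proof -
      have "real (card A) \<le> real (2 * card (names (procedure sel)) * (nat (W T) + 1))"
        using exec_card_cells[OF run(1)] by (simp only: of_nat_le_iff)
      also have "\<dots> = mb T" using W_pos[of T] by (simp add: mb_def m_def algebra_simps)
      finally show ?thesis .
    qed
    ultimately show ?thesis using run by blast
  qed
  show ?thesis
    unfolding Let_def
    by (rule exI[of _ Min], rule exI[of _ lex_min], rule exI[of _ "procedure sel"], rule exI[of _ tb],
        rule exI[of _ mb], rule exI[of _ W], rule exI[of _ 1])
      (use tb mb WO main in \<open>simp add: tie_rule_Min tie_rule_lex_min\<close>)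
qed

end
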